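(* Suppose that $\alpha>d$ and $\gamma:=\alpha(\tau-1)/d>1$. For $\mathrm P$-almost all configurations $\eta$, the averaged clustering coefficient $\mathrm{CC_{av}}(G):=\lim_{n\to\infty}\mathrm{CC}_n$ (limit along integers $n$) exists $P^\eta$-almost surely and does not depend on $\eta$. It is given by $$\mathrm{CC_{av}}(G)=\lim_{n\to\infty}\mathrm{CC}_n=\mathbb E_0[\mathrm{CC}(0)]>0 .$$
   Context: Model (scale-free percolation in continuum space). Fix $d\ge 1$, $\nu>0$, $\alpha>0$, $\tau>1$. The vertex set of the random graph $G$ is a homogeneous Poisson point process $\eta$ in $\mathbb R^d$ of intensity $\nu$, with law $\mathrm P$. Given $\eta$, each $x\in\eta$ receives a random weight $W_x>0$; the weights are i.i.d. with law $P$ and distribution function $F$ satisfying $1-F(w)=P(W>w)=w^{-(\tau-1)}L(w)$, where $L$ is slowly varying at $+\infty$. Given $\eta$ and the weights $(w_x)_{x\in\eta}$, each unordered pair of distinct $x,y\in\eta$ is joined by an undirected edge (written $x\leftrightarrow y$), independently over pairs, with probability $1-\exp\{-w_xw_y/\|x-y\|^{\alpha}\}$, where $\|\cdot\|$ is the Euclidean norm. $P^\eta$ denotes the quenched law of the random graph (weights and edges) given $\eta$. $\mathbb P_0:=\mathrm P\times P^{\eta\cup\{0\}}$ is the law of the graph when a vertex is added to the Poisson process at the origin $0\in\mathbb R^d$ (with its own independent weight and edges drawn by the same rule), and $\mathbb E_0$ is its expectation. For a vertex $x$, $D_x$ is its degree (number of neighbors), $\Delta_x$ is the number of triangles of the graph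 having $x$ as a vertex (i.e. the number of unordered pairs $\{y,z\}$ of distinct neighbors of $x$ with $y\leftrightarrow z$), and the local clustering coefficient is $\mathrm{CC}(x):=\frac{2\Delta_x}{D_x(D_x-1)}$, with $\mathrm{CC}(x):=0$ if $D_x\in\{0,1\}$. Let $B_n$ be the $d$-dimensional box (cube) of side-length $n$ centered at $0$, $V_n:=\eta\cap B_n$, $N_n:=|V_n|$, and $$\mathrm{CC}_n:=\frac1{N_n}\sum_{x\in V_n}\mathrm{CC}(x),$$ where $\mathrm{CC}(x)$ is computed in the full infinite graph. *)

theory Defs
  imports "HOL-Probability.Probability"
begin

section \<open>The homogeneous Poisson point process\<close>

definition locally_finite :: "'a::metric_space set \<Rightarrow> bool" where
  "locally_finite \<eta> \<longleftrightarrow> (\<forall>B. bounded B \<longrightarrow> finite (\<eta> \<inter> B))"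

definition config_space :: "'a::euclidean_space set measure" where
  "config_space = sigma {\<eta>. locally_finite \<eta>}
     {{\<eta>. locally_finite \<eta> \<and> card (\<eta> \<inter> B) = k} | B k. B \<in> sets borel \<and> bounded B}"

text \<open>
  The law of the Poisson process.  The Poisson probabilities are written out because
  \<^const>\<open>poisson_pmf\<close> requires a strictly positive rate.  A sequence of disjoint
  sets may be padded with empty sets, so finite families are included.
\<close>

definition poisson_process_law :: "real \<Rightarrow> 'a::euclidean_space set measure \<Rightarrow> bool" where
  "poisson_process_law \<nu> PP \<longleftrightarrow>
     prob_space PP \<and> sets PP = sets config_space \<and>
     (\<forall>B \<in> sets borel. bounded B \<longrightarrow>
        (\<forall>k. measure PP {\<eta> \<in> space PP. card (\<eta> \<inter> B) = k} =
             (\<nu> * measure lborel B) ^ k / fact k * exp (- (\<nu> * measure lborel B)))) \<and>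
     (\<forall>A :: nat \<Rightarrow> 'a set. disjoint_family A \<longrightarrow> (\<forall>i. A i \<in> sets borel \<and> bounded (A i)) \<longrightarrow>
        prob_space.indep_vars PP (\<lambda>_. count_space UNIV) (\<lambda>i \<eta>. card (\<eta> \<inter> A i)) UNIV)"

section \<open>The weight distribution\<close>

definition slowly_varying :: "(real \<Rightarrow> real) \<Rightarrow> bool" where
  "slowly_varying L \<longleftrightarrow>
     set_borel_measurable borel {0<..} L \<and>
     (\<forall>\<^sub>F w in at_top. 0 < L w) \<and>
     (\<forall>c>0. ((\<lambda>w. L (c * w) / L w) \<longlongrightarrow> 1) at_top)"

definition weight_distribution :: "real \<Rightarrow> (real \<Rightarrow> real) \<Rightarrow> real measure \<Rightarrow> bool" where
  "weight_distribution \<tau> L Wt \<longleftrightarrow>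
     real_distribution Wt \<and> (AE w in Wt. 0 < w) \<and>
     (\<forall>w>0. 1 - cdf Wt w = w powr (- (\<tau> - 1)) * L w)"

section \<open>The quenched law of the graph\<close>

definition pairs :: "'a set \<Rightarrow> 'a set set" where
  "pairs \<eta> = {{x, y} | x y. x \<in> \<eta> \<and> y \<in> \<eta> \<and> x \<noteq> y}"

text \<open>
  For an unordered pair \<open>e = {x, y}\<close> of distinct points, the product of the weights over \<open>e\<close>
  is \<open>w x * w y\<close> and the diameter of \<open>e\<close> is the distance of \<open>x\<close> and \<open>y\<close>
  (see \<open>edge_prob_pair\<close> below).
\<close>

definition edge_prob :: "real \<Rightarrow> ('a::euclidean_space \<Rightarrow> real) \<Rightarrow> 'a set \<Rightarrow> real" where
  "edge_prob \<alpha> w e = 1 - exp (- ((\<Prod>x\<in>e. w x) / diameter e powr \<alpha>))"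

lemma edge_prob_pair:
  fixes x y :: "'a::euclidean_space"
  assumes "x \<noteq> y"
  shows "edge_prob \<alpha> w {x, y} = 1 - exp (- (w x * w y / norm (x - y) powr \<alpha>))"
proof -
  have "diameter {x, y} = dist x y"
  proof (rule antisym)
    show "diameter {x, y} \<le> dist x y"
      by (rule diameter_le) (auto simp: dist_norm norm_minus_commute)
    show "dist x y \<le> diameter {x, y}"
      by (rule diameter_bounded_bound) auto
  qed
  with assms show ?thesis
    by (simp add: edge_prob_def dist_norm)
qed

definition edge_law ::
    "real \<Rightarrow> 'a::euclidean_space set \<Rightarrow> ('a \<Rightarrow> real) \<Rightarrow> ('a set \<Rightarrow> bool) measure" where
  "edge_law \<alpha> \<eta> w = (\<Pi>\<^sub>M e \<in> pairs \<eta>. measure_pmf (bernoulli_pmf (edge_prob \<alpha> w e)))"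

definition graph_space ::
    "'a::euclidean_space set \<Rightarrow> (('a \<Rightarrow> real) \<times> ('a set \<Rightarrow> bool)) measure" where
  "graph_space \<eta> = (\<Pi>\<^sub>M x \<in> \<eta>. borel) \<Otimes>\<^sub>M (\<Pi>\<^sub>M e \<in> pairs \<eta>. count_space UNIV)"

text \<open>
  The joint law of weights and edges given the vertex set: first draw i.i.d. weights, then,
  given the weights, independent edges.
\<close>

definition quenched_law ::
    "real \<Rightarrow> real measure \<Rightarrow> 'a::euclidean_space set \<Rightarrow>
     (('a \<Rightarrow> real) \<times> ('a set \<Rightarrow> bool)) measure" where
  "quenched_law \<alpha> Wt \<eta> =
     (\<Pi>\<^sub>M x \<in> \<eta>. Wt) \<bind> (\<lambda>w. distr (edge_law \<alpha> \<eta> w) (graph_space \<eta>) (\<lambda>E. (w, E)))"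

lemma measurable_edge_law:
  "edge_law \<alpha> \<eta> \<in> (\<Pi>\<^sub>M x \<in> \<eta>. borel) \<rightarrow>\<^sub>M prob_algebra (\<Pi>\<^sub>M e \<in> pairs \<eta>. count_space UNIV)"
proof (rule measurable_prob_algebra_generated[OF sets_PiM Int_stable_prod_algebra
      prod_algebra_sets_into_space])
  fix w :: "'a \<Rightarrow> real"
  show "prob_space (edge_law \<alpha> \<eta> w)"
    unfolding edge_law_def by (intro prob_space_PiM) (rule prob_space_measure_pmf)
  show "sets (edge_law \<alpha> \<eta> w) = sets (\<Pi>\<^sub>M e \<in> pairs \<eta>. count_space UNIV)"
    unfolding edge_law_def by (intro sets_PiM_cong) auto
next
  fix A :: "('a set \<Rightarrow> bool) set"
  assume "A \<in> prod_algebra (pairs \<eta>) (\<lambda>_. count_space UNIV)"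
  then obtain J X where A: "A = prod_emb (pairs \<eta>) (\<lambda>_. count_space UNIV) J (Pi\<^sub>E J X)"
    and J: "finite J" "J \<subseteq> pairs \<eta>"
    by (elim prod_algebraE) auto
  have "emeasure (edge_law \<alpha> \<eta> w) A =
        (\<Prod>e\<in>J. emeasure (measure_pmf (bernoulli_pmf (edge_prob \<alpha> w e))) (X e))" for w
  proof -
    have "A = prod_emb (pairs \<eta>) (\<lambda>e. measure_pmf (bernoulli_pmf (edge_prob \<alpha> w e))) J (Pi\<^sub>E J X)"
      by (simp add: A prod_emb_def)
    then show ?thesis
      unfolding edge_law_def using J
      by (simp only:) (intro emeasure_PiM_emb prob_space_measure_pmf, auto)
  qed
  moreover have "(\<lambda>w. emeasure (measure_pmf (bernoulli_pmf (edge_prob \<alpha> w e))) (X e))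
      \<in> borel_measurable (\<Pi>\<^sub>M x \<in> \<eta>. borel)" if "e \<in> J" for e
  proof -
    from that J obtain x y where e: "e = {x, y}" "x \<in> \<eta>" "y \<in> \<eta>" "x \<noteq> y"
      by (auto simp: pairs_def)
    have [measurable]: "(\<lambda>w. edge_prob \<alpha> w e) \<in> borel_measurable (\<Pi>\<^sub>M x \<in> \<eta>. borel)"
      using e(2-4) unfolding e(1) edge_prob_pair[OF e(4)] by measurable
    have pmf: "pmf (bernoulli_pmf p) b = (if b then min 1 (max 0 p) else 1 - min 1 (max 0 p))"
      for p b by (simp add: bernoulli_pmf.rep_eq)
    have "emeasure (measure_pmf (bernoulli_pmf p)) (X e) =
          ennreal (\<Sum>b\<in>X e. pmf (bernoulli_pmf p) b)" for p
      by (simp add: measure_measure_pmf_finite measure_pmf.emeasure_eq_measure)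
    then show ?thesis
      unfolding pmf by simp
  qed
  ultimately show "(\<lambda>w. emeasure (edge_law \<alpha> \<eta> w) A) \<in> borel_measurable (\<Pi>\<^sub>M x \<in> \<eta>. borel)"
    by simp
qed

lemma measurable_quenched_kernel:
  "(\<lambda>w. distr (edge_law \<alpha> \<eta> w) (graph_space \<eta>) (\<lambda>E. (w, E)))
     \<in> (\<Pi>\<^sub>M x \<in> \<eta>. borel) \<rightarrow>\<^sub>M prob_algebra (graph_space \<eta>)"
  using measurable_edge_law by (rule measurable_distr_prob_space2) (simp add: graph_space_def)

lemma quenched_law_prob_algebra:
  assumes "real_distribution Wt"
  shows "quenched_law \<alpha> Wt \<eta> \<in> space (prob_algebra (graph_space \<eta>))"
proof -
  interpret real_distribution Wt by fact
  have sets_eq: "sets (\<Pi>\<^sub>M x \<in> \<eta>. Wt) = sets (\<Pi>\<^sub>M x \<in> \<eta>. borel)"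
    by (intro sets_PiM_cong) auto
  have "prob_space (\<Pi>\<^sub>M x \<in> \<eta>. Wt)"
    by (intro prob_space_PiM) unfold_locales
  then have "(\<Pi>\<^sub>M x \<in> \<eta>. Wt) \<in> space (prob_algebra (\<Pi>\<^sub>M x \<in> \<eta>. borel))"
    by (simp add: space_prob_algebra sets_eq)
  then have const: "(\<lambda>_. \<Pi>\<^sub>M x \<in> \<eta>. Wt) \<in>
      count_space {()} \<rightarrow>\<^sub>M prob_algebra (\<Pi>\<^sub>M x \<in> \<eta>. borel)"
    by simp
  show ?thesis
    unfolding quenched_law_def
    using measurable_space[OF measurable_bind_prob_space[OF const measurable_quenched_kernel], of "()"]
    by simp
qed

section \<open>Clustering coefficients\<close>

definition edge_set :: "'a set \<Rightarrow> ('a \<Rightarrow> real) \<times> ('a set \<Rightarrow> bool) \<Rightarrow> 'a set set" where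
  "edge_set \<eta> G = {e \<in> pairs \<eta>. snd G e}"

definition neighbors :: "'a set set \<Rightarrow> 'a \<Rightarrow> 'a set" where
  "neighbors Es x = {y. {x, y} \<in> Es}"

definition degr :: "'a set set \<Rightarrow> 'a \<Rightarrow> nat" where
  "degr Es x = card (neighbors Es x)"

definition triangles :: "'a set set \<Rightarrow> 'a \<Rightarrow> nat" where
  "triangles Es x =
     card {{y, z} | y z. y \<in> neighbors Es x \<and> z \<in> neighbors Es x \<and> y \<noteq> z \<and> {y, z} \<in> Es}"

text \<open>
  A vertex of infinite degree has \<open>degr = 0\<close>, hence coefficient \<open>0\<close>; in the regime of the
  theorem this almost surely does not occur.
\<close>

definition CC :: "'a set set \<Rightarrow> 'a \<Rightarrow> real" where
  "CC Es x =
     (if degr Es x \<in> {0, 1} then 0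
      else 2 * real (triangles Es x) / (real (degr Es x) * (real (degr Es x) - 1)))"

definition box_n :: "nat \<Rightarrow> 'a::euclidean_space set" where
  "box_n n = cbox (- (real n / 2) *\<^sub>R One) ((real n / 2) *\<^sub>R One)"

definition CC_avg :: "'a::euclidean_space set \<Rightarrow> 'a set set \<Rightarrow> nat \<Rightarrow> real" where
  "CC_avg \<eta> Es n = (\<Sum>x \<in> \<eta> \<inter> box_n n. CC Es x) / real (card (\<eta> \<inter> box_n n))"

text \<open>
  Expectation under the semidirect product of the Poisson law and the quenched law on the
  configuration with the origin added.
\<close>

definition palm_expectation ::
    "'a::euclidean_space set measure \<Rightarrow> real \<Rightarrow> real measure \<Rightarrow>
     ('a set \<Rightarrow> ('a \<Rightarrow> real) \<times> ('a set \<Rightarrow> bool) \<Rightarrow> real) \<Rightarrow> real" where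
  "palm_expectation PP \<alpha> Wt f =
     (\<integral>\<eta>. (\<integral>G. f (insert 0 \<eta>) G \<partial>quenched_law \<alpha> Wt (insert 0 \<eta>)) \<partial>PP)"

end

theory Submission
  imports Defs
begin

text \<open>
  The first two moments of a sum over a window of a local, translation invariant, continuous
  functional of the Poisson process are computed on a grid of mesh \<open>1/m\<close>, where the occupied
  cells are independent, and pass to the limit by Fatou's lemma; the mean is the Palm mean of the
  functional and the variance is of the order of the volume times the interaction volume.

  Since \<open>1 - exp (- u) \<le> u powr s\<close> for \<open>0 < s \<le> 1\<close> and the weights have a moment of some order
  \<open>s\<close> with \<open>DIM/\<alpha> < s < \<tau> - 1\<close>, the mean connection probability decays like
  \<open>norm (x - y) powr (- \<beta>)\<close> with \<open>\<beta> = \<alpha> s > DIM\<close>.  Hence the clustering coefficient of a vertex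
  may be replaced by that of the graph restricted to a window of side \<open>j ^ q\<close> around it, while the
  vertices run over a window of side \<open>j ^ (q + 2)\<close>.  Truncated coefficients at distant vertices
  are independent given the configuration, so they concentrate around their quenched means, which
  are local functionals of the configuration.  For large \<open>q\<close> all error terms are summable in \<open>j\<close>,
  and monotonicity of the sums and of the number of vertices fills the gaps between consecutive
  windows.
\<close>

section \<open>Sequences of nonnegative integrals\<close>

text \<open>The Poisson law is given only through counts in bounded Borel sets, so a Mecke formula
  has to be built by hand. On a grid it is the splitting of one Bernoulli factor off a finite sum.
  Fatou's lemma transports only upper bounds to the process, and these suffice: what is used are
  second moments about the limit of the discrete means, and expected numbers of errors. The same
  approximations supply measurability, because a local functional is not visibly a function of
  counts.

  The exponents meet three demands. With range \<open>j ^ q\<close> and side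
  \<open>j ^ (q + 2)\<close> the normalized variance is of order
  \<open>(range / side) ^ DIM\<close>, at most a constant over \<open>j ^ 2\<close>. The expected
  share of vertices with an edge leaving their window is of order
  \<open>j powr (- q (\<beta> - DIM))\<close>, which is as small once
  \<open>q (\<beta> - DIM) \<ge> 2\<close>. Finally the growth is polynomial, so the ratio of
  consecutive volumes tends to 1. Hence second moments are enough, and no ergodic theorem is
  invoked.\<close>

lemma nn_integral_le_lim:
  fixes u :: "nat \<Rightarrow> 'b \<Rightarrow> real"
  assumes "\<And>n. u n \<in> borel_measurable M"
    and "\<And>x. x \<in> space M \<Longrightarrow> (\<lambda>n. u n x) \<longlonglongrightarrow> v x"
    and "\<And>n. (\<integral>\<^sup>+x. ennreal (u n x) \<partial>M) \<le> ennreal c"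
  shows "(\<integral>\<^sup>+x. ennreal (v x) \<partial>M) \<le> ennreal c"
proof -
  have "(\<integral>\<^sup>+x. ennreal (v x) \<partial>M) = (\<integral>\<^sup>+x. liminf (\<lambda>n. ennreal (u n x)) \<partial>M)"
    using assms(2) by (intro nn_integral_cong) (metis lim_imp_Liminf sequentially_bot tendsto_ennrealI)
  also have "\<dots> \<le> liminf (\<lambda>n. \<integral>\<^sup>+x. ennreal (u n x) \<partial>M)"
    using assms(1) by (intro nn_integral_liminf) measurable
  also have "\<dots> \<le> liminf (\<lambda>n. ennreal c)"
    by (intro Liminf_mono always_eventually allI assms(3))
  finally show ?thesis by (simp add: Liminf_const)
qed

lemma nn_integral_divide:
  assumes "f \<in> borel_measurable M" "c > 0"
  shows "(\<integral>\<^sup>+x. ennreal (f x / c) \<partial>M) = (\<integral>\<^sup>+x. ennreal (f x) \<partial>M) * ennreal (1 / c)"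
proof -
  have "(\<integral>\<^sup>+x. ennreal (f x / c) \<partial>M) = (\<integral>\<^sup>+x. ennreal (f x) * ennreal (1 / c) \<partial>M)"
    using assms(2) by (intro nn_integral_cong) (simp flip: ennreal_mult'')
  also have "\<dots> = (\<integral>\<^sup>+x. ennreal (f x) \<partial>M) * ennreal (1 / c)"
    by (rule nn_integral_multc[OF measurable_compose[OF assms(1) measurable_ennreal]])
  finally show ?thesis .
qed

lemma nn_integral_divide_le:
  assumes "f \<in> borel_measurable M" "c > 0" "(\<integral>\<^sup>+x. ennreal (f x) \<partial>M) \<le> ennreal C" "C / c \<le> C'"
  shows "(\<integral>\<^sup>+x. ennreal (f x / c) \<partial>M) \<le> ennreal C'"
proof -
  have "(\<integral>\<^sup>+x. ennreal (f x / c) \<partial>M) \<le> ennreal C * ennreal (1 / c)"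
    unfolding nn_integral_divide[OF assms(1,2)] by (intro mult_right_mono assms(3)) simp
  also have "\<dots> \<le> ennreal C'"
    using assms(2,4) by (simp add: ennreal_leI flip: ennreal_mult'')
  finally show ?thesis .
qed

lemma suminf_ennreal_finite:
  assumes "\<And>j. x j \<le> ennreal (c j)" "summable c" "\<And>j. 0 \<le> c j"
  shows "(\<Sum>j. x j) < \<infinity>"
proof -
  have "(\<Sum>j. x j) \<le> (\<Sum>j. ennreal (c j))"
    by (intro suminf_le summableI assms)
  also have "\<dots> < \<infinity>"
    using assms(2,3) by (subst suminf_ennreal2) auto
  finally show ?thesis .
qed

lemma AE_suminf_finite:
  assumes [measurable]: "\<And>j. X j \<in> borel_measurable M"
    and "\<And>j. (\<integral>\<^sup>+x. X j x \<partial>M) \<le> b j" "(\<Sum>j. b j) < \<infinity>"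
  shows "AE x in M. (\<Sum>j. X j x) \<noteq> \<infinity>"
proof (rule nn_integral_noteq_infinite)
  have "(\<integral>\<^sup>+x. (\<Sum>j. X j x) \<partial>M) \<le> (\<Sum>j. b j)"
    using assms(2) by (subst nn_integral_suminf) (auto intro!: suminf_le)
  then show "(\<integral>\<^sup>+x. (\<Sum>j. X j x) \<partial>M) \<noteq> \<infinity>"
    using assms(3) by (metis infinity_ennreal_def leD)
qed measurable

text \<open>Takes the place of Chebyshev and Borel-Cantelli: the series of the means converges, so
  the series of the variables is finite almost surely and its terms tend to 0.\<close>

lemma AE_tendsto_0:
  fixes X :: "nat \<Rightarrow> 'b \<Rightarrow> real"
  assumes "\<And>j. X j \<in> borel_measurable M" and nn: "\<And>j x. 0 \<le> X j x"
    and "\<And>j. (\<integral>\<^sup>+x. ennreal (X j x) \<partial>M) \<le> b j" "(\<Sum>j. b j) < \<infinity>"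
  shows "AE x in M. (\<lambda>j. X j x) \<longlonglongrightarrow> 0"
proof -
  have "AE x in M. (\<Sum>j. ennreal (X j x)) \<noteq> \<infinity>"
    by (rule AE_suminf_finite[OF measurable_compose[OF assms(1) measurable_ennreal] assms(3,4)])
  then show ?thesis
  proof eventually_elim
    case (elim x)
    have "summable (\<lambda>j. X j x)"
      using elim nn by (intro summable_suminf_not_top) auto
    then show ?case by (rule summable_LIMSEQ_zero)
  qed
qed

lemma measurable_finite_range:
  assumes "finite A" "\<And>x. x \<in> space M \<Longrightarrow> X x \<in> A"
    and "\<And>S. S \<in> A \<Longrightarrow> {x \<in> space M. X x = S} \<in> sets M"
  shows "X \<in> measurable M (count_space UNIV)"
proof -
  have "X \<in> measurable M (count_space A)"
  proof (subst measurable_count_space_eq2[OF assms(1)], intro conjI ballI)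
    fix S assume "S \<in> A"
    then show "X -` {S} \<inter> space M \<in> sets M"
      using assms(3)[of S] by (simp add: vimage_def Int_def conj_commute)
  qed (use assms in auto)
  from measurable_compose[OF this, of "\<lambda>x. x" "count_space UNIV"] show ?thesis
    by simp
qed

lemma prod_split_if:
  fixes f g :: "'b \<Rightarrow> 'c::comm_monoid_mult"
  assumes "finite A" "S \<subseteq> A"
  shows "(\<Prod>c\<in>A. if c \<in> S then f c else g c) = (\<Prod>c\<in>S. f c) * (\<Prod>c\<in>A - S. g c)"
  using assms by (simp add: prod.If_cases Int_absorb1 Diff_eq)

text \<open>Serves twice: for the occupied cells of a grid and for the open edges among finitely
  many pairs.\<close>

lemma integral_indicator_partition:
  fixes F :: "'s \<Rightarrow> real"
  assumes "prob_space M" "finite A" "\<And>x. x \<in> space M \<Longrightarrow> X x \<in> A"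
    and "\<And>S. S \<in> A \<Longrightarrow> {x \<in> space M. X x = S} \<in> sets M"
  shows "(\<integral>x. F (X x) \<partial>M) = (\<Sum>S\<in>A. measure M {x \<in> space M. X x = S} * F S)"
proof -
  interpret prob_space M by fact
  have "(\<integral>x. F (X x) \<partial>M) = (\<integral>x. (\<Sum>S\<in>A. indicator {x \<in> space M. X x = S} x * F S) \<partial>M)"
  proof (intro Bochner_Integration.integral_cong refl)
    fix x assume x: "x \<in> space M"
    then have "(\<Sum>S\<in>A. indicator {x \<in> space M. X x = S} x * F S) = (\<Sum>S\<in>A. if S = X x then F S else 0)"
      by (intro sum.cong) (auto simp: indicator_def)
    then show "F (X x) = (\<Sum>S\<in>A. indicator {x \<in> space M. X x = S} x * F S)"
      using assms(2,3) x by simp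
  qed
  also have "\<dots> = (\<Sum>S\<in>A. measure M {x \<in> space M. X x = S} * F S)"
  proof -
    have "integrable M (\<lambda>x. indicator {x \<in> space M. X x = S} x * F S)" if "S \<in> A" for S
      using assms(4)[OF that] by (intro integrable_mult_left integrable_real_indicator) (auto simp: emeasure_eq_measure)
    then show ?thesis
      using assms(4) by (subst Bochner_Integration.integral_sum) (auto intro!: sum.cong)
  qed
  finally show ?thesis .
qed

section \<open>Independent Bernoulli sums\<close>

text \<open>The expectation of \<open>F\<close> at a random subset of \<open>A\<close> that contains
  each \<open>e\<close> independently with probability \<open>p e\<close>. Occupied cells, and edges
  given the weights, are both of this kind, so one finite calculus serves both layers of
  randomness.\<close>

definition bern :: "('e \<Rightarrow> real) \<Rightarrow> 'e set \<Rightarrow> ('e set \<Rightarrow> real) \<Rightarrow> real" where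
  "bern p A F = (\<Sum>S\<in>Pow A. (\<Prod>e\<in>S. p e) * (\<Prod>e\<in>A - S. 1 - p e) * F S)"

lemma bern_empty [simp]: "bern p {} F = F {}"
  by (simp add: bern_def)

text \<open>Conditioning on whether \<open>a\<close> belongs to the random set; the calculus rests
  on this recursion.\<close>

lemma bern_insert:
  assumes "finite A" "a \<notin> A"
  shows "bern p (insert a A) F = p a * bern p A (\<lambda>S. F (insert a S)) + (1 - p a) * bern p A F"
proof -
  have fin: "finite S" if "S \<in> Pow A" for S
    using that assms(1) finite_subset by auto
  have "inj_on (insert a) (Pow A)"
    using assms(2) by (auto simp: inj_on_def)
  moreover have "Pow A \<inter> insert a ` Pow A = {}"
    using assms(2) by auto
  ultimately have "bern p (insert a A) F =
     (\<Sum>S\<in>Pow A. (\<Prod>e\<in>S. p e) * (\<Prod>e\<in>insert a A - S. 1 - p e) * F S) +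
     (\<Sum>S\<in>Pow A. (\<Prod>e\<in>insert a S. p e) * (\<Prod>e\<in>insert a A - insert a S. 1 - p e) * F (insert a S))"
    unfolding bern_def Pow_insert using assms(1)
    by (subst sum.union_disjoint) (auto simp: sum.reindex)
  also have "(\<Sum>S\<in>Pow A. (\<Prod>e\<in>S. p e) * (\<Prod>e\<in>insert a A - S. 1 - p e) * F S) = (1 - p a) * bern p A F"
    unfolding bern_def sum_distrib_left
  proof (intro sum.cong refl)
    fix S assume S: "S \<in> Pow A"
    then have "insert a A - S = insert a (A - S)" "a \<notin> A - S" "finite (A - S)"
      using assms by auto
    then show "(\<Prod>e\<in>S. p e) * (\<Prod>e\<in>insert a A - S. 1 - p e) * F S
       = (1 - p a) * ((\<Prod>e\<in>S. p e) * (\<Prod>e\<in>A - S. 1 - p e) * F S)"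
      by simp
  qed
  also have "(\<Sum>S\<in>Pow A. (\<Prod>e\<in>insert a S. p e) * (\<Prod>e\<in>insert a A - insert a S. 1 - p e) * F (insert a S))
     = p a * bern p A (\<lambda>S. F (insert a S))"
    unfolding bern_def sum_distrib_left
  proof (intro sum.cong refl)
    fix S assume S: "S \<in> Pow A"
    then have "insert a A - insert a S = A - S" "a \<notin> S" "finite S"
      using assms fin by auto
    then show "(\<Prod>e\<in>insert a S. p e) * (\<Prod>e\<in>insert a A - insert a S. 1 - p e) * F (insert a S)
       = p a * ((\<Prod>e\<in>S. p e) * (\<Prod>e\<in>A - S. 1 - p e) * F (insert a S))"
      by simp
  qed
  finally show ?thesis by simp
qed

lemma bern_cong:
  assumes "\<And>e. e \<in> A \<Longrightarrow> p e = q e" "\<And>S. S \<subseteq> A \<Longrightarrow> F S = G S"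
  shows "bern p A F = bern q A G"
  unfolding bern_def using assms by (intro sum.cong refl arg_cong2[where f = "(*)"] prod.cong) auto

lemma bern_cmult: "bern p A (\<lambda>S. c * F S) = c * bern p A F"
  by (simp add: bern_def sum_distrib_left algebra_simps)

lemma bern_add: "bern p A (\<lambda>S. F S + G S) = bern p A F + bern p A G"
  by (simp add: bern_def sum.distrib algebra_simps)

lemma bern_const: "finite A \<Longrightarrow> bern p A (\<lambda>S. c) = c"
  by (induction A rule: finite_induct) (auto simp: bern_insert algebra_simps)

lemma bern_mono:
  assumes "\<And>e. e \<in> A \<Longrightarrow> 0 \<le> p e \<and> p e \<le> 1" "\<And>S. S \<subseteq> A \<Longrightarrow> F S \<le> G S"
  shows "bern p A F \<le> bern p A G"
  unfolding bern_def using assms by (intro sum_mono mult_left_mono mult_nonneg_nonneg prod_nonneg) auto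

lemma bern_nonneg:
  assumes "\<And>e. e \<in> A \<Longrightarrow> 0 \<le> p e \<and> p e \<le> 1" "\<And>S. S \<subseteq> A \<Longrightarrow> 0 \<le> F S"
  shows "0 \<le> bern p A F"
  unfolding bern_def using assms by (intro sum_nonneg mult_nonneg_nonneg prod_nonneg) auto

lemma bern_le_1:
  assumes "finite A" "\<And>e. e \<in> A \<Longrightarrow> 0 \<le> p e \<and> p e \<le> 1" "\<And>S. S \<subseteq> A \<Longrightarrow> F S \<le> 1"
  shows "bern p A F \<le> 1"
  using bern_mono[of A p F "\<lambda>_. 1"] assms by (simp add: bern_const)

text \<open>Independence of the parts of the random set in disjoint index sets. The induction
  generalizes \<open>F\<close>, because revealing \<open>a\<close> turns it into
  \<open>\<lambda>S. F (insert a S)\<close>.\<close>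

lemma bern_prod:
  assumes "finite A" "finite B" "A \<inter> B = {}"
  shows "bern p (A \<union> B) (\<lambda>S. F (S \<inter> A) * G (S \<inter> B)) = bern p A F * bern p B G"
  using assms(1,3)
proof (induction A arbitrary: F rule: finite_induct)
  case empty
  have "bern p B (\<lambda>S. F {} * G (S \<inter> B)) = bern p B (\<lambda>S. F {} * G S)"
    by (rule bern_cong) (auto simp: Int_absorb2)
  then show ?case by (simp add: bern_cmult)
next
  case (insert a A)
  have 1: "bern p (A \<union> B) (\<lambda>S. F (insert a S \<inter> insert a A) * G (insert a S \<inter> B)) =
    bern p (A \<union> B) (\<lambda>S. F (insert a (S \<inter> A)) * G (S \<inter> B))"
    using insert.prems by (intro bern_cong) (auto intro!: arg_cong2[where f = "(*)"] arg_cong[where f = F] arg_cong[where f = G])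
  have 2: "bern p (A \<union> B) (\<lambda>S. F (S \<inter> insert a A) * G (S \<inter> B)) =
    bern p (A \<union> B) (\<lambda>S. F (S \<inter> A) * G (S \<inter> B))"
    using insert.prems insert.hyps by (intro bern_cong) (auto intro!: arg_cong2[where f = "(*)"] arg_cong[where f = F])
  have "bern p (insert a A \<union> B) (\<lambda>S. F (S \<inter> insert a A) * G (S \<inter> B)) =
     p a * (bern p A (\<lambda>S. F (insert a S)) * bern p B G) + (1 - p a) * (bern p A F * bern p B G)"
    using insert by (simp only: Un_insert_left, subst bern_insert) (auto simp: assms(2) 1 2 insert.IH[where F = "\<lambda>S. F (insert a S)"])
  also have "\<dots> = bern p (insert a A) F * bern p B G"
    using insert by (simp add: bern_insert algebra_simps)
  finally show ?case .
qed

text \<open>The marginal on \<open>A\<close>: the product formula with the constant 1 on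
  \<open>B - A\<close>.\<close>

lemma bern_restrict:
  assumes "finite B" "A \<subseteq> B"
  shows "bern p B (\<lambda>S. F (S \<inter> A)) = bern p A F"
  using bern_prod[of A "B - A" p F "\<lambda>_. 1"] assms finite_subset[OF assms(2,1)]
  by (simp add: bern_const Un_absorb1)

lemma bern_reindex:
  assumes "inj_on f A"
  shows "bern p (f ` A) F = bern (\<lambda>e. p (f e)) A (\<lambda>S. F (f ` S))"
proof -
  have "inj_on ((`) f) (Pow A)"
    by (meson assms inj_on_image_Pow)
  moreover have "f ` A - f ` S = f ` (A - S)" if "S \<subseteq> A" for S
    using assms that by (simp add: inj_on_image_set_diff)
  moreover have "inj_on f S" "inj_on f (A - S)" if "S \<subseteq> A" for S
    using assms that by (auto intro: inj_on_subset)
  ultimately show ?thesis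
    unfolding bern_def image_Pow_surj[OF refl, symmetric]
    by (subst sum.reindex) (auto intro!: sum.cong simp: prod.reindex)
qed

text \<open>The discrete Mecke formula: requiring \<open>a\<close> costs the factor
  \<open>p a\<close> and leaves the other elements with their own law.\<close>

lemma bern_mem:
  assumes "finite A" "a \<in> A"
  shows "bern p A (\<lambda>S. if a \<in> S then F (S - {a}) else 0) = p a * bern p (A - {a}) F"
proof -
  have *: "bern p (insert a (A - {a})) (\<lambda>S. if a \<in> S then F (S - {a}) else 0)
    = p a * bern p (A - {a}) (\<lambda>S. F (insert a S - {a})) + (1 - p a) * bern p (A - {a}) (\<lambda>S. if a \<in> S then F (S - {a}) else 0)"
    using assms by (subst bern_insert) auto
  have "bern p (A - {a}) (\<lambda>S. F (insert a S - {a})) = bern p (A - {a}) F"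
    by (rule bern_cong) (auto intro!: arg_cong[where f = F])
  moreover have "bern p (A - {a}) (\<lambda>S. if a \<in> S then F (S - {a}) else 0) = bern p (A - {a}) (\<lambda>_. 0)"
    by (rule bern_cong) auto
  ultimately show ?thesis
    using * assms by (simp add: insert_absorb bern_const)
qed

lemma tendsto_bern:
  assumes "\<And>e. e \<in> A \<Longrightarrow> ((\<lambda>m. p m e) \<longlongrightarrow> q e) M"
  shows "((\<lambda>m. bern (p m) A F) \<longlongrightarrow> bern q A F) M"
  unfolding bern_def using assms by (intro tendsto_intros) auto

lemma borel_measurable_bern [measurable (raw)]:
  assumes "\<And>e. e \<in> A \<Longrightarrow> (\<lambda>w. p w e) \<in> borel_measurable M"
  shows "(\<lambda>w. bern (p w) A F) \<in> borel_measurable M"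
  unfolding bern_def using assms by (intro borel_measurable_sum borel_measurable_times borel_measurable_prod) auto

text \<open>The bound is free of \<open>p\<close>, so it dominates the integrands when weights or
  positions vary.\<close>

lemma bern_bound:
  assumes "\<And>e. e \<in> A \<Longrightarrow> 0 \<le> p e \<and> p e \<le> 1"
  shows "\<bar>bern p A F\<bar> \<le> (\<Sum>S\<in>Pow A. \<bar>F S\<bar>)"
  unfolding bern_def
proof (rule order_trans[OF sum_abs], rule sum_mono)
  fix S assume "S \<in> Pow A"
  then have "(\<Prod>e\<in>S. p e) * (\<Prod>e\<in>A - S. 1 - p e) \<le> 1" "0 \<le> (\<Prod>e\<in>S. p e) * (\<Prod>e\<in>A - S. 1 - p e)"
    using assms by (auto intro!: mult_le_one prod_le_1 prod_nonneg mult_nonneg_nonneg)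
  then show "\<bar>(\<Prod>e\<in>S. p e) * (\<Prod>e\<in>A - S. 1 - p e) * F S\<bar> \<le> \<bar>F S\<bar>"
    by (simp add: abs_mult mult_left_le_one_le)
qed

section \<open>Windows and discretization\<close>

definition window :: "nat \<Rightarrow> 'a::euclidean_space \<Rightarrow> 'a set" where
  "window r x = {y. \<forall>i\<in>Basis. - real r \<le> (y - x) \<bullet> i \<and> (y - x) \<bullet> i < real r}"

definition disc :: "nat \<Rightarrow> 'a::euclidean_space \<Rightarrow> 'a" where
  "disc m x = (\<Sum>i\<in>Basis. (of_int \<lfloor>real m * (x \<bullet> i)\<rfloor> / real m) *\<^sub>R i)"

abbreviation grid :: "nat \<Rightarrow> 'a::euclidean_space set" where
  "grid m \<equiv> range (disc m)"

lemma disc_inner: "i \<in> Basis \<Longrightarrow> disc m x \<bullet> i = of_int \<lfloor>real m * (x \<bullet> i)\<rfloor> / real m"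
  unfolding disc_def by (subst inner_sum_left_Basis) auto

lemma disc_0 [simp]: "disc m 0 = 0"
  by (simp add: disc_def)

lemma grid_iff:
  assumes "m > 0"
  shows "c \<in> grid m \<longleftrightarrow> (\<forall>i\<in>Basis. real m * (c \<bullet> i) \<in> \<int>)"
proof
  assume "c \<in> grid m"
  then show "\<forall>i\<in>Basis. real m * (c \<bullet> i) \<in> \<int>"
    using assms by (auto simp: disc_inner)
next
  assume *: "\<forall>i\<in>Basis. real m * (c \<bullet> i) \<in> \<int>"
  have "disc m c = c"
    by (rule euclidean_eqI) (use * assms in \<open>auto simp: disc_inner elim!: Ints_cases\<close>)
  then show "c \<in> grid m" by (metis rangeI)
qed

lemma zero_in_grid: "0 \<in> grid m"
  using disc_0[of m] by (metis rangeI)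

lemma grid_add: "m > 0 \<Longrightarrow> c \<in> grid m \<Longrightarrow> c' \<in> grid m \<Longrightarrow> c + c' \<in> grid m"
  by (auto simp: grid_iff inner_add_left distrib_left)

lemma grid_diff: "m > 0 \<Longrightarrow> c \<in> grid m \<Longrightarrow> c' \<in> grid m \<Longrightarrow> c - c' \<in> grid m"
  by (auto simp: grid_iff inner_diff_left right_diff_distrib)

lemma window_mono: "r \<le> s \<Longrightarrow> window r x \<subseteq> window s x"
  by (fastforce simp: window_def)

lemma window_self: "r > 0 \<Longrightarrow> x \<in> window r x"
  by (simp add: window_def)

lemma bounded_window: "bounded (window r x)"
proof (rule bounded_subset[OF bounded_cbox])
  show "window r x \<subseteq> cbox (x - real r *\<^sub>R One) (x + real r *\<^sub>R One)"
    by (auto simp: window_def mem_box algebra_simps inner_add_left inner_diff_left less_imp_le)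
qed

lemma window_trans: "y \<in> window r x \<Longrightarrow> z \<in> window s y \<Longrightarrow> z \<in> window (r + s) x"
  by (force simp: window_def inner_diff_left)

text \<open>Two numbers in \<open>[-r, r)\<close> differ by less than \<open>2 r\<close>; twice the
  range is therefore the distance at which dependence ends.\<close>

lemma window_disjoint: "y \<notin> window (2 * r) x \<Longrightarrow> window r x \<inter> window r y = {}"
  by (fastforce simp: window_def inner_diff_left)

lemma window_translate: "(+) a ` window r x = window r (a + x)"
proof (intro set_eqI iffI)
  fix y assume "y \<in> window r (a + x)"
  then have "y - a \<in> window r x" by (simp add: window_def algebra_simps)
  then show "y \<in> (+) a ` window r x" by (rule rev_image_eqI) simp
qed (auto simp: window_def)

lemma norm_ge_outside_window:
  assumes "y \<notin> window r x"
  shows "real r \<le> norm (x - y)"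
proof -
  obtain i where i: "i \<in> Basis" "\<not> (- real r \<le> (y - x) \<bullet> i \<and> (y - x) \<bullet> i < real r)"
    using assms by (auto simp: window_def)
  then have "real r \<le> \<bar>(y - x) \<bullet> i\<bar>" by auto
  also have "\<dots> \<le> norm (y - x)" using i by (intro Basis_le_norm)
  finally show ?thesis by (simp add: norm_minus_commute)
qed

lemma in_some_window:
  fixes x y :: "'a::euclidean_space"
  obtains k :: nat where "y \<in> window k x"
proof -
  obtain k where k: "norm (y - x) < real k" using reals_Archimedean2 by blast
  have "\<bar>(y - x) \<bullet> i\<bar> < real k" if "i \<in> Basis" for i
    using Basis_le_norm[OF that, of "y - x"] k by linarith
  then have "y \<in> window k x" by (force simp: window_def abs_less_iff)
  then show ?thesis by (rule that)
qed

text \<open>Since \<open>k\<close> is an integer, windows are unions of grid cells, so that discretization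
  creates no boundary effects.\<close>

lemma disc_in_window_0:
  assumes "m > 0"
  shows "disc m x \<in> window k 0 \<longleftrightarrow> x \<in> window k 0"
proof -
  have less: "of_int \<lfloor>real m * t\<rfloor> / real m < of_int l \<longleftrightarrow> t < of_int l" for t l
  proof -
    have "of_int \<lfloor>real m * t\<rfloor> / real m < of_int l \<longleftrightarrow> (of_int \<lfloor>real m * t\<rfloor> :: real) < of_int (int m * l)"
      using assms by (simp add: field_simps)
    also have "\<dots> \<longleftrightarrow> real m * t < real m * of_int l"
      unfolding of_int_less_iff floor_less_iff by simp
    finally show ?thesis using assms by simp
  qed
  show ?thesis
    using less[of _ "int k"] less[of _ "- int k"] by (simp add: window_def disc_inner not_less[symmetric])
qed

lemma floor_div_tendsto: "(\<lambda>m. of_int \<lfloor>real m * t\<rfloor> / real m) \<longlonglongrightarrow> t"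
proof (rule tendsto_sandwich)
  show "\<forall>\<^sub>F m in sequentially. t - 1 / real m \<le> of_int \<lfloor>real m * t\<rfloor> / real m"
    using eventually_gt_at_top[of 0]
  proof eventually_elim
    case (elim m)
    have "real m * t - 1 \<le> of_int \<lfloor>real m * t\<rfloor>" by linarith
    then have "(real m * t - 1) / real m \<le> of_int \<lfloor>real m * t\<rfloor> / real m"
      by (rule divide_right_mono) simp
    then show ?case using elim by (simp add: diff_divide_distrib)
  qed
  show "\<forall>\<^sub>F m in sequentially. of_int \<lfloor>real m * t\<rfloor> / real m \<le> t"
    using eventually_gt_at_top[of 0]
  proof eventually_elim
    case (elim m)
    have "of_int \<lfloor>real m * t\<rfloor> \<le> real m * t" by linarith
    then show ?case using elim by (simp add: field_simps)
  qed
  show "(\<lambda>m. t - 1 / real m) \<longlonglongrightarrow> t"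
    by (rule tendsto_eq_rhs, rule tendsto_diff[OF tendsto_const lim_1_over_n]) simp
qed auto

lemma disc_tendsto: "(\<lambda>m. disc m x) \<longlonglongrightarrow> x"
proof -
  have "(\<lambda>m. disc m x) \<longlonglongrightarrow> (\<Sum>i\<in>Basis. (x \<bullet> i) *\<^sub>R i)"
    unfolding disc_def by (intro tendsto_intros floor_div_tendsto)
  then show ?thesis by (simp add: euclidean_representation)
qed

lemma eventually_disc_inj:
  assumes "finite S"
  shows "\<forall>\<^sub>F m in sequentially. inj_on (disc m) S"
proof -
  have "\<forall>\<^sub>F m in sequentially. \<forall>x\<in>S. \<forall>y\<in>S. x \<noteq> y \<longrightarrow> disc m x \<noteq> disc m y"
  proof (intro eventually_ball_finite assms ballI)
    fix x y :: 'a
    show "\<forall>\<^sub>F m in sequentially. x \<noteq> y \<longrightarrow> disc m x \<noteq> disc m y"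
    proof (cases "x = y")
      case False
      have "\<forall>\<^sub>F m in sequentially. disc m x - disc m y \<noteq> 0"
        by (rule tendsto_imp_eventually_ne[OF tendsto_diff[OF disc_tendsto disc_tendsto]]) (simp add: False)
      then show ?thesis by (rule eventually_mono) simp
    qed simp
  qed
  then show ?thesis by eventually_elim (unfold inj_on_def, blast)
qed

text \<open>Convergence alone does not decide points on the boundary of a window. A strict
  inequality \<open>s - t < l\<close> survives for fine meshes as an open condition; its negation is
  preserved by every mesh, because \<open>l\<close> is an integer and the floor commutes with adding
  \<open>m * l\<close>.\<close>

lemma eventually_disc_in_window:
  "\<forall>\<^sub>F m in sequentially. disc m y \<in> window K (disc m x) \<longleftrightarrow> y \<in> window K x"
proof -
  have ev: "\<forall>\<^sub>F m in sequentially. of_int \<lfloor>real m * s\<rfloor> / real m - of_int \<lfloor>real m * t\<rfloor> / real m < of_int l \<longleftrightarrow> s - t < of_int l"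
    for s t :: real and l
  proof (cases "s - t < of_int l")
    case True
    have "\<forall>\<^sub>F m in sequentially. of_int \<lfloor>real m * s\<rfloor> / real m - of_int \<lfloor>real m * t\<rfloor> / real m < of_int l"
      using True by (rule order_tendstoD(2)[OF tendsto_diff[OF floor_div_tendsto floor_div_tendsto]])
    then show ?thesis using True by simp
  next
    case False
    show ?thesis using eventually_gt_at_top[of 0]
    proof eventually_elim
      case (elim m)
      have "real m * s \<ge> real m * (t + of_int l)"
        using False elim by (intro mult_left_mono) auto
      then have "real m * s \<ge> real m * t + of_int (int m * l)"
        by (simp add: distrib_left)
      then have "\<lfloor>real m * s\<rfloor> \<ge> \<lfloor>real m * t\<rfloor> + int m * l"
        by (metis floor_add_int floor_mono)
      then have "of_int \<lfloor>real m * s\<rfloor> \<ge> of_int \<lfloor>real m * t\<rfloor> + real m * of_int l"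
        by (simp flip: of_int_le_iff[where 'a = real])
      then show ?case using False elim by (simp add: field_simps)
    qed
  qed
  have "\<forall>\<^sub>F m in sequentially. \<forall>i\<in>Basis.
     ((disc m y - disc m x) \<bullet> i < - real K \<longleftrightarrow> (y - x) \<bullet> i < - real K) \<and>
     ((disc m y - disc m x) \<bullet> i < real K \<longleftrightarrow> (y - x) \<bullet> i < real K)"
    using ev[of _ _ "- int K"] ev[of _ _ "int K"]
    by (intro eventually_ball_finite ballI eventually_conj) (simp_all add: inner_diff_left disc_inner)
  then show ?thesis
    by eventually_elim (auto simp: window_def not_less[symmetric])
qed

section \<open>Local sums under rounding of the configuration\<close>

lemma locally_finite_window: "locally_finite \<eta> \<Longrightarrow> finite (\<eta> \<inter> window r x)"
  by (simp add: locally_finite_def bounded_window)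

lemma disc_image_Int_window_0:
  "m > 0 \<Longrightarrow> disc m ` \<eta> \<inter> window k 0 = disc m ` (\<eta> \<inter> window k 0)"
  by (auto simp: disc_in_window_0)

text \<open>The configuration is infinite, so pointwise statements give no common \<open>m\<close>.
  But any point that is relevant before or after rounding lies in \<open>window (k + K) 0\<close>,
  and the finitely many pairs of points there decide everything.\<close>

lemma eventually_disc_image_Int_window:
  assumes "locally_finite \<eta>"
  shows "\<forall>\<^sub>F m in sequentially. \<forall>x\<in>\<eta> \<inter> window k 0.
    disc m ` \<eta> \<inter> window K (disc m x) = disc m ` (\<eta> \<inter> window K x)"
proof -
  let ?X = "\<eta> \<inter> window (k + K) 0"
  have "\<forall>\<^sub>F m in sequentially. \<forall>x\<in>?X. \<forall>y\<in>?X.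
      disc m y \<in> window K (disc m x) \<longleftrightarrow> y \<in> window K x"
    using assms by (intro eventually_ball_finite ballI eventually_disc_in_window locally_finite_window)
  then show ?thesis using eventually_gt_at_top[of 0]
  proof eventually_elim
    case (elim m)
    show ?case
    proof (intro ballI)
      fix x assume x: "x \<in> \<eta> \<inter> window k 0"
      then have x': "x \<in> ?X" using window_mono[of k "k + K"] by auto
      have "y \<in> ?X" if "y \<in> \<eta>" "y \<in> window K x" for y
        using that x window_trans[of x k 0 y K] by simp
      moreover have "y \<in> ?X" if "y \<in> \<eta>" "disc m y \<in> window K (disc m x)" for y
      proof -
        have "disc m x \<in> window k 0" using x elim by (simp add: disc_in_window_0)
        then have "disc m y \<in> window (k + K) 0"
          using window_trans[of "disc m x" k 0 "disc m y" K] that by simp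
        then show ?thesis using that(1) elim disc_in_window_0 by blast
      qed
      ultimately show "disc m ` \<eta> \<inter> window K (disc m x) = disc m ` (\<eta> \<inter> window K x)"
        using elim x' by blast
    qed
  qed
qed

text \<open>Continuity only along the roundings of one finite configuration: this is what the
  passage from the grid to the process uses, and it spares a topology on configurations.\<close>

definition disc_continuous :: "('a::euclidean_space set \<Rightarrow> 'a \<Rightarrow> real) \<Rightarrow> bool" where
  "disc_continuous F \<longleftrightarrow>
    (\<forall>X x. finite X \<longrightarrow> x \<in> X \<longrightarrow> (\<lambda>m. F (disc m ` X) (disc m x)) \<longlonglongrightarrow> F X x)"

text \<open>For a fine mesh no two points of the finite window share a cell and the neighbourhoods
  correspond, so the sum over cells is the sum over points with displaced arguments.
  \<open>K > 0\<close> puts each point into its own window, as continuity at a marked point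
  requires.\<close>

lemma disc_sum_tendsto:
  assumes "locally_finite \<eta>" "disc_continuous F" "K > 0"
  shows "(\<lambda>m. \<Sum>c\<in>disc m ` \<eta> \<inter> window k 0. F (disc m ` \<eta> \<inter> window K c) c)
     \<longlonglongrightarrow> (\<Sum>x\<in>\<eta> \<inter> window k 0. F (\<eta> \<inter> window K x) x)"
proof (rule Lim_transform_eventually)
  let ?V = "\<eta> \<inter> window k 0"
  show "(\<lambda>m. \<Sum>x\<in>?V. F (disc m ` (\<eta> \<inter> window K x)) (disc m x))
     \<longlonglongrightarrow> (\<Sum>x\<in>?V. F (\<eta> \<inter> window K x) x)"
    using assms by (intro tendsto_sum) (auto simp: disc_continuous_def locally_finite_window window_self)
  show "\<forall>\<^sub>F m in sequentially. (\<Sum>x\<in>?V. F (disc m ` (\<eta> \<inter> window K x)) (disc m x)) =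
      (\<Sum>c\<in>disc m ` \<eta> \<inter> window k 0. F (disc m ` \<eta> \<inter> window K c) c)"
    using eventually_disc_image_Int_window[OF assms(1), of k K]
      eventually_disc_inj[OF locally_finite_window[OF assms(1)], of k 0] eventually_gt_at_top[of 0]
  proof eventually_elim
    case (elim m)
    then show ?case
      by (simp add: disc_image_Int_window_0 sum.reindex)
  qed
qed

text \<open>Serves to count grid points: half-open windows give exactly \<open>2 * k * m\<close>
  values per coordinate, without boundary corrections.\<close>

lemma bij_betw_grid_window_0:
  assumes "m > 0"
  shows "bij_betw (\<lambda>c. \<lambda>i\<in>Basis. \<lfloor>real m * (c \<bullet> i)\<rfloor>)
    (grid m \<inter> window k (0::'a::euclidean_space)) (\<Pi>\<^sub>E i\<in>(Basis::'a set). {- int (k * m)..<int (k * m)})"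
proof (rule bij_betwI)
  let ?g = "\<lambda>v :: 'a \<Rightarrow> int. \<Sum>i\<in>Basis. (of_int (v i) / real m) *\<^sub>R i :: 'a"
  have g: "?g v \<bullet> i = of_int (v i) / real m" if "i \<in> Basis" for v i
    using that by (subst inner_sum_left_Basis) auto
  show "(\<lambda>c. \<lambda>i\<in>Basis. \<lfloor>real m * (c \<bullet> i)\<rfloor>) \<in>
     grid m \<inter> window k 0 \<rightarrow> (\<Pi>\<^sub>E i\<in>(Basis::'a set). {- int (k * m)..<int (k * m)})"
  proof (rule Pi_I)
    fix c :: 'a assume c: "c \<in> grid m \<inter> window k 0"
    have "\<lfloor>real m * (c \<bullet> i)\<rfloor> \<in> {- int (k * m)..<int (k * m)}" if "i \<in> Basis" for i
    proof -
      have "- real k \<le> c \<bullet> i" "c \<bullet> i < real k" using c that by (auto simp: window_def)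
      then have "real m * (- real k) \<le> real m * (c \<bullet> i)" "real m * (c \<bullet> i) < real m * real k"
        using assms by (simp_all only: mult_le_cancel_left mult_less_cancel_left) auto
      then show ?thesis
        by (simp add: le_floor_iff floor_less_iff mult.commute)
    qed
    then show "(\<lambda>i\<in>Basis. \<lfloor>real m * (c \<bullet> i)\<rfloor>) \<in> (\<Pi>\<^sub>E i\<in>(Basis::'a set). {- int (k * m)..<int (k * m)})"
      unfolding restrict_PiE_iff by blast
  qed
  show "?g \<in> (\<Pi>\<^sub>E i\<in>(Basis::'a set). {- int (k * m)..<int (k * m)}) \<rightarrow> grid m \<inter> window k 0"
  proof (intro Pi_I IntI)
    fix v assume v: "v \<in> (\<Pi>\<^sub>E i\<in>(Basis::'a set). {- int (k * m)..<int (k * m)})"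
    show "?g v \<in> grid m" using assms by (auto simp: grid_iff g)
    show "?g v \<in> window k 0"
      unfolding window_def
    proof (safe)
      fix i :: 'a assume i: "i \<in> Basis"
      then have v1: "- int (k * m) \<le> v i" and v2: "v i < int (k * m)" using PiE_mem[OF v i] by auto
      have "real_of_int (- int (k * m)) \<le> of_int (v i)" "real_of_int (v i) < of_int (int (k * m))"
        using v1 v2 by (simp_all only: of_int_le_iff of_int_less_iff)
      then show "- real k \<le> (?g v - 0) \<bullet> i" "(?g v - 0) \<bullet> i < real k"
        using i assms by (simp_all add: g field_simps)
    qed
  qed
  show "?g (\<lambda>i\<in>Basis. \<lfloor>real m * (c \<bullet> i)\<rfloor>) = c" if "c \<in> grid m \<inter> window k 0" for c
  proof (rule euclidean_eqI)
    fix i :: 'a assume i: "i \<in> Basis"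
    have "real m * (c \<bullet> i) \<in> \<int>" using that i assms grid_iff by blast
    then have "of_int \<lfloor>real m * (c \<bullet> i)\<rfloor> = real m * (c \<bullet> i)" by simp
    then show "?g (\<lambda>i\<in>Basis. \<lfloor>real m * (c \<bullet> i)\<rfloor>) \<bullet> i = c \<bullet> i"
      using i assms by (simp only: g restrict_apply' simp_thms) simp
  qed
  show "(\<lambda>i\<in>Basis. \<lfloor>real m * (?g v \<bullet> i)\<rfloor>) = v"
    if "v \<in> (\<Pi>\<^sub>E i\<in>(Basis::'a set). {- int (k * m)..<int (k * m)})" for v
  proof (rule extensionalityI[of _ Basis])
    fix i :: 'a assume i: "i \<in> Basis"
    show "(\<lambda>i\<in>Basis. \<lfloor>real m * (?g v \<bullet> i)\<rfloor>) i = v i"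
      using i assms by (simp only: g restrict_apply' simp_thms) simp
  qed (use that in \<open>auto simp: PiE_def\<close>)
qed

lemma finite_grid_window_0: "m > 0 \<Longrightarrow> finite (grid m \<inter> window k (0::'a::euclidean_space))"
  using bij_betw_finite[OF bij_betw_grid_window_0, of m k] by (simp add: finite_PiE)

lemma card_grid_window_0:
  "m > 0 \<Longrightarrow> card (grid m \<inter> window k (0::'a::euclidean_space)) = (2 * k * m) ^ DIM('a)"
  using bij_betw_same_card[OF bij_betw_grid_window_0[where 'a = 'a], of m k]
  by (simp add: card_PiE nat_mult_distrib mult.assoc)

lemma grid_window_translate:
  fixes c :: "'a::euclidean_space"
  assumes "m > 0" "c \<in> grid m"
  shows "(+) c ` (grid m \<inter> window r 0) = grid m \<inter> window r c"
proof -
  have "(+) c ` (grid m \<inter> window r 0) = (+) c ` grid m \<inter> window r c"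
    using window_translate[of c r 0] image_Int[OF inj_on_add] by (metis add.right_neutral)
  also have "(+) c ` grid m = (grid m :: 'a set)"
  proof (intro equalityI subsetI)
    fix y :: 'a assume "y \<in> grid m"
    then have "y - c \<in> grid m" by (intro grid_diff assms)
    then show "y \<in> (+) c ` grid m" by (rule rev_image_eqI) simp
  qed (use assms grid_add in blast)
  finally show ?thesis .
qed

lemma finite_grid_window: "m > 0 \<Longrightarrow> c \<in> grid m \<Longrightarrow> finite (grid m \<inter> window k c)"
  by (metis finite_grid_window_0 finite_imageI grid_window_translate)

lemma card_grid_window:
  "m > 0 \<Longrightarrow> c \<in> grid m \<Longrightarrow>
    card (grid m \<inter> window k (c::'a::euclidean_space)) = (2 * k * m) ^ DIM('a)"
  by (metis card_grid_window_0 card_image grid_window_translate inj_on_add)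

section \<open>Grid cells and their volume\<close>

definition cell :: "nat \<Rightarrow> 'a::euclidean_space \<Rightarrow> 'a set" where
  "cell m c = {y. disc m y = c}"

lemma cell_eq:
  assumes "m > 0" "c \<in> grid m"
  shows "cell m c = {y. \<forall>i\<in>Basis. c \<bullet> i \<le> y \<bullet> i \<and> y \<bullet> i < c \<bullet> i + 1 / real m}"
proof -
  have "of_int \<lfloor>real m * t\<rfloor> / real m = c \<bullet> i \<longleftrightarrow> c \<bullet> i \<le> t \<and> t < c \<bullet> i + 1 / real m"
    if "i \<in> Basis" for t i
  proof -
    have "real m * (c \<bullet> i) \<in> \<int>" using assms that grid_iff by blast
    then obtain z where z: "real m * (c \<bullet> i) = of_int z" by (auto elim: Ints_cases)
    have "of_int \<lfloor>real m * t\<rfloor> / real m = c \<bullet> i \<longleftrightarrow> of_int \<lfloor>real m * t\<rfloor> = real m * (c \<bullet> i)"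
      using assms(1) by (auto simp: field_simps)
    also have "\<dots> \<longleftrightarrow> \<lfloor>real m * t\<rfloor> = z" by (simp add: z)
    also have "\<dots> \<longleftrightarrow> real m * (c \<bullet> i) \<le> real m * t \<and> real m * t < real m * (c \<bullet> i) + 1"
      unfolding z by (auto simp: floor_eq_iff)
    also have "\<dots> \<longleftrightarrow> c \<bullet> i \<le> t \<and> t < c \<bullet> i + 1 / real m"
      using assms(1) by (auto simp: field_simps)
    finally show ?thesis .
  qed
  then show ?thesis
    unfolding cell_def by (subst euclidean_eq_iff) (auto simp: disc_inner)
qed

lemma cell_borel: "m > 0 \<Longrightarrow> c \<in> grid m \<Longrightarrow> cell m c \<in> sets borel"
  unfolding cell_eq by measurable

lemma cell_subset_cbox:
  assumes "m > 0" "c \<in> grid m"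
  shows "cell m c \<subseteq> cbox c (c + (1 / real m) *\<^sub>R One)"
  unfolding cell_eq[OF assms] by (auto simp: mem_box inner_add_left less_imp_le)

lemma bounded_cell: "m > 0 \<Longrightarrow> c \<in> grid m \<Longrightarrow> bounded (cell m c)"
  by (rule bounded_subset[OF bounded_cbox cell_subset_cbox])

lemma measure_cell:
  assumes "m > 0" "c \<in> grid m"
  shows "measure lborel (cell m (c::'a::euclidean_space)) = (1 / real m) ^ DIM('a)"
proof (rule antisym)
  have "box c (c + (1 / real m) *\<^sub>R One) \<subseteq> cell m c"
    unfolding cell_eq[OF assms] by (auto simp: mem_box inner_add_left less_imp_le)
  moreover have "cell m c \<in> fmeasurable lborel"
    using assms bounded_cell[OF assms] cell_borel[OF assms]
    by (auto intro!: fmeasurableI emeasure_bounded_finite)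
  ultimately have "measure lborel (box c (c + (1 / real m) *\<^sub>R One)) \<le> measure lborel (cell m c)"
    by (intro measure_mono_fmeasurable) auto
  then show "(1 / real m) ^ DIM('a) \<le> measure lborel (cell m c)"
    using assms by (simp add: measure_lborel_box_eq inner_add_left power_divide)
  have "measure lborel (cell m c) \<le> measure lborel (cbox c (c + (1 / real m) *\<^sub>R One))"
    using cell_subset_cbox[OF assms] cell_borel[OF assms] by (intro measure_mono_fmeasurable) auto
  then show "measure lborel (cell m c) \<le> (1 / real m) ^ DIM('a)"
    using assms by (simp add: measure_lborel_cbox_eq inner_add_left power_divide)
qed

lemma disjoint_cells: "c \<noteq> c' \<Longrightarrow> cell m c \<inter> cell m c' = {}"
  by (auto simp: cell_def)

section \<open>The discretized Poisson process\<close>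

locale poisson_process =
  fixes \<nu> :: real and PP :: "'a::euclidean_space set measure"
  assumes law: "poisson_process_law \<nu> PP" and nu_pos: "\<nu> > 0"
begin

sublocale prob_space PP
  using law by (simp add: poisson_process_law_def)

lemma space_PP: "space PP = {\<eta>. locally_finite \<eta>}"
proof -
  have "space PP = space (config_space :: 'a set measure)"
    using law by (auto simp: poisson_process_law_def dest: sets_eq_imp_space_eq)
  also have "\<dots> = {\<eta>. locally_finite \<eta>}"
    unfolding config_space_def by (rule space_measure_of) auto
  finally show ?thesis .
qed

lemma count_event:
  assumes "B \<in> sets borel" "bounded B"
  shows "{\<eta> \<in> space PP. card (\<eta> \<inter> B) = k} \<in> sets PP"
proof -
  have "{\<eta>. locally_finite \<eta> \<and> card (\<eta> \<inter> B) = k} \<in> sets config_space"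
    unfolding config_space_def using assms by (subst sets_measure_of) auto
  then show ?thesis
    using law by (simp add: poisson_process_law_def space_PP)
qed

text \<open>The probability that a cell of mesh \<open>1/m\<close> holds at least one point.\<close>

definition occ :: "nat \<Rightarrow> real" where
  "occ m = 1 - exp (- (\<nu> * (1 / real m) ^ DIM('a)))"

lemma occ_range: "0 \<le> occ m" "occ m \<le> 1"
  using nu_pos by (auto simp: occ_def)

lemma occ_le: "occ m \<le> \<nu> * (1 / real m) ^ DIM('a)"
  using exp_ge_add_one_self[of "- (\<nu> * (1 / real m) ^ DIM('a))"] by (simp add: occ_def)

text \<open>The mean number of occupied cells per unit volume. Double occupation becomes negligible
  as the mesh shrinks, so the limit is the intensity.\<close>

lemma occ_tendsto: "(\<lambda>m. real m ^ DIM('a) * occ m) \<longlonglongrightarrow> \<nu>"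
proof -
  let ?t = "\<lambda>m. \<nu> * (1 / real m) ^ DIM('a)"
  have t0: "?t \<longlonglongrightarrow> 0"
    by (intro tendsto_mult_right_zero tendsto_null_power lim_1_over_n) simp
  have "((\<lambda>t::real. (1 - exp (- t)) / t) \<longlongrightarrow> 1) (at 0)"
  proof -
    have "((\<lambda>t::real. - exp (- t)) has_real_derivative 1) (at 0)"
      by (auto intro!: derivative_eq_intros)
    then show ?thesis by (simp add: has_field_derivative_iff)
  qed
  moreover have "filterlim ?t (at 0) sequentially"
    unfolding filterlim_at using t0 nu_pos
    by (auto intro!: eventually_mono[OF eventually_gt_at_top[of 0]])
  ultimately have "(\<lambda>m. (1 - exp (- ?t m)) / ?t m) \<longlonglongrightarrow> 1"
    by (rule filterlim_compose)
  then have "(\<lambda>m. \<nu> * ((1 - exp (- ?t m)) / ?t m)) \<longlonglongrightarrow> \<nu> * 1"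
    by (intro tendsto_mult tendsto_const)
  moreover have "\<forall>\<^sub>F m in sequentially. \<nu> * ((1 - exp (- ?t m)) / ?t m) = real m ^ DIM('a) * occ m"
    using eventually_gt_at_top[of 0]
    by eventually_elim (use nu_pos in \<open>simp add: occ_def power_divide\<close>)
  ultimately show ?thesis by (simp add: Lim_transform_eventually)
qed

lemma disc_mem_iff:
  assumes "m > 0" "\<eta> \<in> space PP" "c \<in> grid m"
  shows "c \<in> disc m ` \<eta> \<longleftrightarrow> card (\<eta> \<inter> cell m c) \<noteq> 0"
proof -
  \<comment> \<open>An infinite set also has \<open>card\<close> equal to 0, so local finiteness is
    what makes a nonzero count equivalent to occupation.\<close>
  have "finite (\<eta> \<inter> cell m c)"
    using assms bounded_cell[of m c] by (auto simp: space_PP locally_finite_def)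
  then show ?thesis by (auto simp: cell_def)
qed

lemma prob_cell_empty:
  assumes "m > 0" "c \<in> grid m"
  shows "prob {\<eta> \<in> space PP. card (\<eta> \<inter> cell m c) = 0} = 1 - occ m"
  using law cell_borel[OF assms] bounded_cell[OF assms]
  by (simp add: poisson_process_law_def measure_cell[OF assms] occ_def)

lemma prob_cell_nonempty:
  assumes "m > 0" "c \<in> grid m"
  shows "prob {\<eta> \<in> space PP. card (\<eta> \<inter> cell m c) \<noteq> 0} = occ m"
proof -
  have "{\<eta> \<in> space PP. card (\<eta> \<inter> cell m c) \<noteq> 0} = space PP - {\<eta> \<in> space PP. card (\<eta> \<inter> cell m c) = 0}"
    by auto
  then show ?thesis
    using prob_compl[OF count_event[OF cell_borel[OF assms] bounded_cell[OF assms], of 0]]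
    by (simp add: prob_cell_empty[OF assms])
qed

text \<open>Occupation of a cell is decided by its count, and counts in disjoint cells are
  independent; this turns the Poisson law into \<open>bern\<close> sums.\<close>

lemma prob_disc:
  assumes "m > 0" "finite A" "A \<subseteq> grid m" "S \<subseteq> A"
  shows "{\<eta> \<in> space PP. disc m ` \<eta> \<inter> A = S} \<in> events" (is ?th1)
    and "prob {\<eta> \<in> space PP. disc m ` \<eta> \<inter> A = S} = (\<Prod>c\<in>S. occ m) * (\<Prod>c\<in>A - S. 1 - occ m)" (is ?th2)
proof -
  obtain f where f: "bij_betw f {0..<card A} A"
    using ex_bij_betw_nat_finite[OF assms(2)] by blast
  define n where "n = card A"
  \<comment> \<open>The law speaks of sequences of sets: the cells are enumerated and the sequence
    is continued by empty sets.\<close>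
  define B where "B i = (if i < n then cell m (f i) else {})" for i
  define E where "E i = (if f i \<in> S then UNIV - {0::nat} else {0})" for i
  have A_eq: "A = f ` {..<n}"
    using f by (simp add: bij_betw_def n_def atLeast0LessThan)
  have ball_A: "(\<forall>c\<in>A. Q c) \<longleftrightarrow> (\<forall>i<n. Q (f i))" for Q
    using A_eq by (metis imageE image_eqI lessThan_iff)
  have fA: "f i \<in> A" "f i \<in> grid m" if "i < n" for i
    using f that assms(3) by (auto simp: bij_betw_def n_def)
  have "disjoint_family B"
    unfolding disjoint_family_on_def
  proof (intro ballI impI)
    fix i j :: nat assume "i \<noteq> j"
    then have "f i \<noteq> f j" if "i < n" "j < n"
      using that inj_onD[OF bij_betw_imp_inj_on[OF f], of i j] by (auto simp: n_def)
    then show "B i \<inter> B j = {}"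
      using disjoint_cells[of "f i" "f j" m] by (simp add: B_def)
  qed
  moreover have Bb: "B i \<in> sets borel \<and> bounded (B i)" for i
    using fA(2)[of i] cell_borel[OF assms(1), of "f i"] bounded_cell[OF assms(1), of "f i"] by (auto simp: B_def)
  ultimately have ind: "indep_vars (\<lambda>_. count_space UNIV) (\<lambda>i \<eta>. card (\<eta> \<inter> B i)) UNIV"
    using law unfolding poisson_process_law_def by blast
  have eq: "disc m ` \<eta> \<inter> A = S \<longleftrightarrow> (\<forall>i<n. card (\<eta> \<inter> B i) \<in> E i)" if "\<eta> \<in> space PP" for \<eta>
  proof -
    have "disc m ` \<eta> \<inter> A = S \<longleftrightarrow> (\<forall>c\<in>A. c \<in> disc m ` \<eta> \<longleftrightarrow> c \<in> S)"
      using assms(4) by auto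
    also have "\<dots> \<longleftrightarrow> (\<forall>i<n. f i \<in> disc m ` \<eta> \<longleftrightarrow> f i \<in> S)"
      by (rule ball_A)
    also have "\<dots> \<longleftrightarrow> (\<forall>i<n. card (\<eta> \<inter> cell m (f i)) \<noteq> 0 \<longleftrightarrow> f i \<in> S)"
    proof -
      have "f i \<in> disc m ` \<eta> \<longleftrightarrow> card (\<eta> \<inter> cell m (f i)) \<noteq> 0" if "i < n" for i
        by (rule disc_mem_iff[OF assms(1) \<open>\<eta> \<in> space PP\<close> fA(2)[OF that]])
      then show ?thesis by metis
    qed
    also have "\<dots> \<longleftrightarrow> (\<forall>i<n. card (\<eta> \<inter> B i) \<in> E i)"
      by (auto simp: B_def E_def)
    finally show ?thesis .
  qed
  have rv: "(\<lambda>\<eta>. card (\<eta> \<inter> B i)) \<in> measurable PP (count_space UNIV)" for i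
    using ind by (simp add: indep_vars_def)
  have set_eq: "{\<eta> \<in> space PP. disc m ` \<eta> \<inter> A = S} = {\<eta> \<in> space PP. \<forall>i\<in>{..<n}. card (\<eta> \<inter> B i) \<in> E i}"
    using eq by (intro Collect_cong conj_cong refl) (simp add: Ball_def)
  show ?th1
    unfolding set_eq
  proof (rule sets.sets_Collect_finite_All)
    fix i
    show "{\<eta> \<in> space PP. card (\<eta> \<inter> B i) \<in> E i} \<in> events"
      using measurable_sets[OF rv, of "E i" i] by (simp add: vimage_def Int_def conj_commute)
  qed simp
  have prob_i: "prob ((\<lambda>\<eta>. card (\<eta> \<inter> B i)) -` E i \<inter> space PP) = (if f i \<in> S then occ m else 1 - occ m)"
    if "i < n" for i
  proof -
    have "(\<lambda>\<eta>. card (\<eta> \<inter> B i)) -` E i \<inter> space PP =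
      (if f i \<in> S then {\<eta> \<in> space PP. card (\<eta> \<inter> cell m (f i)) \<noteq> 0} else {\<eta> \<in> space PP. card (\<eta> \<inter> cell m (f i)) = 0})"
      using that by (auto simp: E_def B_def)
    then show ?thesis
      using prob_cell_nonempty[OF assms(1) fA(2)[OF that]] prob_cell_empty[OF assms(1) fA(2)[OF that]]
      by simp
  qed
  have "prob {\<eta> \<in> space PP. disc m ` \<eta> \<inter> A = S} = (\<Prod>i<n. if f i \<in> S then occ m else 1 - occ m)"
  \<comment> \<open>\<open>indep_varsD\<close> asks for a nonempty index set, so the empty family of
    cells is treated apart.\<close>
  proof (cases "n = 0")
    case True
    then show ?thesis unfolding set_eq by (simp add: prob_space)
  next
    case False
    then have ne: "{..<n} \<noteq> {}" by auto
    then have "{\<eta> \<in> space PP. \<forall>i\<in>{..<n}. card (\<eta> \<inter> B i) \<in> E i} =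
        (\<Inter>i\<in>{..<n}. (\<lambda>\<eta>. card (\<eta> \<inter> B i)) -` E i \<inter> space PP)"
      by auto
    then have "prob {\<eta> \<in> space PP. disc m ` \<eta> \<inter> A = S} =
        prob (\<Inter>i\<in>{..<n}. (\<lambda>\<eta>. card (\<eta> \<inter> B i)) -` E i \<inter> space PP)"
      unfolding set_eq by (rule arg_cong)
    also have "\<dots> = (\<Prod>i<n. prob ((\<lambda>\<eta>. card (\<eta> \<inter> B i)) -` E i \<inter> space PP))"
      by (rule indep_varsD[OF ind ne]) auto
    also have "\<dots> = (\<Prod>i<n. if f i \<in> S then occ m else 1 - occ m)"
      by (rule prod.cong[OF refl], rule prob_i) simp
    finally show ?thesis .
  qed
  also have "\<dots> = (\<Prod>c\<in>A. if c \<in> S then occ m else 1 - occ m)"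
    using prod.reindex_bij_betw[OF f, of "\<lambda>c. if c \<in> S then occ m else 1 - occ m"]
    by (simp only: n_def atLeast0LessThan)
  also have "\<dots> = (\<Prod>c\<in>S. occ m) * (\<Prod>c\<in>A - S. 1 - occ m)"
    by (rule prod_split_if[OF assms(2,4)])
  finally show ?th2 .
qed

lemma disc_measurable:
  assumes "m > 0" "finite A" "A \<subseteq> grid m"
  shows "(\<lambda>\<eta>. disc m ` \<eta> \<inter> A) \<in> measurable PP (count_space UNIV)"
  using assms prob_disc(1)[OF assms] by (intro measurable_finite_range[of "Pow A"]) auto

lemma expectation_disc:
  assumes "m > 0" "finite A" "A \<subseteq> grid m"
  shows "expectation (\<lambda>\<eta>. F (disc m ` \<eta> \<inter> A)) = bern (\<lambda>_. occ m) A F"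
  unfolding bern_def using assms prob_disc[OF assms] prob_space_axioms
  by (subst integral_indicator_partition[of _ "Pow A"]) auto

lemma nn_integral_disc:
  assumes "m > 0" "finite A" "A \<subseteq> grid m" "\<And>S. S \<subseteq> A \<Longrightarrow> 0 \<le> F S"
  shows "(\<integral>\<^sup>+\<eta>. ennreal (F (disc m ` \<eta> \<inter> A)) \<partial>PP) = ennreal (bern (\<lambda>_. occ m) A F)"
proof -
  have "integrable PP (\<lambda>\<eta>. F (disc m ` \<eta> \<inter> A))"
  proof (rule integrable_const_bound)
    show "AE \<eta> in PP. norm (F (disc m ` \<eta> \<inter> A)) \<le> (\<Sum>S\<in>Pow A. norm (F S))"
      using assms(2) by (intro AE_I2 member_le_sum) auto
    show "(\<lambda>\<eta>. F (disc m ` \<eta> \<inter> A)) \<in> borel_measurable PP"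
      by (rule measurable_compose[OF disc_measurable[OF assms(1-3)]]) simp
  qed
  then show ?thesis
    using assms by (subst nn_integral_eq_integral) (auto simp: expectation_disc)
qed

end

section \<open>Mean and variance of local sums on the grid\<close>

lemma bern_sum: "bern p A (\<lambda>S. \<Sum>i\<in>I. F i S) = (\<Sum>i\<in>I. bern p A (F i))"
  unfolding bern_def by (subst sum.swap) (simp add: sum_distrib_left)

lemma bern_card:
  assumes "finite A"
  shows "bern (\<lambda>_. q) A (\<lambda>S. real (card S)) = real (card A) * q"
proof -
  have "bern (\<lambda>_. q) A (\<lambda>S. real (card S)) = bern (\<lambda>_. q) A (\<lambda>S. \<Sum>c\<in>A. if c \<in> S then 1 else 0)"
  proof (rule bern_cong[OF refl])
    fix S assume "S \<subseteq> A"
    then have "A \<inter> S = S" by blast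
    then show "real (card S) = (\<Sum>c\<in>A. if c \<in> S then 1 else 0)"
      using assms by (simp add: sum.If_cases Int_def[symmetric])
  qed
  also have "\<dots> = (\<Sum>c\<in>A. q)"
    unfolding bern_sum
  proof (intro sum.cong refl)
    fix c assume "c \<in> A"
    then show "bern (\<lambda>_. q) A (\<lambda>S. if c \<in> S then 1 else 0) = q"
      using bern_mem[OF assms, of c "\<lambda>_. q" "\<lambda>_. 1"] assms by (simp add: bern_const)
  qed
  finally show ?thesis by simp
qed

definition translation_invariant :: "('a::euclidean_space set \<Rightarrow> 'a \<Rightarrow> real) \<Rightarrow> bool" where
  "translation_invariant F \<longleftrightarrow> 
    (\<forall>a X x. finite X \<longrightarrow> x \<in> X \<longrightarrow> F ((+) a ` X) (a + x) = F X x)"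

text \<open>The finite model behind the process: grid points are occupied independently with
  probability \<open>q\<close>, later \<open>occ m\<close>, and moments of local sums are finite
  sums.\<close>

locale grid_functional =
  fixes q :: real and m k K :: nat and F :: "'a::euclidean_space set \<Rightarrow> 'a \<Rightarrow> real"
  assumes m: "m > 0" and K: "K > 0" and q: "0 \<le> q" "q \<le> 1" and trans: "translation_invariant F"
begin

definition "nbh r c = grid m \<inter> window r (c::'a)"
definition "term_at c S = (if c \<in> S then F (S \<inter> window K c) c else 0)"
definition "tot S = (\<Sum>c\<in>nbh k 0. term_at c S)"
text \<open>The Palm measure of the grid model: a point is placed at 0 while all other cells keep
  their law.\<close>

definition "palm_mean = bern (\<lambda>_. q) (nbh K 0 - {0}) (\<lambda>S. F (insert 0 S) 0)"

lemma nbh_0: "finite (nbh r 0)" "card (nbh r 0) = (2 * r * m) ^ DIM('a)"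
  using finite_grid_window_0[OF m] card_grid_window_0[OF m] by (auto simp: nbh_def)

lemma nbh_grid: "c \<in> nbh r x \<Longrightarrow> c \<in> grid m"
  by (auto simp: nbh_def)

lemma nbh_sub: "c \<in> nbh k 0 \<Longrightarrow> nbh K c \<subseteq> nbh (k + K) 0"
  unfolding nbh_def using window_trans[of c k 0 _ K] by auto

lemma nbh_k_sub: "c \<in> nbh k 0 \<Longrightarrow> c \<in> nbh (k + K) 0"
  unfolding nbh_def using window_mono[of k "k + K" 0] by auto

lemma nbh_self: "c \<in> nbh k 0 \<Longrightarrow> c \<in> nbh K c"
  unfolding nbh_def using window_self[of K c] K by auto

lemma nbh_translate: "c \<in> grid m \<Longrightarrow> nbh r c = (+) c ` nbh r 0"
  unfolding nbh_def using grid_window_translate[OF m] by blast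

lemma nbh_fin: "c \<in> grid m \<Longrightarrow> finite (nbh r c)" "c \<in> grid m \<Longrightarrow> card (nbh r c) = (2 * r * m) ^ DIM('a)"
  by (simp_all add: nbh_def finite_grid_window[OF m] card_grid_window[OF m])

lemma term_local:
  assumes "c \<in> nbh k 0" "S \<subseteq> nbh (k + K) 0"
  shows "term_at c (S \<inter> nbh K c) = term_at c S"
proof -
  have "c \<in> nbh K c" by (rule nbh_self[OF assms(1)])
  moreover have "S \<inter> nbh K c \<inter> window K c = S \<inter> window K c"
    using assms(2) by (auto simp: nbh_def)
  ultimately show ?thesis by (simp add: term_at_def)
qed

text \<open>\<open>bern_mem\<close> strips off the occupied cell \<open>c\<close> at the price
  \<open>q\<close>, and translation moves the remaining average to the origin.\<close>

lemma bern_term_nbh: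
  assumes "c \<in> nbh k 0"
  shows "bern (\<lambda>_. q) (nbh K c) (term_at c) = q * palm_mean"
proof -
  have cg: "c \<in> grid m" using assms by (rule nbh_grid)
  have "bern (\<lambda>_. q) (nbh K c) (term_at c) =
     bern (\<lambda>_. q) (nbh K c) (\<lambda>S. if c \<in> S then F (insert c (S - {c})) c else 0)"
  proof (rule bern_cong[OF refl])
    fix S assume "S \<subseteq> nbh K c"
    then have "S \<inter> window K c = S" by (auto simp: nbh_def)
    then show "term_at c S = (if c \<in> S then F (insert c (S - {c})) c else 0)"
      by (simp add: term_at_def insert_absorb)
  qed
  also have "\<dots> = q * bern (\<lambda>_. q) (nbh K c - {c}) (\<lambda>S. F (insert c S) c)"
    by (rule bern_mem[OF nbh_fin(1)[OF cg] nbh_self[OF assms]])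
  also have "nbh K c - {c} = (+) c ` (nbh K 0 - {0})"
    by (subst nbh_translate[OF cg]) auto
  also have "bern (\<lambda>_. q) ((+) c ` (nbh K 0 - {0})) (\<lambda>S. F (insert c S) c) = palm_mean"
    unfolding palm_mean_def
  proof (subst bern_reindex, simp, rule bern_cong[OF refl])
    fix S assume "S \<subseteq> nbh K 0 - {0}"
    then have "finite S" using nbh_0(1) by (auto intro: finite_subset)
    then have "F ((+) c ` insert 0 S) (c + 0) = F (insert 0 S) 0"
      using trans unfolding translation_invariant_def by blast
    then show "F (insert c ((+) c ` S)) c = F (insert 0 S) 0" by simp
  qed
  finally show ?thesis .
qed

lemma bern_term:
  assumes "c \<in> nbh k 0"
  shows "bern (\<lambda>_. q) (nbh (k + K) 0) (term_at c) = q * palm_mean"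
proof -
  have "bern (\<lambda>_. q) (nbh (k + K) 0) (term_at c) = bern (\<lambda>_. q) (nbh (k + K) 0) (\<lambda>S. term_at c (S \<inter> nbh K c))"
    by (rule bern_cong[OF refl]) (simp add: term_local[OF assms])
  also have "\<dots> = bern (\<lambda>_. q) (nbh K c) (term_at c)"
    by (rule bern_restrict[OF nbh_0(1) nbh_sub[OF assms]])
  finally show ?thesis using bern_term_nbh[OF assms] by simp
qed

lemma bern_tot: "bern (\<lambda>_. q) (nbh (k + K) 0) tot = real (card (nbh k 0)) * q * palm_mean"
  unfolding tot_def bern_sum by (simp add: bern_term)

text \<open>Beyond twice the range the two neighbourhoods are disjoint, so the mean of the product
  factors and the covariance vanishes.\<close>

lemma bern_term_far:
  assumes "c \<in> nbh k 0" "c' \<in> nbh k 0" "c' \<notin> window (2 * K) c"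
  shows "bern (\<lambda>_. q) (nbh (k + K) 0) (\<lambda>S. term_at c S * term_at c' S) = (q * palm_mean) ^ 2"
proof -
  define H where "H S = term_at c (S \<inter> nbh K c) * term_at c' (S \<inter> nbh K c')" for S
  have dj: "nbh K c \<inter> nbh K c' = {}"
    using window_disjoint[OF assms(3)] by (auto simp: nbh_def)
  have "bern (\<lambda>_. q) (nbh (k + K) 0) (\<lambda>S. term_at c S * term_at c' S) =
      bern (\<lambda>_. q) (nbh (k + K) 0) (\<lambda>S. H (S \<inter> (nbh K c \<union> nbh K c')))"
  proof (rule bern_cong[OF refl])
    fix S assume S: "S \<subseteq> nbh (k + K) 0"
    have "S \<inter> (nbh K c \<union> nbh K c') \<inter> nbh K c = S \<inter> nbh K c"
      "S \<inter> (nbh K c \<union> nbh K c') \<inter> nbh K c' = S \<inter> nbh K c'" by auto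
    then show "term_at c S * term_at c' S = H (S \<inter> (nbh K c \<union> nbh K c'))"
      unfolding H_def using term_local[OF assms(1) S] term_local[OF assms(2) S] by simp
  qed
  also have "\<dots> = bern (\<lambda>_. q) (nbh K c \<union> nbh K c') H"
    using nbh_sub[OF assms(1)] nbh_sub[OF assms(2)] by (intro bern_restrict nbh_0) auto
  also have "\<dots> = bern (\<lambda>_. q) (nbh K c) (term_at c) * bern (\<lambda>_. q) (nbh K c') (term_at c')"
    unfolding H_def using dj nbh_fin(1) nbh_grid assms by (intro bern_prod) blast+
  also have "\<dots> = (q * palm_mean) ^ 2"
    using bern_term_nbh assms by (simp add: power2_eq_square)
  finally show ?thesis .
qed

text \<open>Each term is at most the occupation indicator of its cell. The second factor
  \<open>q\<close> off the diagonal is essential: a cell has of the order of \<open>m ^ DIM\<close>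
  neighbours, and only \<open>q ^ 2\<close> compensates for their number.\<close>

lemma bern_term_near:
  assumes "c \<in> nbh k 0" "c' \<in> nbh k 0"
    and "\<And>X x. finite X \<Longrightarrow> x \<in> X \<Longrightarrow> 0 \<le> F X x \<and> F X x \<le> 1"
  shows "bern (\<lambda>_. q) (nbh (k + K) 0) (\<lambda>S. term_at c S * term_at c' S) \<le> (if c = c' then q else q ^ 2)"
proof -
  let ?U = "nbh (k + K) 0"
  have ran: "0 \<le> term_at d S \<and> term_at d S \<le> (if d \<in> S then 1 else 0)" if "S \<subseteq> ?U" for S d
    using assms(3)[of "S \<inter> window K d" d] K finite_subset[OF that nbh_0(1)] window_self[of K d]
    by (auto simp: term_at_def)
  have U: "c \<in> ?U" "c' \<in> ?U" using nbh_k_sub assms by auto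
  \<comment> \<open>The bound is written as a nested condition so that \<open>bern_mem\<close> can
    strip off first \<open>c\<close> and then \<open>c'\<close>.\<close>
  have "bern (\<lambda>_. q) ?U (\<lambda>S. term_at c S * term_at c' S) \<le>
     bern (\<lambda>_. q) ?U (\<lambda>S. if c \<in> S then (if c' = c \<or> c' \<in> S - {c} then 1 else 0) else 0)"
  proof (rule bern_mono)
    fix S assume S: "S \<subseteq> ?U"
    have "term_at c S * term_at c' S \<le> (if c \<in> S then 1 else 0) * (if c' \<in> S then 1 else 0)"
      using ran[OF S, of c] ran[OF S, of c'] by (intro mult_mono) auto
    then show "term_at c S * term_at c' S \<le> (if c \<in> S then (if c' = c \<or> c' \<in> S - {c} then 1 else 0) else 0)"
      by (auto split: if_splits)
  qed (use q in auto)
  also have "\<dots> = q * bern (\<lambda>_. q) (?U - {c}) (\<lambda>S. if c' = c \<or> c' \<in> S then 1 else 0)"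
    by (rule bern_mem[OF nbh_0(1) U(1)])
  also have "\<dots> = (if c = c' then q else q ^ 2)"
  proof (cases "c = c'")
    case True
    then show ?thesis using nbh_0(1) by (simp add: bern_const)
  next
    case False
    then have "c' \<in> ?U - {c}" "finite (?U - {c})" using U nbh_0(1) by auto
    then show ?thesis
      using bern_mem[of "?U - {c}" c' "\<lambda>_. q" "\<lambda>_. 1"] False by (simp add: bern_const power2_eq_square)
  qed
  finally show ?thesis .
qed

text \<open>Diagonal pairs cost \<open>q\<close>, near pairs \<open>q ^ 2\<close>, far pairs
  nothing, and at most \<open>(4 * K * m) ^ DIM\<close> cells are near a given one. For
  \<open>q = occ m\<close> both numbers of cells times \<open>q\<close> stay bounded as the mesh
  shrinks.\<close>

lemma bern_variance:
  assumes "\<And>X x. finite X \<Longrightarrow> x \<in> X \<Longrightarrow> 0 \<le> F X x \<and> F X x \<le> 1"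
  shows "bern (\<lambda>_. q) (nbh (k + K) 0) (\<lambda>S. (tot S - real (card (nbh k 0)) * q * palm_mean) ^ 2)
    \<le> real (card (nbh k 0)) * (q + real ((4 * K * m) ^ DIM('a)) * q ^ 2)"
proof -
  let ?U = "nbh (k + K) 0" and ?C = "nbh k 0"
  define a where "a = real (card ?C) * q * palm_mean"
  have "bern (\<lambda>_. q) ?U (\<lambda>S. (tot S - a) ^ 2) =
      bern (\<lambda>_. q) ?U (\<lambda>S. (\<Sum>c\<in>?C. \<Sum>c'\<in>?C. term_at c S * term_at c' S) + ((- 2 * a) * tot S + a ^ 2))"
    by (rule bern_cong[OF refl]) (simp add: tot_def power2_eq_square sum_product[symmetric] algebra_simps)
  also have "\<dots> = (\<Sum>c\<in>?C. \<Sum>c'\<in>?C. bern (\<lambda>_. q) ?U (\<lambda>S. term_at c S * term_at c' S)) - a ^ 2"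
    unfolding bern_add bern_cmult bern_sum using nbh_0(1)
    by (simp add: bern_const bern_tot a_def power2_eq_square)
  also have "a ^ 2 = (\<Sum>c\<in>?C. \<Sum>c'\<in>?C. (q * palm_mean) ^ 2)"
    by (simp add: a_def power2_eq_square)
  also have "(\<Sum>c\<in>?C. \<Sum>c'\<in>?C. bern (\<lambda>_. q) ?U (\<lambda>S. term_at c S * term_at c' S)) - (\<Sum>c\<in>?C. \<Sum>c'\<in>?C. (q * palm_mean) ^ 2)
     = (\<Sum>c\<in>?C. \<Sum>c'\<in>?C. bern (\<lambda>_. q) ?U (\<lambda>S. term_at c S * term_at c' S) - (q * palm_mean) ^ 2)"
    by (simp only: sum_subtractf)
  also have "\<dots> \<le> (\<Sum>c\<in>?C. \<Sum>c'\<in>?C. (if c' = c then q else 0) + (if c' \<in> nbh (2 * K) c then q ^ 2 else 0))"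
  proof (intro sum_mono)
    fix c c' assume c: "c \<in> ?C" "c' \<in> ?C"
    show "bern (\<lambda>_. q) ?U (\<lambda>S. term_at c S * term_at c' S) - (q * palm_mean) ^ 2
      \<le> (if c' = c then q else 0) + (if c' \<in> nbh (2 * K) c then q ^ 2 else 0)"
    proof (cases "c' \<in> nbh (2 * K) c")
      case False
      then have "c' \<notin> window (2 * K) c" using c nbh_grid[OF c(2)] by (simp add: nbh_def)
      then show ?thesis using bern_term_far[OF c] q by simp
    next
      case True
      then show ?thesis using bern_term_near[OF c assms] q
        by (smt (verit) zero_le_power2)
    qed
  qed
  also have "\<dots> \<le> (\<Sum>c\<in>?C. q + real ((4 * K * m) ^ DIM('a)) * q ^ 2)"
  proof (intro sum_mono)
    fix c assume c: "c \<in> ?C"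
    have "(\<Sum>c'\<in>?C. if c' \<in> nbh (2 * K) c then q ^ 2 else 0) = real (card (?C \<inter> nbh (2 * K) c)) * q ^ 2"
      using nbh_0(1) by (simp add: sum.If_cases Int_def[symmetric])
    also have "\<dots> \<le> real (card (nbh (2 * K) c)) * q ^ 2"
      using nbh_fin(1)[OF nbh_grid[OF c]] by (intro mult_right_mono) (auto intro!: card_mono)
    also have "\<dots> = real ((4 * K * m) ^ DIM('a)) * q ^ 2"
      using nbh_fin(2)[OF nbh_grid[OF c], of "2 * K"] by simp
    finally show "(\<Sum>c'\<in>?C. (if c' = c then q else 0) + (if c' \<in> nbh (2 * K) c then q ^ 2 else 0))
      \<le> q + real ((4 * K * m) ^ DIM('a)) * q ^ 2"
      unfolding sum.distrib using nbh_0(1) c by simp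
  qed
  finally show ?thesis by (simp add: a_def)
qed

lemma tot_eq:
  assumes "D \<subseteq> grid m"
  shows "(\<Sum>c\<in>D \<inter> window k 0. F (D \<inter> window K c) c) = tot (D \<inter> nbh (k + K) 0)"
proof -
  have "tot (D \<inter> nbh (k + K) 0) = (\<Sum>c\<in>nbh k 0. if c \<in> D then F (D \<inter> window K c) c else 0)"
    unfolding tot_def
  proof (rule sum.cong[OF refl])
    fix c assume c: "c \<in> nbh k 0"
    have "D \<inter> nbh (k + K) 0 \<inter> window K c = D \<inter> window K c"
      using assms nbh_sub[OF c] by (auto simp: nbh_def)
    then show "term_at c (D \<inter> nbh (k + K) 0) = (if c \<in> D then F (D \<inter> window K c) c else 0)"
      using nbh_k_sub[OF c] by (simp add: term_at_def)
  qed
  also have "\<dots> = (\<Sum>c\<in>nbh k 0 \<inter> D. F (D \<inter> window K c) c)"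
    using nbh_0(1) by (simp add: sum.If_cases Int_def[symmetric])
  also have "nbh k 0 \<inter> D = D \<inter> window k 0"
    using assms by (auto simp: nbh_def)
  finally show ?thesis by simp
qed

text \<open>The insertion of 0 overwrites the cell at the origin, so this cell may be left random;
  in this form the mean is the expectation of a functional of the rounded process.\<close>

lemma palm_mean_nbh: "palm_mean = bern (\<lambda>_. q) (nbh K 0) (\<lambda>S. F (insert 0 S) 0)"
proof -
  have 0: "0 \<in> nbh K 0" using K zero_in_grid[of m] window_self[of K 0] by (auto simp: nbh_def)
  have "bern (\<lambda>_. q) (insert 0 (nbh K 0 - {0})) (\<lambda>S. F (insert 0 S) 0) = palm_mean"
    using nbh_0(1) by (subst bern_insert) (auto simp: palm_mean_def algebra_simps)
  then show ?thesis using 0 by (simp add: insert_absorb)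
qed

end

section \<open>Moments of local sums\<close>

context poisson_process
begin

definition local_sum :: "('a set \<Rightarrow> 'a \<Rightarrow> real) \<Rightarrow> nat \<Rightarrow> nat \<Rightarrow> 'a set \<Rightarrow> real" where
  "local_sum F k K \<eta> = (\<Sum>x\<in>\<eta> \<inter> window k 0. F (\<eta> \<inter> window K x) x)"

definition palm_local :: "('a set \<Rightarrow> 'a \<Rightarrow> real) \<Rightarrow> nat \<Rightarrow> real" where
  "palm_local F K = expectation (\<lambda>\<eta>. F (insert 0 (\<eta> \<inter> window K 0)) 0)"

text \<open>\<open>Suc m\<close> excludes the degenerate mesh \<open>1/0\<close>.\<close>

lemma grid_functional_occ:
  "translation_invariant F \<Longrightarrow> K > 0 \<Longrightarrow> grid_functional (occ (Suc m)) (Suc m) K F"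
  by standard (auto simp: occ_range)

lemma local_sum_disc:
  assumes "translation_invariant F" "K > 0"
  shows "local_sum F k K (disc (Suc m) ` \<eta>) =
    grid_functional.tot (Suc m) k K F (disc (Suc m) ` \<eta> \<inter> grid_functional.nbh (Suc m) (k + K) 0)"
proof -
  interpret grid_functional "occ (Suc m)" "Suc m" k K F
    by (rule grid_functional_occ[OF assms])
  show ?thesis
    unfolding local_sum_def by (rule tot_eq) auto
qed

lemma local_sum_disc_measurable:
  assumes "translation_invariant F" "K > 0"
  shows "(\<lambda>\<eta>. local_sum F k K (disc (Suc m) ` \<eta>)) \<in> borel_measurable PP"
proof -
  interpret grid_functional "occ (Suc m)" "Suc m" k K F
    by (rule grid_functional_occ[OF assms])
  show ?thesis
    unfolding local_sum_disc[OF assms] using nbh_0(1) nbh_grid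
    by (intro measurable_compose[OF disc_measurable]) auto
qed

lemma local_sum_disc_tendsto:
  assumes "disc_continuous F" "K > 0" "\<eta> \<in> space PP"
  shows "(\<lambda>m. local_sum F k K (disc (Suc m) ` \<eta>)) \<longlonglongrightarrow> local_sum F k K \<eta>"
  using LIMSEQ_Suc[OF disc_sum_tendsto[OF _ assms(1,2), of \<eta> k]] assms(3)
  unfolding local_sum_def by (simp add: space_PP)

lemma local_sum_measurable:
  assumes "disc_continuous F" "translation_invariant F" "K > 0"
  shows "local_sum F k K \<in> borel_measurable PP"
  by (rule borel_measurable_LIMSEQ_real[OF local_sum_disc_tendsto[OF assms(1,3)] local_sum_disc_measurable[OF assms(2,3)]])

lemma palm_disc_eq:
  assumes "translation_invariant F" "K > 0"
  shows "F (disc (Suc m) ` insert 0 (\<eta> \<inter> window K 0)) (disc (Suc m) 0) =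
    F (insert 0 (disc (Suc m) ` \<eta> \<inter> grid_functional.nbh (Suc m) K 0)) 0"
proof -
  interpret grid_functional "occ (Suc m)" "Suc m" k K F for k
    by (rule grid_functional_occ[OF assms])
  have "disc (Suc m) ` (\<eta> \<inter> window K 0) = disc (Suc m) ` \<eta> \<inter> nbh K 0"
    by (subst disc_image_Int_window_0[symmetric]) (auto simp: nbh_def)
  then show ?thesis by simp
qed

lemma palm_disc_measurable:
  assumes "translation_invariant F" "K > 0"
  shows "(\<lambda>\<eta>. F (disc (Suc m) ` insert 0 (\<eta> \<inter> window K 0)) (disc (Suc m) 0)) \<in> borel_measurable PP"
proof -
  interpret grid_functional "occ (Suc m)" "Suc m" k K F for k
    by (rule grid_functional_occ[OF assms])
  show ?thesis
    unfolding palm_disc_eq[OF assms] using nbh_0(1) nbh_grid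
    by (intro measurable_compose[OF disc_measurable, where g = "\<lambda>S. F (insert 0 S) 0"]) auto
qed

lemma palm_disc_tendsto:
  assumes "disc_continuous F" "\<eta> \<in> space PP"
  shows "(\<lambda>m. F (disc (Suc m) ` insert 0 (\<eta> \<inter> window K 0)) (disc (Suc m) 0))
    \<longlonglongrightarrow> F (insert 0 (\<eta> \<inter> window K 0)) 0"
proof -
  have "(\<lambda>m. F (disc m ` insert 0 (\<eta> \<inter> window K 0)) (disc m 0))
    \<longlonglongrightarrow> F (insert 0 (\<eta> \<inter> window K 0)) 0"
    using assms(1) locally_finite_window[of \<eta> K 0] assms(2)
    unfolding disc_continuous_def space_PP by blast
  then show ?thesis by (rule LIMSEQ_Suc)
qed

lemma palm_measurable:
  assumes "disc_continuous F" "translation_invariant F" "K > 0"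
  shows "(\<lambda>\<eta>. F (insert 0 (\<eta> \<inter> window K 0)) 0) \<in> borel_measurable PP"
  by (rule borel_measurable_LIMSEQ_real[OF palm_disc_tendsto[OF assms(1)] palm_disc_measurable[OF assms(2,3)]])

text \<open>The discrete Palm mean is the expectation of the functional at the rounded
  configuration, so dominated convergence applies with the bound 1.\<close>

lemma palm_mean_tendsto:
  assumes F: "disc_continuous F" "translation_invariant F" "K > 0"
    and bnd: "\<And>X x. finite X \<Longrightarrow> x \<in> X \<Longrightarrow> 0 \<le> F X x \<and> F X x \<le> 1"
  shows "(\<lambda>m. grid_functional.palm_mean (occ (Suc m)) (Suc m) K F) \<longlonglongrightarrow> palm_local F K"
proof -
  have eq: "grid_functional.palm_mean (occ (Suc m)) (Suc m) K F =
    expectation (\<lambda>\<eta>. F (disc (Suc m) ` insert 0 (\<eta> \<inter> window K 0)) (disc (Suc m) 0))" for m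
  proof -
    interpret grid_functional "occ (Suc m)" "Suc m" k K F for k
      by (rule grid_functional_occ[OF F(2,3)])
    show ?thesis
      unfolding palm_disc_eq[OF F(2,3)] palm_mean_nbh using nbh_0(1) nbh_grid
      by (intro expectation_disc[symmetric, where F = "\<lambda>S. F (insert 0 S) 0"]) auto
  qed
  show ?thesis
    unfolding eq palm_local_def
  proof (rule integral_dominated_convergence[where w = "\<lambda>_. 1"])
    show "AE \<eta> in PP. norm (F (disc (Suc m) ` insert 0 (\<eta> \<inter> window K 0)) (disc (Suc m) 0)) \<le> 1" for m
    proof (rule AE_I2)
      fix \<eta> assume "\<eta> \<in> space PP"
      then have "finite (disc (Suc m) ` insert 0 (\<eta> \<inter> window K 0))"
        using locally_finite_window by (auto simp: space_PP)
      from bnd[OF this, of "disc (Suc m) 0"]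
      show "norm (F (disc (Suc m) ` insert 0 (\<eta> \<inter> window K 0)) (disc (Suc m) 0)) \<le> 1" by simp
    qed
  qed (use palm_measurable[OF F] palm_disc_measurable[OF F(2,3)] palm_disc_tendsto[OF F(1)] in auto)
qed

lemma local_sum_disc_bound:
  fixes F :: "'a set \<Rightarrow> 'a \<Rightarrow> real" and G :: "'a set \<Rightarrow> real"
  assumes "translation_invariant F" "K > 0"
    and "\<And>S. finite S \<Longrightarrow> 0 \<le> G S"
  shows "(\<integral>\<^sup>+\<eta>. ennreal (G (disc (Suc m) ` \<eta> \<inter> grid_functional.nbh (Suc m) (k + K) 0)) \<partial>PP)
    = ennreal (bern (\<lambda>_. occ (Suc m)) (grid_functional.nbh (Suc m) (k + K) 0) G)"
proof -
  interpret grid_functional "occ (Suc m)" "Suc m" k K F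
    by (rule grid_functional_occ[OF assms(1,2)])
  show ?thesis
    using nbh_0(1) nbh_grid by (intro nn_integral_disc) (auto intro!: assms(3) intro: finite_subset)
qed

text \<open>The mesh cancels: \<open>1 - exp (- t) \<le> t\<close> turns a number of cells times
  \<open>occ m\<close> into a volume times \<open>\<nu>\<close>, uniformly in
  \<open>m\<close>.\<close>

lemma cells_times_occ_le:
  assumes "m > 0"
  shows "real ((j * m) ^ DIM('a)) * occ m \<le> real j ^ DIM('a) * \<nu>"
proof -
  have "real ((j * m) ^ DIM('a)) * occ m \<le> real ((j * m) ^ DIM('a)) * (\<nu> * (1 / real m) ^ DIM('a))"
    by (intro mult_left_mono occ_le) auto
  also have "\<dots> = real j ^ DIM('a) * \<nu>"
    using assms by (simp add: power_mult_distrib power_divide)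
  finally show ?thesis .
qed

text \<open>The mean value comes from the Mecke formula, which for the discretized process is the
  independence of the occupation of a cell from the rest of the configuration.\<close>

lemma second_moment_local_sum:
  assumes F: "disc_continuous F" "translation_invariant F" "K > 0"
    and bnd: "\<And>X x. finite X \<Longrightarrow> x \<in> X \<Longrightarrow> 0 \<le> F X x \<and> F X x \<le> 1"
  shows "(\<integral>\<^sup>+\<eta>. ennreal ((local_sum F k K \<eta> - (2 * real k) ^ DIM('a) * \<nu> * palm_local F K) ^ 2) \<partial>PP)
    \<le> ennreal ((2 * real k) ^ DIM('a) * (\<nu> + (4 * real K) ^ DIM('a) * \<nu> ^ 2))"
proof (rule nn_integral_le_lim)
  \<comment> \<open>Centering at the mean on the grid, not at its limit, makes every approximating
    second moment a true variance; the centers converge too.\<close>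
  define a where "a m = real ((2 * k * Suc m) ^ DIM('a)) * occ (Suc m) * grid_functional.palm_mean (occ (Suc m)) (Suc m) K F" for m
  let ?u = "\<lambda>m \<eta>. (local_sum F k K (disc (Suc m) ` \<eta>) - a m) ^ 2"
  show "?u m \<in> borel_measurable PP" for m
    using local_sum_disc_measurable[OF F(2,3)] by measurable
  have a: "a \<longlonglongrightarrow> (2 * real k) ^ DIM('a) * \<nu> * palm_local F K"
  proof -
    have "a = (\<lambda>m. (2 * real k) ^ DIM('a) * (real (Suc m) ^ DIM('a) * occ (Suc m)) * grid_functional.palm_mean (occ (Suc m)) (Suc m) K F)"
      unfolding a_def by (simp only: of_nat_power of_nat_mult of_nat_numeral power_mult_distrib mult.assoc)
    then show ?thesis
      by (simp only:) (intro tendsto_intros LIMSEQ_Suc[OF occ_tendsto] palm_mean_tendsto[OF F bnd])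
  qed
  show "(\<lambda>m. ?u m \<eta>) \<longlonglongrightarrow> (local_sum F k K \<eta> - (2 * real k) ^ DIM('a) * \<nu> * palm_local F K) ^ 2"
    if "\<eta> \<in> space PP" for \<eta>
    by (intro tendsto_intros a local_sum_disc_tendsto[OF F(1,3) that])
  fix m
  show "(\<integral>\<^sup>+\<eta>. ennreal (?u m \<eta>) \<partial>PP)
     \<le> ennreal ((2 * real k) ^ DIM('a) * (\<nu> + (4 * real K) ^ DIM('a) * \<nu> ^ 2))"
  proof -
    interpret grid_functional "occ (Suc m)" "Suc m" k K F
      by (rule grid_functional_occ[OF F(2,3)])
    let ?q = "occ (Suc m)"
    have "(\<integral>\<^sup>+\<eta>. ennreal (?u m \<eta>) \<partial>PP) = ennreal (bern (\<lambda>_. ?q) (nbh (k + K) 0) (\<lambda>S. (tot S - a m) ^ 2))"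
      unfolding local_sum_disc[OF F(2,3)] by (rule local_sum_disc_bound[OF F(2,3)]) simp
    also have "bern (\<lambda>_. ?q) (nbh (k + K) 0) (\<lambda>S. (tot S - a m) ^ 2)
        \<le> real (card (nbh k 0)) * (?q + real ((4 * K * Suc m) ^ DIM('a)) * ?q ^ 2)"
      using bern_variance[OF bnd] by (simp only: a_def nbh_0(2))
    also have "\<dots> = real (card (nbh k 0)) * ?q * (1 + real ((4 * K * Suc m) ^ DIM('a)) * ?q)"
      by (simp add: algebra_simps power2_eq_square)
    also have "\<dots> \<le> (real (2 * k) ^ DIM('a) * \<nu>) * (1 + real (4 * K) ^ DIM('a) * \<nu>)"
      unfolding nbh_0(2) using occ_range nu_pos
      by (intro mult_mono[OF cells_times_occ_le add_left_mono[OF cells_times_occ_le]]) auto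
    also have "\<dots> = (2 * real k) ^ DIM('a) * (\<nu> + (4 * real K) ^ DIM('a) * \<nu> ^ 2)"
      by (simp add: algebra_simps power2_eq_square)
    finally show "(\<integral>\<^sup>+\<eta>. ennreal (?u m \<eta>) \<partial>PP)
     \<le> ennreal ((2 * real k) ^ DIM('a) * (\<nu> + (4 * real K) ^ DIM('a) * \<nu> ^ 2))"
      by (simp add: ennreal_leI)
  qed
qed

text \<open>The argument is already cut to a window, so \<open>local_sum nbr_count k r\<close>
  counts ordered pairs of points within range \<open>r\<close>, the diagonal included for
  \<open>r > 0\<close>. Both quenched error terms, variance and far edges, are bounded by such
  counts.\<close>

definition nbr_count :: "'a set \<Rightarrow> 'a \<Rightarrow> real" where
  "nbr_count X x = real (card X)"

lemma disc_continuous_card: "disc_continuous nbr_count"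
  unfolding disc_continuous_def nbr_count_def
proof (intro allI impI)
  fix X :: "'a set" and x assume "finite X"
  from eventually_disc_inj[OF this] have "\<forall>\<^sub>F m in sequentially. real (card X) = real (card (disc m ` X))"
    by eventually_elim (simp add: card_image)
  then show "(\<lambda>m. real (card (disc m ` X))) \<longlonglongrightarrow> real (card X)"
    by (rule Lim_transform_eventually[OF tendsto_const])
qed

lemma translation_invariant_card: "translation_invariant nbr_count"
  by (simp add: translation_invariant_def nbr_count_def card_image)

text \<open>The functional is unbounded, so the second moment bound does not cover it. Its Palm mean
  is 1 for the point itself plus the expected number of other occupied cells.\<close>

lemma first_moment_nbr_count:
  assumes "r > 0"
  shows "(\<integral>\<^sup>+\<eta>. ennreal (local_sum nbr_count k r \<eta>) \<partial>PP)
    \<le> ennreal ((2 * real k) ^ DIM('a) * (\<nu> + (2 * real r) ^ DIM('a) * \<nu> ^ 2))"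
proof (rule nn_integral_le_lim)
  note F = disc_continuous_card translation_invariant_card assms
  let ?u = "\<lambda>m \<eta>. local_sum nbr_count k r (disc (Suc m) ` \<eta>)"
  show "?u m \<in> borel_measurable PP" for m
    by (rule local_sum_disc_measurable[OF F(2,3)])
  show "(\<lambda>m. ?u m \<eta>) \<longlonglongrightarrow> local_sum nbr_count k r \<eta>" if "\<eta> \<in> space PP" for \<eta>
    by (rule local_sum_disc_tendsto[OF F(1,3) that])
  fix m
  show "(\<integral>\<^sup>+\<eta>. ennreal (?u m \<eta>) \<partial>PP)
     \<le> ennreal ((2 * real k) ^ DIM('a) * (\<nu> + (2 * real r) ^ DIM('a) * \<nu> ^ 2))"
  proof -
    interpret grid_functional "occ (Suc m)" "Suc m" k r nbr_count
      by (rule grid_functional_occ[OF F(2,3)])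
    let ?q = "occ (Suc m)" and ?N = "nbh r 0 - {0}"
    have "(\<integral>\<^sup>+\<eta>. ennreal (?u m \<eta>) \<partial>PP) = ennreal (bern (\<lambda>_. ?q) (nbh (k + r) 0) tot)"
      unfolding local_sum_disc[OF F(2,3)]
      by (rule local_sum_disc_bound[OF F(2,3)]) (auto simp: tot_def term_at_def nbr_count_def intro!: sum_nonneg)
    also have "bern (\<lambda>_. ?q) (nbh (k + r) 0) tot = real (card (nbh k 0)) * ?q * palm_mean"
      by (rule bern_tot)
    also have "palm_mean = bern (\<lambda>_. ?q) ?N (\<lambda>S. 1 + real (card S))"
      unfolding palm_mean_def
    proof (rule bern_cong[OF refl])
      fix S assume "S \<subseteq> ?N"
      then have "finite S" "0 \<notin> S" using nbh_0(1) by (auto intro: finite_subset)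
      then show "nbr_count (insert 0 S) 0 = 1 + real (card S)"
        by (simp add: nbr_count_def)
    qed
    also have "\<dots> = 1 + real (card ?N) * ?q"
      using nbh_0(1) by (simp add: bern_add bern_const bern_card)
    also have "real (card (nbh k 0)) * ?q * (1 + real (card ?N) * ?q) \<le>
      real (card (nbh k 0)) * ?q * (1 + real (card (nbh r 0)) * ?q)"
      using nbh_0(1)[of r] occ_range by (intro mult_left_mono add_left_mono mult_right_mono mult_nonneg_nonneg) (auto intro!: card_mono)
    also have "\<dots> \<le> (real (2 * k) ^ DIM('a) * \<nu>) * (1 + real (2 * r) ^ DIM('a) * \<nu>)"
      unfolding nbh_0(2) using occ_range nu_pos
      by (intro mult_mono[OF cells_times_occ_le add_left_mono[OF cells_times_occ_le]]) auto
    also have "\<dots> = (2 * real k) ^ DIM('a) * (\<nu> + (2 * real r) ^ DIM('a) * \<nu> ^ 2)"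
      by (simp add: algebra_simps power2_eq_square)
    finally show "(\<integral>\<^sup>+\<eta>. ennreal (?u m \<eta>) \<partial>PP)
     \<le> ennreal ((2 * real k) ^ DIM('a) * (\<nu> + (2 * real r) ^ DIM('a) * \<nu> ^ 2))"
      by (simp add: ennreal_leI)
  qed
qed

end

section \<open>Local functionals of the quenched graph\<close>

lemma pairs_image:
  assumes "inj_on f X"
  shows "pairs (f ` X) = (`) f ` pairs X"
proof (intro equalityI subsetI)
  fix e assume "e \<in> pairs (f ` X)"
  then obtain x y where "x \<in> X" "y \<in> X" "f x \<noteq> f y" "e = f ` {x, y}" by (auto simp: pairs_def)
  moreover from this have "{x, y} \<in> pairs X" by (auto simp: pairs_def)
  ultimately show "e \<in> (`) f ` pairs X" by blast
next
  fix e assume "e \<in> (`) f ` pairs X"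
  then obtain x y where xy: "x \<in> X" "y \<in> X" "x \<noteq> y" "e = f ` {x, y}" by (auto simp: pairs_def)
  then have "f x \<noteq> f y" using assms by (auto dest: inj_onD)
  with xy show "e \<in> pairs (f ` X)" unfolding pairs_def by blast
qed

lemma pairs_subset: "e \<in> pairs X \<Longrightarrow> e \<subseteq> X"
  by (auto simp: pairs_def)

lemma pairs_within: "e \<in> pairs Y \<Longrightarrow> e \<subseteq> X \<Longrightarrow> e \<in> pairs X"
  by (auto simp: pairs_def)

lemma pairs_mono: "X \<subseteq> Y \<Longrightarrow> pairs X \<subseteq> pairs Y"
  by (auto simp: pairs_def)

lemma finite_pairs: "finite X \<Longrightarrow> finite (pairs X)"
  by (rule finite_subset[of _ "Pow X"]) (auto simp: pairs_def)

lemma pairs_disjoint: "X \<inter> Y = {} \<Longrightarrow> pairs X \<inter> pairs Y = {}"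
  by (auto simp: pairs_def doubleton_eq_iff)

lemma inj_on_image_pairs: "inj_on f X \<Longrightarrow> inj_on ((`) f) (pairs X)"
  by (rule inj_on_subset[OF inj_on_image_Pow]) (auto dest: pairs_subset)

lemma diameter_pair: "diameter {x, y :: 'a::euclidean_space} = dist x y"
proof (rule antisym)
  show "diameter {x, y} \<le> dist x y"
    by (rule diameter_le) (auto simp: dist_norm norm_minus_commute)
  show "dist x y \<le> diameter {x, y}"
    by (rule diameter_bounded_bound) auto
qed

text \<open>Weights of opposite signs make \<^const>\<open>edge_prob\<close> negative; \<^const>\<open>bernoulli_pmf\<close> truncates
  its parameter to the unit interval.\<close>

definition clamp01 :: "real \<Rightarrow> real" where
  "clamp01 p = min 1 (max 0 p)"

lemma clamp01_range: "0 \<le> clamp01 p \<and> clamp01 p \<le> 1"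
  by (simp add: clamp01_def)

locale weighted_graph =
  fixes \<alpha> :: real and Wt :: "real measure"
  assumes weight_real: "real_distribution Wt"
begin

sublocale W: real_distribution Wt
  by (rule weight_real)

sublocale PW: product_prob_space "\<lambda>_. Wt" I for I
  by standard

definition edge_p :: "('a::euclidean_space \<Rightarrow> real) \<Rightarrow> 'a set \<Rightarrow> real" where
  "edge_p w e = clamp01 (edge_prob \<alpha> w e)"

lemma edge_p_range: "0 \<le> edge_p w e \<and> edge_p w e \<le> 1"
  by (simp add: edge_p_def clamp01_range)

abbreviation weights :: "'a set \<Rightarrow> ('a \<Rightarrow> real) measure" where
  "weights X \<equiv> \<Pi>\<^sub>M x\<in>X. Wt"

abbreviation Q :: "'a::euclidean_space set \<Rightarrow> (('a \<Rightarrow> real) \<times> ('a set \<Rightarrow> bool)) measure" where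
  "Q \<eta> \<equiv> quenched_law \<alpha> Wt \<eta>"

lemma sets_weights: "sets (weights X) = sets (\<Pi>\<^sub>M x\<in>X. borel)"
  by (intro sets_PiM_cong) auto

lemma prob_weights: "prob_space (weights X)"
  by (intro prob_space_PiM) (rule W.prob_space_axioms)

lemma edge_p_measurable:
  assumes "e \<in> pairs X"
  shows "(\<lambda>w. edge_p w e) \<in> borel_measurable (weights X)"
proof -
  from assms obtain x y where e: "e = {x, y}" "x \<in> X" "y \<in> X" "x \<noteq> y"
    by (auto simp: pairs_def)
  have "(\<lambda>w. edge_p w e) \<in> borel_measurable (\<Pi>\<^sub>M x\<in>X. borel)"
    using e(2-4) unfolding e(1) edge_p_def clamp01_def edge_prob_pair[OF e(4)] by measurable
  then show ?thesis using measurable_cong_sets[OF sets_weights refl] by blast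
qed

lemma prob_Q: "prob_space (Q \<eta>)" and sets_Q: "sets (Q \<eta>) = sets (graph_space \<eta>)"
  using quenched_law_prob_algebra[OF weight_real, of \<alpha> \<eta>] by (auto simp: space_prob_algebra)

lemma space_Q: "space (Q \<eta>) = space (graph_space \<eta>)"
  by (rule sets_eq_imp_space_eq[OF sets_Q])

lemma edge_event:
  assumes "e \<in> pairs \<eta>"
  shows "{G \<in> space (graph_space \<eta>). snd G e} \<in> sets (graph_space \<eta>)"
  using assms unfolding graph_space_def by measurable

lemma edges_event:
  assumes "finite J" "J \<subseteq> pairs \<eta>" "S \<subseteq> J"
  shows "{G \<in> space (graph_space \<eta>). {e\<in>J. snd G e} = S} \<in> sets (graph_space \<eta>)"
proof -
  have "{G \<in> space (graph_space \<eta>). {e\<in>J. snd G e} = S} =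
    {G \<in> space (graph_space \<eta>). \<forall>e\<in>J. snd G e = (e \<in> S)}"
    using assms(3) by auto
  also have "\<dots> \<in> sets (graph_space \<eta>)"
  proof (intro sets.sets_Collect_finite_All assms(1))
    fix e assume "e \<in> J"
    then have "{G \<in> space (graph_space \<eta>). snd G e} \<in> sets (graph_space \<eta>)"
      using assms(2) edge_event by auto
    moreover from sets.compl_sets[OF this] have "{G \<in> space (graph_space \<eta>). \<not> snd G e} \<in> sets (graph_space \<eta>)"
      by (rule back_subst[where P = "\<lambda>A. A \<in> sets (graph_space \<eta>)"]) auto
    ultimately show "{G \<in> space (graph_space \<eta>). snd G e = (e \<in> S)} \<in> sets (graph_space \<eta>)"
      by (cases "e \<in> S") simp_all
  qed
  finally show ?thesis .
qed

lemma edges_measurable: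
  assumes "finite J" "J \<subseteq> pairs \<eta>"
  shows "(\<lambda>G. {e\<in>J. snd G e}) \<in> measurable (graph_space \<eta>) (count_space UNIV)"
  using assms edges_event[OF assms] by (intro measurable_finite_range[of "Pow J"]) auto

lemma pmf_bernoulli_clamp: "pmf (bernoulli_pmf p) b = (if b then clamp01 p else 1 - clamp01 p)"
  by (simp add: bernoulli_pmf.rep_eq clamp01_def)

lemma integral_edge_law:
  assumes "finite J" "J \<subseteq> pairs \<eta>"
  shows "(\<integral>E. F {e\<in>J. E e} \<partial>edge_law \<alpha> \<eta> w) = bern (edge_p w) J F"
proof -
  interpret E: product_prob_space "\<lambda>e. measure_pmf (bernoulli_pmf (edge_prob \<alpha> w e))" "pairs \<eta>"
    by standard
  have pr: "prob_space (edge_law \<alpha> \<eta> w)"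
    unfolding edge_law_def by (intro prob_space_PiM) (rule prob_space_measure_pmf)
  have eq: "{E \<in> space (edge_law \<alpha> \<eta> w). {e\<in>J. E e} = S} =
    {E \<in> space (edge_law \<alpha> \<eta> w). \<forall>e\<in>J. E e \<in> {e \<in> S}}" if "S \<in> Pow J" for S
    using that by auto
  have ev: "{E \<in> space (edge_law \<alpha> \<eta> w). {e\<in>J. E e} = S} \<in> sets (edge_law \<alpha> \<eta> w)" if "S \<in> Pow J" for S
    unfolding eq[OF that]
  proof (intro sets.sets_Collect_finite_All assms(1))
    fix e assume "e \<in> J"
    then show "{E \<in> space (edge_law \<alpha> \<eta> w). E e \<in> {e \<in> S}} \<in> sets (edge_law \<alpha> \<eta> w)"
      unfolding edge_law_def using assms(2) by (intro sets_PiM_I_countable sets_Collect_single') auto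
  qed
  have me: "measure (edge_law \<alpha> \<eta> w) {E \<in> space (edge_law \<alpha> \<eta> w). {e\<in>J. E e} = S}
     = (\<Prod>e\<in>S. edge_p w e) * (\<Prod>e\<in>J - S. 1 - edge_p w e)" if S: "S \<in> Pow J" for S
  proof -
    have "emeasure (edge_law \<alpha> \<eta> w) {E \<in> space (edge_law \<alpha> \<eta> w). {e\<in>J. E e} = S} =
       (\<Prod>e\<in>J. emeasure (measure_pmf (bernoulli_pmf (edge_prob \<alpha> w e))) {e \<in> S})"
      unfolding eq[OF S] by (unfold edge_law_def, rule E.emeasure_PiM_Collect) (use assms in auto)
    also have "\<dots> = (\<Prod>e\<in>J. ennreal (if e \<in> S then edge_p w e else 1 - edge_p w e))"
      by (intro prod.cong refl) (auto simp: emeasure_pmf_single pmf_bernoulli_clamp edge_p_def)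
    also have "\<dots> = ennreal (\<Prod>e\<in>J. if e \<in> S then edge_p w e else 1 - edge_p w e)"
      using edge_p_range by (intro prod_ennreal) auto
    finally have "measure (edge_law \<alpha> \<eta> w) {E \<in> space (edge_law \<alpha> \<eta> w). {e\<in>J. E e} = S} =
       (\<Prod>e\<in>J. if e \<in> S then edge_p w e else 1 - edge_p w e)"
      using edge_p_range by (intro measure_eq_emeasure_eq_ennreal prod_nonneg) auto
    also have "\<dots> = (\<Prod>e\<in>S. edge_p w e) * (\<Prod>e\<in>J - S. 1 - edge_p w e)"
      using S assms(1) by (intro prod_split_if) auto
    finally show ?thesis .
  qed
  show ?thesis
    unfolding bern_def using assms(1) pr ev me
    by (subst integral_indicator_partition[of _ "Pow J"]) (auto intro!: sum.cong)
qed

text \<open>Reduces the infinite graph to finitely many pairs: given the weights, the edges among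
  them form a Bernoulli set, and the weights are averaged afterwards.\<close>

lemma integral_Q_finite:
  assumes "finite J" "J \<subseteq> pairs \<eta>"
  shows "(\<integral>G. F {e\<in>J. snd G e} \<partial>Q \<eta>) = (\<integral>w. bern (edge_p w) J F \<partial>weights \<eta>)"
proof -
  let ?N = "\<lambda>w. distr (edge_law \<alpha> \<eta> w) (graph_space \<eta>) (\<lambda>E. (w, E))"
  have meas: "(\<lambda>G. F {e\<in>J. snd G e}) \<in> borel_measurable (graph_space \<eta>)"
    by (rule measurable_compose[OF edges_measurable[OF assms]]) simp
  have N: "?N \<in> weights \<eta> \<rightarrow>\<^sub>M prob_algebra (graph_space \<eta>)"
    using measurable_quenched_kernel[of \<alpha> \<eta>] measurable_cong_sets[OF sets_weights refl] by blast
  have "(\<integral>G. F {e\<in>J. snd G e} \<partial>Q \<eta>) = (\<integral>w. (\<integral>G. F {e\<in>J. snd G e} \<partial>?N w) \<partial>weights \<eta>)"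
    unfolding quenched_law_def
  proof (rule integral_bind[OF meas _ measurable_prob_algebraD[OF N], where B' = 1])
    fix G :: "('a \<Rightarrow> real) \<times> ('a set \<Rightarrow> bool)"
    show "\<bar>F {e \<in> J. snd G e}\<bar> \<le> (\<Sum>S\<in>Pow J. \<bar>F S\<bar>)"
      using assms(1) by (intro member_le_sum[where f = "\<lambda>S. \<bar>F S\<bar>"]) auto
    show "AE w in weights \<eta>. emeasure (?N w) (space (?N w)) \<le> ennreal 1"
    proof (rule AE_I2)
      fix w assume "w \<in> space (weights \<eta>)"
      from measurable_space[OF N this] have "prob_space (?N w)" by (simp add: space_prob_algebra)
      from prob_space.emeasure_space_1[OF this] show "emeasure (?N w) (space (?N w)) \<le> ennreal 1"
        by (simp only: ennreal_1 order_refl)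
    qed
  qed (rule prob_space.finite_measure[OF prob_weights])
  also have "\<dots> = (\<integral>w. bern (edge_p w) J F \<partial>weights \<eta>)"
  proof (intro Bochner_Integration.integral_cong refl)
    fix w assume w: "w \<in> space (weights \<eta>)"
    then have "(\<lambda>E. (w, E)) \<in> edge_law \<alpha> \<eta> w \<rightarrow>\<^sub>M graph_space \<eta>"
    proof -
      have "sets (edge_law \<alpha> \<eta> w) = sets (\<Pi>\<^sub>M e\<in>pairs \<eta>. count_space UNIV)"
        unfolding edge_law_def by (intro sets_PiM_cong) auto
      moreover have "w \<in> space (\<Pi>\<^sub>M x\<in>\<eta>. borel)"
        using w sets_eq_imp_space_eq[OF sets_weights] by blast
      then have "Pair w \<in> (\<Pi>\<^sub>M e\<in>pairs \<eta>. count_space UNIV) \<rightarrow>\<^sub>M graph_space \<eta>"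
        unfolding graph_space_def by (rule measurable_Pair1')
      ultimately show ?thesis using measurable_cong_sets by blast
    qed
    then show "(\<integral>G. F {e\<in>J. snd G e} \<partial>?N w) = bern (edge_p w) J F"
      using meas integral_edge_law[OF assms] by (subst integral_distr) auto
  qed
  finally show ?thesis .
qed

lemma integral_weights_restrict:
  fixes H :: "('a \<Rightarrow> real) \<Rightarrow> real"
  assumes "finite X" "X \<subseteq> \<eta>" "H \<in> borel_measurable (weights X)"
  shows "(\<integral>w. H (restrict w X) \<partial>weights \<eta>) = (\<integral>w. H w \<partial>weights X)"
proof -
  have "(\<integral>w. H w \<partial>weights X) = (\<integral>w. H w \<partial>distr (weights \<eta>) (weights X) (\<lambda>w. restrict w X))"
    using PW.distr_PiM_restrict_finite[OF assms(1,2)] by simp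
  also have "\<dots> = (\<integral>w. H (restrict w X) \<partial>weights \<eta>)"
    using assms by (intro integral_distr measurable_restrict_subset) auto
  finally show ?thesis by simp
qed

lemma edge_p_restrict:
  assumes "e \<in> pairs X"
  shows "edge_p (restrict w X) e = edge_p w e"
  using pairs_subset[OF assms] unfolding edge_p_def edge_prob_def
  by (simp add: subset_iff cong: prod.cong)

text \<open>The mean of \<open>f\<close> at \<open>x\<close> in the graph whose whole vertex set is
  \<open>X\<close>. It depends on positions only, and so becomes the local functional to which the
  Poisson moment bounds are applied.\<close>

definition mean_val :: "('a::euclidean_space set set \<Rightarrow> 'a \<Rightarrow> real) \<Rightarrow> 'a set \<Rightarrow> 'a \<Rightarrow> real" where
  "mean_val f X x = (\<integral>w. bern (edge_p w) (pairs X) (\<lambda>S. f S x) \<partial>weights X)"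

lemma bern_edge_p_measurable:
  assumes "A \<subseteq> pairs X"
  shows "(\<lambda>w. bern (edge_p w) A F) \<in> borel_measurable (weights X)"
  using assms edge_p_measurable by (intro borel_measurable_bern) auto

lemma bern_edge_p_integrable:
  assumes "A \<subseteq> pairs X"
  shows "integrable (weights X) (\<lambda>w. bern (edge_p w) A F)"
  using bern_bound[of A "edge_p w" F for w, OF edge_p_range] bern_edge_p_measurable[OF assms]
  by (intro finite_measure.integrable_const_bound[where B = "\<Sum>S\<in>Pow A. \<bar>F S\<bar>"]
      prob_space.finite_measure prob_weights) auto

lemma edge_set_Int_pairs: "X \<subseteq> \<eta> \<Longrightarrow> edge_set \<eta> G \<inter> pairs X = {e\<in>pairs X. snd G e}"
  using pairs_mono[of X \<eta>] by (auto simp: edge_set_def)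

text \<open>Consistency of the model: the subgraph induced on \<open>X\<close> has the law of the
  graph built on \<open>X\<close> alone, since edge probabilities involve only the weights of the
  endpoints.\<close>

lemma integral_Q_local:
  assumes "finite X" "X \<subseteq> \<eta>"
  shows "(\<integral>G. f (edge_set \<eta> G \<inter> pairs X) x \<partial>Q \<eta>) = mean_val f X x"
proof -
  have "(\<integral>G. f (edge_set \<eta> G \<inter> pairs X) x \<partial>Q \<eta>) =
     (\<integral>w. bern (edge_p w) (pairs X) (\<lambda>S. f S x) \<partial>weights \<eta>)"
    unfolding edge_set_Int_pairs[OF assms(2)]
    by (rule integral_Q_finite[OF finite_pairs[OF assms(1)] pairs_mono[OF assms(2)], where F = "\<lambda>S. f S x"])
  also have "\<dots> = (\<integral>w. bern (edge_p (restrict w X)) (pairs X) (\<lambda>S. f S x) \<partial>weights \<eta>)"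
    by (intro Bochner_Integration.integral_cong refl bern_cong) (simp_all add: edge_p_restrict)
  also have "\<dots> = mean_val f X x"
    unfolding mean_val_def
    by (rule integral_weights_restrict[OF assms]) (rule bern_edge_p_measurable[OF order_refl])
  finally show ?thesis .
qed

lemma local_measurable:
  fixes F :: "'a::euclidean_space set set \<Rightarrow> real"
  assumes "finite X" "X \<subseteq> \<eta>"
  shows "(\<lambda>G. F (edge_set \<eta> G \<inter> pairs X)) \<in> borel_measurable (Q \<eta>)"
  unfolding edge_set_Int_pairs[OF assms(2)] measurable_cong_sets[OF sets_Q refl]
  using assms by (intro measurable_compose[OF edges_measurable] finite_pairs pairs_mono) simp_all

lemma integrable_Q:
  fixes f :: "_ \<Rightarrow> real"
  assumes "f \<in> borel_measurable (Q \<eta>)" "\<And>G. \<bar>f G\<bar> \<le> 1"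
  shows "integrable (Q \<eta>) f"
  using assms by (intro finite_measure.integrable_const_bound[where B = 1] prob_space.finite_measure prob_Q) auto

text \<open>Graphs on disjoint vertex sets share neither weights nor pairs. Given the weights the
  edges factor by \<open>bern_prod\<close>; the weights then factor by Fubini.\<close>

lemma integral_Q_local_prod:
  assumes "finite X" "X \<subseteq> \<eta>" "finite Y" "Y \<subseteq> \<eta>" "X \<inter> Y = {}"
  shows "(\<integral>G. f (edge_set \<eta> G \<inter> pairs X) x * g (edge_set \<eta> G \<inter> pairs Y) y \<partial>Q \<eta>) = mean_val f X x * mean_val g Y y"
proof -
  let ?bX = "\<lambda>w. bern (edge_p w) (pairs X) (\<lambda>S. f S x)" and ?bY = "\<lambda>w. bern (edge_p w) (pairs Y) (\<lambda>S. g S y)"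
  let ?J = "pairs X \<union> pairs Y"
  have dj: "pairs X \<inter> pairs Y = {}" by (rule pairs_disjoint[OF assms(5)])
  have fin: "finite (pairs X)" "finite (pairs Y)" using assms finite_pairs by auto
  have J: "?J \<subseteq> pairs (X \<union> Y)" "?J \<subseteq> pairs \<eta>"
    using pairs_mono[of X "X \<union> Y"] pairs_mono[of Y "X \<union> Y"] pairs_mono[OF assms(2)] pairs_mono[OF assms(4)] by auto
  have "(\<integral>G. f (edge_set \<eta> G \<inter> pairs X) x * g (edge_set \<eta> G \<inter> pairs Y) y \<partial>Q \<eta>) =
    (\<integral>G. (\<lambda>S. f (S \<inter> pairs X) x * g (S \<inter> pairs Y) y) {e\<in>?J. snd G e} \<partial>Q \<eta>)"
    unfolding edge_set_Int_pairs[OF assms(2)] edge_set_Int_pairs[OF assms(4)]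
    by (intro Bochner_Integration.integral_cong refl arg_cong2[where f = "(*)"] arg_cong[where f = "\<lambda>S. f S x"] arg_cong[where f = "\<lambda>S. g S y"]) auto
  also have "\<dots> = (\<integral>w. bern (edge_p w) ?J (\<lambda>S. f (S \<inter> pairs X) x * g (S \<inter> pairs Y) y) \<partial>weights \<eta>)"
    using fin J by (intro integral_Q_finite) auto
  also have "\<dots> = (\<integral>w. ?bX w * ?bY w \<partial>weights \<eta>)"
    by (intro Bochner_Integration.integral_cong refl bern_prod[OF fin dj])
  \<comment> \<open>Restriction to \<open>X \<union> Y\<close> makes the weight space a finite
    product, as the Fubini step through \<open>merge\<close> requires.\<close>
  also have "\<dots> = (\<integral>w. ?bX (restrict w (X \<union> Y)) * ?bY (restrict w (X \<union> Y)) \<partial>weights \<eta>)"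
    using J(1) by (intro Bochner_Integration.integral_cong refl arg_cong2[where f = "(*)"] bern_cong) (auto simp: edge_p_restrict)
  also have "\<dots> = (\<integral>w. ?bX w * ?bY w \<partial>weights (X \<union> Y))"
    using assms J(1)
    by (intro integral_weights_restrict borel_measurable_times bern_edge_p_measurable) auto
  also have "\<dots> = (\<integral>u. (\<integral>v. ?bX (merge X Y (u, v)) * ?bY (merge X Y (u, v)) \<partial>weights Y) \<partial>weights X)"
  proof (rule PW.product_integral_fold[OF assms(5,1,3)])
    have "(\<lambda>w. ?bX w * ?bY w) = (\<lambda>w. bern (edge_p w) ?J (\<lambda>S. f (S \<inter> pairs X) x * g (S \<inter> pairs Y) y))"
      by (intro ext bern_prod[OF fin dj, symmetric])
    then show "integrable (weights (X \<union> Y)) (\<lambda>w. ?bX w * ?bY w)"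
      using bern_edge_p_integrable[OF J(1)] by simp
  qed
  also have "\<dots> = (\<integral>u. (\<integral>v. ?bX u * ?bY v \<partial>weights Y) \<partial>weights X)"
  proof -
    have "edge_p (merge X Y (u, v)) e = edge_p u e" if "e \<in> pairs X" for u v e
      using pairs_subset[OF that] unfolding edge_p_def edge_prob_def
      by (simp add: subset_iff merge_def cong: prod.cong)
    moreover have "edge_p (merge X Y (u, v)) e = edge_p v e" if "e \<in> pairs Y" for u v e
    proof -
      have "e \<subseteq> Y" "e \<inter> X = {}" using pairs_subset[OF that] assms(5) by auto
      then have "(\<Prod>z\<in>e. merge X Y (u, v) z) = (\<Prod>z\<in>e. v z)"
        by (intro prod.cong) (auto simp: merge_def)
      then show ?thesis by (simp add: edge_p_def edge_prob_def)
    qed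
    ultimately show ?thesis
      by (intro Bochner_Integration.integral_cong refl arg_cong2[where f = "(*)"] bern_cong) auto
  qed
  finally show ?thesis by (simp add: mean_val_def)
qed

end

section \<open>Relabelling invariance and continuity\<close>

text \<open>Translations, and fine roundings of a finite set, are both injective relabellings, so
  this single property yields translation invariance and continuity.\<close>

definition graph_invariant :: "('a set set \<Rightarrow> 'a \<Rightarrow> real) \<Rightarrow> bool" where
  "graph_invariant f \<longleftrightarrow>
    (\<forall>h X S x. inj_on h X \<longrightarrow> S \<subseteq> pairs X \<longrightarrow> x \<in> X \<longrightarrow> f ((`) h ` S) (h x) = f S x)"

lemma neighbors_image:
  assumes "inj_on h X" "S \<subseteq> pairs X" "x \<in> X"
  shows "neighbors ((`) h ` S) (h x) = h ` neighbors S x"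
proof (intro equalityI subsetI)
  fix y assume "y \<in> neighbors ((`) h ` S) (h x)"
  then obtain e where e: "e \<in> S" "h ` e = {h x, y}" by (auto simp: neighbors_def)
  then obtain a b where ab: "e = {a, b}" "a \<in> X" "b \<in> X" "a \<noteq> b" using assms(2) by (auto simp: pairs_def)
  have "h a \<noteq> h b" using ab assms(1) by (auto dest: inj_onD)
  moreover have "{h a, h b} = {h x, y}" using e ab by simp
  ultimately have "(h a = h x \<and> h b = y) \<or> (h b = h x \<and> h a = y)" by (auto simp: doubleton_eq_iff)
  then show "y \<in> h ` neighbors S x"
  proof
    assume *: "h a = h x \<and> h b = y"
    then have "a = x" using ab assms by (auto dest: inj_onD)
    then have "b \<in> neighbors S x" using e(1) ab by (simp add: neighbors_def)
    then show ?thesis using * by blast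
  next
    assume *: "h b = h x \<and> h a = y"
    then have "b = x" using ab assms by (auto dest: inj_onD)
    then have "a \<in> neighbors S x" using e(1) ab by (simp add: neighbors_def insert_commute)
    then show ?thesis using * by blast
  qed
next
  fix y assume "y \<in> h ` neighbors S x"
  then obtain z where z: "{x, z} \<in> S" "y = h z" by (auto simp: neighbors_def)
  have "h ` {x, z} \<in> (`) h ` S" using z(1) by (rule imageI)
  then show "y \<in> neighbors ((`) h ` S) (h x)" using z(2) by (simp add: neighbors_def)
qed

lemma neighbors_subset: "S \<subseteq> pairs X \<Longrightarrow> neighbors S x \<subseteq> X - {x}"
proof
  fix y assume "S \<subseteq> pairs X" "y \<in> neighbors S x"
  then have "{x, y} \<in> pairs X" by (auto simp: neighbors_def)
  then obtain a b where "{x, y} = {a, b}" "a \<in> X" "b \<in> X" "a \<noteq> b" unfolding pairs_def by blast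
  then show "y \<in> X - {x}" by (auto simp: doubleton_eq_iff)
qed

lemma degr_image:
  assumes "inj_on h X" "S \<subseteq> pairs X" "x \<in> X"
  shows "degr ((`) h ` S) (h x) = degr S x"
  unfolding degr_def neighbors_image[OF assms]
  by (rule card_image, rule inj_on_subset[OF assms(1)]) (use neighbors_subset[OF assms(2), of x] in blast)

lemma triangles_eq:
  assumes "S \<subseteq> pairs X"
  shows "triangles S x = card {e \<in> S. e \<subseteq> neighbors S x}"
proof -
  have "{{y, z} | y z. y \<in> neighbors S x \<and> z \<in> neighbors S x \<and> y \<noteq> z \<and> {y, z} \<in> S} = {e \<in> S. e \<subseteq> neighbors S x}"
  proof (intro equalityI subsetI)
    fix e assume e: "e \<in> {e \<in> S. e \<subseteq> neighbors S x}"
    then obtain y z where "e = {y, z}" "y \<noteq> z" using assms by (auto simp: pairs_def)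
    then show "e \<in> {{y, z} | y z. y \<in> neighbors S x \<and> z \<in> neighbors S x \<and> y \<noteq> z \<and> {y, z} \<in> S}" using e by auto
  qed auto
  then show ?thesis by (simp only: triangles_def)
qed

lemma triangles_image:
  assumes "inj_on h X" "S \<subseteq> pairs X" "x \<in> X"
  shows "triangles ((`) h ` S) (h x) = triangles S x"
proof -
  have N: "neighbors S x \<subseteq> X" using neighbors_subset[OF assms(2), of x] by auto
  have S: "e \<subseteq> X" if "e \<in> S" for e using that assms(2) pairs_subset by blast
  have "(`) h ` S \<subseteq> pairs (h ` X)" unfolding pairs_image[OF assms(1)] by (rule image_mono[OF assms(2)])
  then have "triangles ((`) h ` S) (h x) = card {e \<in> (`) h ` S. e \<subseteq> h ` neighbors S x}"
    by (simp add: triangles_eq neighbors_image[OF assms])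
  also have "{e \<in> (`) h ` S. e \<subseteq> h ` neighbors S x} = (`) h ` {e \<in> S. e \<subseteq> neighbors S x}"
    using inj_on_image_subset_iff[OF assms(1) S N] by auto
  also have "card \<dots> = triangles S x"
    unfolding triangles_eq[OF assms(2)]
    by (rule card_image, rule inj_on_subset[OF inj_on_image_pairs[OF assms(1)]]) (use assms(2) in blast)
  finally show ?thesis .
qed

lemma graph_invariant_CC: "graph_invariant CC"
  unfolding graph_invariant_def CC_def by (intro allI impI) (simp add: degr_image triangles_image)

text \<open>The cut-off keeps the coefficient a limit of local functionals at vertices of infinite degree;
  the Palm integrand has to be measurable on all configurations, not only on almost all.\<close>

definition CC_upto :: "nat \<Rightarrow> 'a set set \<Rightarrow> 'a \<Rightarrow> real" where
  "CC_upto k S x = (if degr S x \<le> k then CC S x else 0)"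

lemma graph_invariant_CC_upto: "graph_invariant (CC_upto k)"
  unfolding graph_invariant_def CC_upto_def CC_def by (intro allI impI) (simp add: degr_image triangles_image)

lemma CC_range: "0 \<le> CC S x \<and> CC S x \<le> 1"
proof (cases "degr S x \<in> {0, 1}")
  case False
  define n where "n = degr S x"
  have n: "n \<ge> 2" using False by (auto simp: n_def)
  \<comment> \<open>A degree of at least 2 excludes infinite neighbourhoods, whose
    \<open>card\<close> is 0.\<close>
  have fin: "finite (neighbors S x)" using n by (auto simp: n_def degr_def intro: card_ge_0_finite)
  have "triangles S x \<le> card {B. B \<subseteq> neighbors S x \<and> card B = 2}"
    unfolding triangles_def
  proof (rule card_mono)
    show "finite {B. B \<subseteq> neighbors S x \<and> card B = 2}" using fin by simp
  qed auto
  also have "\<dots> = n choose 2" using n_subsets[OF fin] by (simp add: n_def degr_def)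
  finally have "real (triangles S x) \<le> real (n choose 2)" by simp
  also have "\<dots> = real n * (real n - 1) / 2"
    using n by (simp add: choose_two real_of_nat_div of_nat_diff)
  finally have "2 * real (triangles S x) \<le> real n * (real n - 1)" by simp
  moreover have "real n * (real n - 1) > 0" using n by simp
  ultimately show ?thesis using False by (auto simp: CC_def n_def[symmetric])
qed (simp add: CC_def)

lemmas CC_nonneg = CC_range[THEN conjunct1] and CC_le_1 = CC_range[THEN conjunct2]

lemma CC_upto_range: "\<bar>CC_upto k S x\<bar> \<le> 1"
  by (simp add: CC_upto_def CC_nonneg CC_le_1)

context weighted_graph
begin

text \<open>Weights stay indexed by the original points while distances are measured after the
  displacement \<open>h\<close>. All displaced graphs thus live on one probability space, and a
  limit in \<open>h\<close> becomes a limit of integrands.\<close>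

definition moved_p :: "('a \<Rightarrow> 'a::euclidean_space) \<Rightarrow> ('a \<Rightarrow> real) \<Rightarrow> 'a set \<Rightarrow> real" where
  "moved_p h w e = clamp01 (1 - exp (- ((\<Prod>x\<in>e. w x) / diameter (h ` e) powr \<alpha>)))"

lemma moved_p_measurable:
  assumes "e \<in> pairs X"
  shows "(\<lambda>w. moved_p h w e) \<in> borel_measurable (weights X)"
proof -
  from assms obtain x y where e: "e = {x, y}" "x \<in> X" "y \<in> X" "x \<noteq> y"
    by (auto simp: pairs_def)
  have "(\<lambda>w. moved_p h w e) \<in> borel_measurable (\<Pi>\<^sub>M x\<in>X. borel)"
    using e(2-4) unfolding e(1) moved_p_def clamp01_def by simp
  then show ?thesis using measurable_cong_sets[OF sets_weights refl] by blast
qed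

text \<open>I.i.d. weights may be carried along an injection, so displacing the points only changes
  the distances in the edge probabilities.\<close>

lemma mean_val_image:
  fixes h :: "'a::euclidean_space \<Rightarrow> 'a"
  assumes "inj_on h X" "x \<in> X" "graph_invariant f"
  shows "mean_val f (h ` X) (h x) = (\<integral>w. bern (moved_p h w) (pairs X) (\<lambda>S. f S x) \<partial>weights X)"
proof -
  let ?t = "\<lambda>u. \<lambda>y\<in>X. u (h y)"
  have meas: "(\<lambda>w. bern (moved_p h w) (pairs X) (\<lambda>S. f S x)) \<in> borel_measurable (weights X)"
    by (intro borel_measurable_bern moved_p_measurable)
  have "distr (weights (h ` X)) (weights X) ?t = weights X"
    by (rule distr_PiM_reindex[OF W.prob_space_axioms assms(1)]) auto
  then have "(\<integral>w. bern (moved_p h w) (pairs X) (\<lambda>S. f S x) \<partial>weights X) =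
     (\<integral>w. bern (moved_p h w) (pairs X) (\<lambda>S. f S x) \<partial>distr (weights (h ` X)) (weights X) ?t)"
    by simp
  also have "\<dots> = (\<integral>u. bern (moved_p h (?t u)) (pairs X) (\<lambda>S. f S x) \<partial>weights (h ` X))"
    by (rule integral_distr[OF _ meas], rule measurable_restrict) auto
  also have "\<dots> = mean_val f (h ` X) (h x)"
    unfolding mean_val_def
  proof (intro Bochner_Integration.integral_cong refl)
    fix u :: "'a \<Rightarrow> real"
    have "bern (edge_p u) (pairs (h ` X)) (\<lambda>S. f S (h x)) =
      bern (\<lambda>e. edge_p u (h ` e)) (pairs X) (\<lambda>S. f ((`) h ` S) (h x))"
      unfolding pairs_image[OF assms(1)] by (rule bern_reindex[OF inj_on_image_pairs[OF assms(1)]])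
    also have "\<dots> = bern (moved_p h (?t u)) (pairs X) (\<lambda>S. f S x)"
    proof (rule bern_cong)
      fix e assume e: "e \<in> pairs X"
      have "(\<Prod>z\<in>h ` e. u z) = (\<Prod>y\<in>e. ?t u y)"
        using pairs_subset[OF e] inj_on_subset[OF assms(1)]
        by (subst prod.reindex) (auto intro!: prod.cong)
      then show "edge_p u (h ` e) = moved_p h (?t u) e"
        by (simp add: edge_p_def edge_prob_def moved_p_def)
    next
      fix S assume "S \<subseteq> pairs X"
      then show "f ((`) h ` S) (h x) = f S x"
        using assms unfolding graph_invariant_def by blast
    qed
    finally show "bern (moved_p h (?t u)) (pairs X) (\<lambda>S. f S x) = bern (edge_p u) (pairs (h ` X)) (\<lambda>S. f S (h x))" ..
  qed
  finally show ?thesis ..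
qed

lemma translation_invariant_mean_val:
  fixes f :: "'a::euclidean_space set set \<Rightarrow> 'a \<Rightarrow> real"
  assumes "graph_invariant f"
  shows "translation_invariant (mean_val f)"
  unfolding translation_invariant_def
proof (intro allI impI)
  fix a x :: 'a and X assume "x \<in> X"
  have "mean_val f ((+) a ` X) (a + x) = (\<integral>w. bern (moved_p ((+) a) w) (pairs X) (\<lambda>S. f S x) \<partial>weights X)"
    by (rule mean_val_image) (use \<open>x \<in> X\<close> assms in auto)
  also have "\<dots> = mean_val f X x"
    unfolding mean_val_def
  proof (intro Bochner_Integration.integral_cong refl bern_cong)
    fix w :: "'a \<Rightarrow> real" and e assume "e \<in> pairs X"
    then obtain y z where "e = {y, z}" by (auto simp: pairs_def)
    then show "moved_p ((+) a) w e = edge_p w e"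
      by (simp add: moved_p_def edge_p_def edge_prob_def diameter_pair)
  qed
  finally show "mean_val f ((+) a ` X) (a + x) = mean_val f X x" .
qed

lemma moved_p_tendsto:
  assumes "e \<in> pairs X"
  shows "(\<lambda>m. moved_p (disc m) w e) \<longlonglongrightarrow> edge_p w e"
proof -
  from assms obtain x y where e: "e = {x, y}" "x \<noteq> y"
    by (auto simp: pairs_def)
  have "(\<lambda>m. clamp01 (1 - exp (- ((\<Prod>x\<in>e. w x) / dist (disc m x) (disc m y) powr \<alpha>))))
     \<longlonglongrightarrow> clamp01 (1 - exp (- ((\<Prod>x\<in>e. w x) / dist x y powr \<alpha>)))"
    unfolding clamp01_def using e(2)
    by (intro tendsto_intros tendsto_min tendsto_max tendsto_dist disc_tendsto) auto
  then show ?thesis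
    by (simp add: e(1) diameter_pair moved_p_def edge_p_def edge_prob_def)
qed

text \<open>With the weights on the original labels only the edge probabilities vary with
  \<open>m\<close>. They converge because distinct points have a positive limiting distance, and
  \<open>bern_bound\<close> gives the domination.\<close>

lemma disc_continuous_mean_val:
  fixes f :: "'a::euclidean_space set set \<Rightarrow> 'a \<Rightarrow> real"
  assumes "graph_invariant f"
  shows "disc_continuous (mean_val f)"
  unfolding disc_continuous_def
proof (intro allI impI)
  fix X :: "'a set" and x assume X: "finite X" "x \<in> X"
  show "(\<lambda>m. mean_val f (disc m ` X) (disc m x)) \<longlonglongrightarrow> mean_val f X x"
  proof (rule Lim_transform_eventually)
    show "(\<lambda>m. \<integral>w. bern (moved_p (disc m) w) (pairs X) (\<lambda>S. f S x) \<partial>weights X) \<longlonglongrightarrow> mean_val f X x"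
      unfolding mean_val_def
    proof (rule integral_dominated_convergence[where w = "\<lambda>_. \<Sum>S\<in>Pow (pairs X). \<bar>f S x\<bar>"])
      show "AE w in weights X. (\<lambda>m. bern (moved_p (disc m) w) (pairs X) (\<lambda>S. f S x))
          \<longlonglongrightarrow> bern (edge_p w) (pairs X) (\<lambda>S. f S x)"
        by (intro AE_I2 tendsto_bern moved_p_tendsto)
      show "AE w in weights X. norm (bern (moved_p (disc m) w) (pairs X) (\<lambda>S. f S x)) \<le> (\<Sum>S\<in>Pow (pairs X). \<bar>f S x\<bar>)" for m
      proof (rule AE_I2)
        fix w :: "'a \<Rightarrow> real"
        show "norm (bern (moved_p (disc m) w) (pairs X) (\<lambda>S. f S x)) \<le> (\<Sum>S\<in>Pow (pairs X). \<bar>f S x\<bar>)"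
          unfolding real_norm_def by (rule bern_bound) (simp add: moved_p_def clamp01_range)
      qed
      show "integrable (weights X) (\<lambda>_. \<Sum>S\<in>Pow (pairs X). \<bar>f S x\<bar>)"
        by (rule finite_measure.integrable_const[OF prob_space.finite_measure[OF prob_weights]])
    qed (intro borel_measurable_bern moved_p_measurable edge_p_measurable, assumption)+
    show "\<forall>\<^sub>F m in sequentially. (\<integral>w. bern (moved_p (disc m) w) (pairs X) (\<lambda>S. f S x) \<partial>weights X) =
        mean_val f (disc m ` X) (disc m x)"
      using eventually_disc_inj[OF X(1)]
      by eventually_elim (rule mean_val_image[symmetric, OF _ X(2) assms])
  qed
qed

lemma mean_val_range:
  assumes "finite X" "\<And>S x. 0 \<le> f S x \<and> f S x \<le> 1"
  shows "0 \<le> mean_val f X x \<and> mean_val f X x \<le> 1"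
proof
  show "0 \<le> mean_val f X x"
    unfolding mean_val_def using assms(2) edge_p_range
    by (intro Bochner_Integration.integral_nonneg bern_nonneg) auto
  have "mean_val f X x \<le> (\<integral>w. 1 \<partial>weights X)"
    unfolding mean_val_def
  proof (rule integral_mono[OF bern_edge_p_integrable[OF order_refl]])
    show "bern (edge_p w) (pairs X) (\<lambda>S. f S x) \<le> 1" for w
      using assms(2) edge_p_range by (intro bern_le_1 finite_pairs assms(1)) auto
  qed (rule finite_measure.integrable_const[OF prob_space.finite_measure[OF prob_weights]])
  also have "\<dots> = 1" using prob_space.prob_space[OF prob_weights] by simp
  finally show "mean_val f X x \<le> 1" .
qed

end

section \<open>Decay of the connection probabilities\<close>

lemma weight_tail:
  assumes "weight_distribution \<tau> L Wt" "w > 0"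
  shows "measure Wt {w<..} = w powr (- (\<tau> - 1)) * L w"
proof -
  interpret real_distribution Wt using assms(1) by (simp add: weight_distribution_def)
  have "measure Wt {w<..} = 1 - cdf Wt w"
    using prob_compl[of "{..w}"] by (simp add: cdf_def Compl_eq_Diff_UNIV[symmetric])
  then show ?thesis using assms by (simp add: weight_distribution_def)
qed

text \<open>Slow variation enters only along doublings: the ratio of the tails at
  \<open>2 * w\<close> and \<open>w\<close> tends to \<open>2 powr (- (\<tau> - 1))\<close>, hence
  finally stays below any larger \<open>\<rho>\<close>. Iteration gives geometric decay at dyadic
  points.\<close>

lemma weight_tail_halving:
  assumes W: "weight_distribution \<tau> L Wt" and L: "slowly_varying L" and \<rho>: "2 powr (- (\<tau> - 1)) < \<rho>"
  obtains w0 where "w0 > 0" "\<And>w. w \<ge> w0 \<Longrightarrow> measure Wt {2 * w<..} \<le> \<rho> * measure Wt {w<..}"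
proof -
  have "((\<lambda>w. 2 powr (- (\<tau> - 1)) * (L (2 * w) / L w)) \<longlongrightarrow> 2 powr (- (\<tau> - 1)) * 1) at_top"
    using L by (intro tendsto_intros) (auto simp: slowly_varying_def)
  then have "\<forall>\<^sub>F w in at_top. 2 powr (- (\<tau> - 1)) * (L (2 * w) / L w) < \<rho>"
    using \<rho> by (intro order_tendstoD(2)) auto
  moreover have "\<forall>\<^sub>F w in at_top. 0 < L w" using L by (simp add: slowly_varying_def)
  ultimately have "\<forall>\<^sub>F w in at_top. measure Wt {2 * w<..} \<le> \<rho> * measure Wt {w<..}"
    using eventually_gt_at_top[of 0]
  proof eventually_elim
    case (elim w)
    have "measure Wt {2 * w<..} = w powr (- (\<tau> - 1)) * (2 powr (- (\<tau> - 1)) * L (2 * w))"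
      using elim by (simp add: weight_tail[OF W] powr_mult)
    also have "\<dots> \<le> w powr (- (\<tau> - 1)) * (\<rho> * L w)"
      using elim by (intro mult_left_mono) (auto simp: field_simps)
    finally show ?case using elim by (simp add: weight_tail[OF W] ac_simps)
  qed
  then obtain w0 where w0: "\<forall>w\<ge>w0. measure Wt {2 * w<..} \<le> \<rho> * measure Wt {w<..}"
    unfolding eventually_at_top_linorder by blast
  show ?thesis
    by (rule that[of "max 1 w0"]) (use w0 in auto)
qed

text \<open>On the dyadic interval above \<open>2 ^ j * w0\<close> the integrand is at most
  \<open>(2 ^ Suc j * w0) powr s\<close>, and the tail there is at most \<open>\<rho> ^ j\<close>;
  the resulting series is geometric with ratio \<open>2 powr s * \<rho>\<close>.\<close>

lemma weight_moment_finite: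
  assumes W: "weight_distribution \<tau> L Wt" and L: "slowly_varying L" and s: "0 < s" "s < \<tau> - 1"
  shows "(\<integral>\<^sup>+w. ennreal (w powr s) \<partial>Wt) < \<infinity>"
proof -
  interpret real_distribution Wt using W by (simp add: weight_distribution_def)
  \<comment> \<open>The exponent is the midpoint of \<open>s\<close> and \<open>\<tau> - 1\<close>:
    then \<open>\<rho>\<close> exceeds the limiting ratio of the tails and still
    \<open>2 powr s * \<rho> < 1\<close>.\<close>
  define \<rho> :: real where "\<rho> = 2 powr (- ((s + (\<tau> - 1)) / 2))"
  have "2 powr (- (\<tau> - 1)) < \<rho>" unfolding \<rho>_def using s by (intro powr_less_mono) (auto simp: field_simps)
  from weight_tail_halving[OF W L this] obtain w0
    where w0: "w0 > 0" "\<And>w. w \<ge> w0 \<Longrightarrow> measure Wt {2 * w<..} \<le> \<rho> * measure Wt {w<..}" by blast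
  have \<rho>0: "\<rho> \<ge> 0" by (simp add: \<rho>_def)
  have tail: "measure Wt {2 ^ k * w0<..} \<le> \<rho> ^ k" for k
  proof (induction k)
    case (Suc k)
    have "w0 \<le> 2 ^ k * w0" using w0(1) by simp
    from w0(2)[OF this] have "measure Wt {2 ^ Suc k * w0<..} \<le> \<rho> * measure Wt {2 ^ k * w0<..}"
      by (simp add: mult.assoc)
    also have "\<dots> \<le> \<rho> * \<rho> ^ k" by (intro mult_left_mono Suc.IH \<rho>0)
    finally show ?case by simp
  qed simp
  define c where "c k = (2 ^ Suc k * w0) powr s" for k :: nat
  have c0: "c k \<ge> 0" for k by (simp add: c_def)
  have le_suminf: "f j \<le> (\<Sum>k. f k)" for j and f :: "nat \<Rightarrow> ennreal"
    using sum_le_suminf[OF summableI, of "{j}" f] by simp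
  have bound: "ennreal (w powr s) \<le> ennreal (w0 powr s) + (\<Sum>k. ennreal (c k) * indicator {2 ^ k * w0<..} w)"
    if w: "w > 0" for w
  proof (cases "w \<le> w0")
    case True
    then have "ennreal (w powr s) \<le> ennreal (w0 powr s)"
      using w s by (intro ennreal_leI powr_mono2) auto
    then show ?thesis by (simp add: add_increasing2)
  next
    case False
    obtain n where n: "w / w0 < 2 ^ n" using real_arch_pow[of 2 "w / w0"] by auto
    \<comment> \<open>The least exponent locates \<open>w\<close> in one dyadic interval; the single
      term of the series for that interval already bounds \<open>w powr s\<close>.\<close>
    define k where "k = (LEAST n. w \<le> 2 ^ n * w0)"
    have ex: "w \<le> 2 ^ n * w0" using n w0(1) by (simp add: field_simps)
    then have k: "w \<le> 2 ^ k * w0" unfolding k_def by (rule LeastI)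
    then obtain j where j: "k = Suc j" using False by (cases k) auto
    have "\<not> w \<le> 2 ^ j * w0" using not_less_Least[of j "\<lambda>n. w \<le> 2 ^ n * w0"] by (simp add: k_def[symmetric] j)
    then have "ennreal (w powr s) \<le> ennreal (c j) * indicator {2 ^ j * w0<..} w"
      using k w s unfolding j c_def by (auto intro!: ennreal_leI powr_mono2)
    also have "\<dots> \<le> (\<Sum>k. ennreal (c k) * indicator {2 ^ k * w0<..} w)"
      by (rule le_suminf)
    finally show ?thesis by (simp add: add_increasing)
  qed
  have "(\<integral>\<^sup>+w. ennreal (w powr s) \<partial>Wt) \<le>
      (\<integral>\<^sup>+w. ennreal (w0 powr s) + (\<Sum>k. ennreal (c k) * indicator {2 ^ k * w0<..} w) \<partial>Wt)"
    using W bound by (intro nn_integral_mono_AE) (auto simp: weight_distribution_def)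
  also have "\<dots> = ennreal (w0 powr s) + (\<Sum>k. ennreal (c k) * emeasure Wt {2 ^ k * w0<..})"
    by (subst nn_integral_add) (auto simp: nn_integral_suminf nn_integral_cmult emeasure_space_1[simplified])
  also have "\<dots> \<le> ennreal (w0 powr s) + (\<Sum>k. ennreal (c k * \<rho> ^ k))"
  proof (intro add_left_mono suminf_le summableI)
    fix k
    have "ennreal (c k) * emeasure Wt {2 ^ k * w0<..} = ennreal (c k * measure Wt {2 ^ k * w0<..})"
      using c0 by (simp add: emeasure_eq_measure ennreal_mult)
    also have "\<dots> \<le> ennreal (c k * \<rho> ^ k)"
      using c0 tail by (intro ennreal_leI mult_left_mono)
    finally show "ennreal (c k) * emeasure Wt {2 ^ k * w0<..} \<le> ennreal (c k * \<rho> ^ k)" .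
  qed
  finally have le: "(\<integral>\<^sup>+w. ennreal (w powr s) \<partial>Wt) \<le> ennreal (w0 powr s) + (\<Sum>k. ennreal (c k * \<rho> ^ k))" .
  have "(\<Sum>k. ennreal (c k * \<rho> ^ k)) < top"
  proof -
    have "c k * \<rho> ^ k = (2 * w0) powr s * (2 powr s * \<rho>) ^ k" for k
    proof -
      have "(2 ^ Suc k * w0) powr s = (2 * w0) powr s * (2 powr s) ^ k"
      proof -
        have "(2 ^ k :: real) powr s = (2 powr s) ^ k"
          by (simp add: powr_realpow[symmetric] powr_powr mult.commute)
        moreover have "(2 ^ Suc k * w0) powr s = ((2 * w0) * 2 ^ k) powr s"
          by (simp add: ac_simps)
        ultimately show ?thesis using w0(1) by (simp add: powr_mult)
      qed
      then show ?thesis by (simp add: c_def power_mult_distrib)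
    qed
    moreover have "2 powr s * \<rho> < 1"
    proof -
      have "2 powr s * \<rho> = 2 powr (s - (s + (\<tau> - 1)) / 2)" by (simp add: \<rho>_def powr_add[symmetric])
      also have "\<dots> < 2 powr 0" using s by (intro powr_less_mono) (auto simp: field_simps)
      finally show ?thesis by simp
    qed
    ultimately have "summable (\<lambda>k. c k * \<rho> ^ k)"
      using \<rho>0 by (simp add: summable_geometric)
    then show ?thesis
      using c0 \<rho>0 by (subst suminf_ennreal2) auto
  qed
  then show ?thesis using le by (simp add: le_less_trans)
qed

context weighted_graph
begin

text \<open>The bound \<open>u powr s\<close> is a product over the two endpoints, so independence
  of their weights produces the square of the moment of order \<open>s\<close>.\<close>

lemma integral_edge_p_bound:
  fixes x y :: "'a::euclidean_space"
  assumes pos: "AE w in Wt. 0 < w" and s: "0 < s" "s \<le> 1" and xy: "x \<in> \<eta>" "y \<in> \<eta>" "x \<noteq> y"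
  shows "(\<integral>\<^sup>+w. ennreal (edge_p w {x, y}) \<partial>weights \<eta>)
    \<le> (\<integral>\<^sup>+w. ennreal (w powr s) \<partial>Wt) ^ 2 * ennreal (norm (x - y) powr (- (\<alpha> * s)))"
proof -
  let ?X = "{x, y}"
  have pr: "distr (weights \<eta>) (weights ?X) (\<lambda>w. restrict w ?X) = weights ?X"
    using xy by (intro PW.distr_PiM_restrict_finite) auto
  have e: "{x, y} \<in> pairs ?X" using xy by (auto simp: pairs_def)
  have "(\<integral>\<^sup>+w. ennreal (edge_p w {x, y}) \<partial>weights \<eta>) = (\<integral>\<^sup>+w. ennreal (edge_p (restrict w ?X) {x, y}) \<partial>weights \<eta>)"
    by (simp add: edge_p_restrict[OF e])
  also have "\<dots> = (\<integral>\<^sup>+w. ennreal (edge_p w {x, y}) \<partial>distr (weights \<eta>) (weights ?X) (\<lambda>w. restrict w ?X))"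
    using xy edge_p_measurable[OF e] by (intro nn_integral_distr[symmetric] measurable_restrict_subset) auto
  also have "\<dots> = (\<integral>\<^sup>+w. ennreal (edge_p w {x, y}) \<partial>weights ?X)" by (simp only: pr)
  also have "\<dots> \<le> (\<integral>\<^sup>+w. ennreal (norm (x - y) powr (- (\<alpha> * s))) * (\<Prod>z\<in>?X. ennreal (w z powr s)) \<partial>weights ?X)"
  proof (rule nn_integral_mono_AE)
    have "AE w in weights ?X. 0 < w z" if "z \<in> ?X" for z
      using that pos W.prob_space_axioms by (intro AE_PiM_component) auto
    then have "AE w in weights ?X. 0 < w x \<and> 0 < w y" by simp
    then show "AE w in weights ?X. ennreal (edge_p w {x, y}) \<le> ennreal (norm (x - y) powr (- (\<alpha> * s))) * (\<Prod>z\<in>?X. ennreal (w z powr s))"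
    proof eventually_elim
      case (elim w)
      define u where "u = w x * w y / norm (x - y) powr \<alpha>"
      have u: "u > 0" using elim xy by (simp add: u_def)
      have "edge_p w {x, y} = clamp01 (1 - exp (- u))" by (simp add: edge_p_def edge_prob_pair[OF xy(3)] u_def)
      also have "\<dots> \<le> u powr s"
      proof (cases "u \<ge> 1")
        case True
        then have "1 \<le> u powr s" using s by (simp add: ge_one_powr_ge_zero)
        then show ?thesis using clamp01_range order_trans by blast
      next
        case False
        have "1 - exp (- u) \<le> u" using exp_ge_add_one_self[of "- u"] by simp
        also have "u \<le> u powr s" using False u s powr_mono'[of s 1 u] by simp
        finally show ?thesis using u by (simp add: clamp01_def)
      qed
      also have "u powr s = norm (x - y) powr (- (\<alpha> * s)) * (w x powr s * w y powr s)"
        using elim by (simp add: u_def powr_divide powr_mult powr_powr powr_minus_divide)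
      finally have le: "edge_p w {x, y} \<le> norm (x - y) powr (- (\<alpha> * s)) * (w x powr s * w y powr s)" .
      have "ennreal (norm (x - y) powr (- (\<alpha> * s))) * (\<Prod>z\<in>?X. ennreal (w z powr s)) =
          ennreal (norm (x - y) powr (- (\<alpha> * s)) * (w x powr s * w y powr s))"
        using xy by (simp add: ennreal_mult)
      then show ?case using ennreal_leI[OF le] by (simp only:)
    qed
  qed
  also have "\<dots> = ennreal (norm (x - y) powr (- (\<alpha> * s))) * (\<integral>\<^sup>+w. (\<Prod>z\<in>?X. ennreal (w z powr s)) \<partial>weights ?X)"
    by (intro nn_integral_cmult borel_measurable_prod_ennreal) auto
  also have "(\<integral>\<^sup>+w. (\<Prod>z\<in>?X. ennreal (w z powr s)) \<partial>weights ?X) = (\<Prod>z\<in>?X. \<integral>\<^sup>+w. ennreal (w powr s) \<partial>Wt)"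
    by (rule PW.product_nn_integral_prod) auto
  also have "\<dots> = (\<integral>\<^sup>+w. ennreal (w powr s) \<partial>Wt) ^ 2"
    using xy by (simp add: power2_eq_square)
  finally show ?thesis by (simp add: mult.commute)
qed

lemma measure_edge:
  assumes "e \<in> pairs \<eta>"
  shows "emeasure (Q \<eta>) {G \<in> space (Q \<eta>). snd G e} = (\<integral>\<^sup>+w. ennreal (edge_p w e) \<partial>weights \<eta>)"
proof -
  have ev: "{G \<in> space (Q \<eta>). snd G e} \<in> sets (Q \<eta>)"
    using edge_event[OF assms] by (simp add: sets_Q space_Q)
  have "measure (Q \<eta>) {G \<in> space (Q \<eta>). snd G e} = (\<integral>G. indicator {G \<in> space (Q \<eta>). snd G e} G \<partial>Q \<eta>)"
    by (simp add: Int_absorb2)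
  also have "\<dots> = (\<integral>G. (\<lambda>S. if e \<in> S then 1 else 0) {e'\<in>{e}. snd G e'} \<partial>Q \<eta>)"
    by (intro Bochner_Integration.integral_cong refl) (auto simp: indicator_def)
  also have "\<dots> = (\<integral>w. bern (edge_p w) {e} (\<lambda>S. if e \<in> S then 1 else 0) \<partial>weights \<eta>)"
    using assms by (intro integral_Q_finite) auto
  also have "\<dots> = (\<integral>w. edge_p w e \<partial>weights \<eta>)"
    by (simp add: bern_insert)
  finally have "ennreal (measure (Q \<eta>) {G \<in> space (Q \<eta>). snd G e}) = ennreal (\<integral>w. edge_p w e \<partial>weights \<eta>)"
    by simp
  also have "\<dots> = (\<integral>\<^sup>+w. ennreal (edge_p w e) \<partial>weights \<eta>)"
  proof (rule nn_integral_eq_integral[symmetric])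
    have "integrable (weights \<eta>) (\<lambda>w. bern (edge_p w) {e} (\<lambda>S. if e \<in> S then 1 else 0))"
      using assms by (intro bern_edge_p_integrable) auto
    then show "integrable (weights \<eta>) (\<lambda>w. edge_p w e)" by (simp add: bern_insert)
  qed (use edge_p_range in auto)
  finally show ?thesis
    by (simp only: finite_measure.emeasure_eq_measure[OF prob_space.finite_measure[OF prob_Q]])
qed

end

lemma edge_decay:
  fixes L :: "real \<Rightarrow> real"
  assumes W: "weight_distribution \<tau> L Wt" and L: "slowly_varying L" and "\<tau> > 1"
    and "\<alpha> > real DIM('a::euclidean_space)" "\<alpha> * (\<tau> - 1) / real DIM('a) > 1"
  obtains \<beta> B :: real where "\<beta> > real DIM('a)" "B \<ge> 0"
    "\<And>\<eta> x y. x \<in> \<eta> \<Longrightarrow> y \<in> \<eta> \<Longrightarrow> x \<noteq> (y::'a) \<Longrightarrow>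
      emeasure (quenched_law \<alpha> Wt \<eta>) {G \<in> space (quenched_law \<alpha> Wt \<eta>). snd G {x, y}}
        \<le> ennreal (B * norm (x - y) powr (- \<beta>))"
proof -
  have "real_distribution Wt" using W by (simp add: weight_distribution_def)
  then interpret weighted_graph \<alpha> Wt by (rule weighted_graph.intro)
  let ?d = "real DIM('a)"
  have \<alpha>: "\<alpha> > 0" using assms(4) DIM_positive[where 'a = 'a] by linarith
  \<comment> \<open>The two hypotheses on the parameters are exactly the two halves of this
    inequality.\<close>
  have "?d / \<alpha> < min 1 (\<tau> - 1)" using assms \<alpha> by (auto simp: field_simps)
  then obtain s where s: "?d / \<alpha> < s" "s < min 1 (\<tau> - 1)" using dense by blast
  have s0: "0 < s" using s(1) \<alpha> DIM_positive[where 'a = 'a] by (meson divide_pos_pos of_nat_0_less_iff order_less_trans)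
  define M where "M = (\<integral>\<^sup>+w. ennreal (w powr s) \<partial>Wt)"
  have M: "M < \<infinity>" unfolding M_def using s s0 by (intro weight_moment_finite[OF W L]) auto
  show ?thesis
  proof (rule that[of "\<alpha> * s" "(enn2real M) ^ 2"])
    show "\<alpha> * s > ?d" using s(1) \<alpha> by (simp add: field_simps)
    fix \<eta> and x y :: 'a assume xy: "x \<in> \<eta>" "y \<in> \<eta>" "x \<noteq> y"
    have "emeasure (Q \<eta>) {G \<in> space (Q \<eta>). snd G {x, y}} = (\<integral>\<^sup>+w. ennreal (edge_p w {x, y}) \<partial>weights \<eta>)"
      using xy by (intro measure_edge) (auto simp: pairs_def)
    also have "\<dots> \<le> M ^ 2 * ennreal (norm (x - y) powr (- (\<alpha> * s)))"
      unfolding M_def using W s s0 xy by (intro integral_edge_p_bound) (auto simp: weight_distribution_def)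
    also have "M ^ 2 = ennreal (enn2real M ^ 2)"
      using M by (simp add: ennreal_power[symmetric])
    finally show "emeasure (Q \<eta>) {G \<in> space (Q \<eta>). snd G {x, y}} \<le> ennreal (enn2real M ^ 2 * norm (x - y) powr (- (\<alpha> * s)))"
      by (simp add: ennreal_mult)
  qed simp
qed

section \<open>Quenched concentration\<close>

text \<open>The third edge of a triangle at \<open>x\<close> joins two neighbours of
  \<open>x\<close>, so a vertex set containing \<open>x\<close> and its neighbours determines the
  coefficient.\<close>

lemma CC_Int_pairs:
  assumes "x \<in> X" "neighbors Es x \<subseteq> X" "Es \<subseteq> pairs Y"
  shows "neighbors (Es \<inter> pairs X) x = neighbors Es x" "CC (Es \<inter> pairs X) x = CC Es x"
proof -
  show N: "neighbors (Es \<inter> pairs X) x = neighbors Es x"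
  proof (intro equalityI subsetI)
    fix y assume y: "y \<in> neighbors Es x"
    then have "y \<noteq> x" using neighbors_subset[OF assms(3), of x] by auto
    then have "{x, y} \<in> pairs X" using y assms(1,2) by (auto simp: pairs_def)
    then show "y \<in> neighbors (Es \<inter> pairs X) x" using y by (simp add: neighbors_def)
  qed (auto simp: neighbors_def)
  have "{e \<in> Es \<inter> pairs X. e \<subseteq> neighbors Es x} = {e \<in> Es. e \<subseteq> neighbors Es x}"
    using assms(2,3) pairs_within by blast
  then have "triangles (Es \<inter> pairs X) x = triangles Es x"
    using assms(3) by (simp add: triangles_eq[of _ Y] N le_infI1)
  then show "CC (Es \<inter> pairs X) x = CC Es x"
    by (simp only: CC_def degr_def N)
qed

lemma edge_set_subset: "edge_set \<eta> G \<subseteq> pairs \<eta>"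
  by (auto simp: edge_set_def)

text \<open>The tail of the weight law enters from here on only through the decay exponent
  \<open>\<beta>\<close> and the constant \<open>B\<close>. Positivity of the weights is what makes
  the limit strictly positive.\<close>

locale scale_free = poisson_process \<nu> PP + weighted_graph \<alpha> Wt
  for \<nu> :: real and PP :: "'a::euclidean_space set measure" and \<alpha> :: real and Wt :: "real measure" +
  fixes \<beta> B :: real
  assumes beta: "\<beta> > real DIM('a)" and B: "B \<ge> 0"
    and edge_bound: "\<And>\<eta> x y. x \<in> \<eta> \<Longrightarrow> y \<in> \<eta> \<Longrightarrow> x \<noteq> (y::'a) \<Longrightarrow>
      emeasure (quenched_law \<alpha> Wt \<eta>) {G \<in> space (quenched_law \<alpha> Wt \<eta>). snd G {x, y}}
        \<le> ennreal (B * norm (x - y) powr (- \<beta>))"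
    and weight_pos: "AE w in Wt. 0 < w"
begin

section \<open>Edges leaving a window\<close>

definition far_edge :: "'a set \<Rightarrow> nat \<Rightarrow> 'a \<Rightarrow> (('a \<Rightarrow> real) \<times> ('a set \<Rightarrow> bool)) set" where
  "far_edge \<eta> K x = {G \<in> space (Q \<eta>). \<exists>y\<in>\<eta> - window K x. snd G {x, y}}"

text \<open>Bounds the probability of one edge from the center to a point of the dyadic shell number
  \<open>i\<close>, which lies at distance at least \<open>2 ^ i * K\<close>.\<close>

definition shell_bound :: "nat \<Rightarrow> nat \<Rightarrow> real" where
  "shell_bound K i = B * real (2 ^ i * K) powr (- \<beta>)"

lemma shell_bound_nonneg: "0 \<le> shell_bound K i"
  using B by (simp add: shell_bound_def)

definition shell :: "'a set \<Rightarrow> nat \<Rightarrow> 'a \<Rightarrow> nat \<Rightarrow> 'a set" where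
  "shell \<eta> K x i = \<eta> \<inter> window (2 ^ Suc i * K) x - window (2 ^ i * K) x"

lemma far_edge_shells:
  assumes "K > 0"
  shows "far_edge \<eta> K x = (\<Union>i. \<Union>y\<in>shell \<eta> K x i. {G \<in> space (Q \<eta>). snd G {x, y}})"
proof -
  have eq: "\<eta> - window K x = (\<Union>i. shell \<eta> K x i)"
  proof (intro equalityI subsetI)
    fix y assume y: "y \<in> \<eta> - window K x"
    obtain k where k: "y \<in> window k x" by (rule in_some_window)
    have "k * 1 \<le> 2 ^ k * K" using assms by (intro mult_le_mono) (auto simp: less_imp_le)
    then have ex: "y \<in> window (2 ^ k * K) x" using k window_mono[of k "2 ^ k * K" x] by auto
    define i where "i = (LEAST i. y \<in> window (2 ^ i * K) x)"
    have i: "y \<in> window (2 ^ i * K) x" unfolding i_def using ex by (rule LeastI)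
    then obtain j where j: "i = Suc j" using y by (cases i) auto
    have "j < i" by (simp add: j)
    then have "y \<notin> window (2 ^ j * K) x" unfolding i_def by (rule not_less_Least)
    then show "y \<in> (\<Union>i. shell \<eta> K x i)" using y i j unfolding shell_def by blast
  next
    fix y assume "y \<in> (\<Union>i. shell \<eta> K x i)"
    then obtain i where i: "y \<in> shell \<eta> K x i" by blast
    have "K \<le> 2 ^ i * K" by simp
    then show "y \<in> \<eta> - window K x" using i window_mono[of K "2 ^ i * K" x] unfolding shell_def by blast
  qed
  show ?thesis unfolding far_edge_def eq by blast
qed

lemma shell_props:
  assumes "locally_finite \<eta>" "x \<in> \<eta>" "K > 0"
  shows "finite (shell \<eta> K x i)"
    and "y \<in> shell \<eta> K x i \<Longrightarrow> y \<in> \<eta> \<and> x \<noteq> y \<and> real (2 ^ i * K) \<le> norm (x - y)"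
proof -
  show "finite (shell \<eta> K x i)"
    using locally_finite_window[OF assms(1)] by (simp add: shell_def)
  assume y: "y \<in> shell \<eta> K x i"
  then have "real (2 ^ i * K) \<le> norm (x - y)"
    unfolding shell_def by (intro norm_ge_outside_window) auto
  moreover have "real (2 ^ i * K) > 0" using assms(3) by simp
  ultimately have "x \<noteq> y" by auto
  with y \<open>real (2 ^ i * K) \<le> norm (x - y)\<close> show "y \<in> \<eta> \<and> x \<noteq> y \<and> real (2 ^ i * K) \<le> norm (x - y)"
    by (simp add: shell_def)
qed

lemma edge_event_Q:
  assumes "x \<in> \<eta>" "y \<in> \<eta>" "x \<noteq> y"
  shows "{G \<in> space (Q \<eta>). snd G {x, y}} \<in> sets (Q \<eta>)"
proof -
  have "{x, y} \<in> pairs \<eta>" using assms by (auto simp: pairs_def)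
  then show ?thesis using edge_event by (simp only: space_Q sets_Q)
qed

lemma far_edge_sets:
  assumes "locally_finite \<eta>" "x \<in> \<eta>" "K > 0"
  shows "far_edge \<eta> K x \<in> sets (Q \<eta>)"
  unfolding far_edge_shells[OF assms(3)]
  using shell_props[OF assms] assms(2)
  by (intro sets.countable_UN'' sets.finite_UN edge_event_Q) auto

text \<open>A union bound shell by shell. The shells are enlarged to full windows in the count,
  because the mean of window counts is known from \<open>first_moment_nbr_count\<close>.\<close>

lemma emeasure_far_edge_le:
  assumes "locally_finite \<eta>" "x \<in> \<eta>" "K > 0"
  shows "emeasure (Q \<eta>) (far_edge \<eta> K x) \<le>
    (\<Sum>i. ennreal (shell_bound K i * real (card (\<eta> \<inter> window (2 ^ Suc i * K) x))))"
proof -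
  let ?E = "\<lambda>y. {G \<in> space (Q \<eta>). snd G {x, y}}"
  note sp = shell_props[OF assms]
  have ev: "?E y \<in> sets (Q \<eta>)" if "y \<in> shell \<eta> K x i" for i y
    using sp(2)[OF that] assms(2) by (intro edge_event_Q) auto
  have "emeasure (Q \<eta>) (far_edge \<eta> K x) \<le> (\<Sum>i. emeasure (Q \<eta>) (\<Union>y\<in>shell \<eta> K x i. ?E y))"
    unfolding far_edge_shells[OF assms(3)]
    using ev sp(1) by (intro emeasure_subadditive_countably) auto
  also have "\<dots> \<le> (\<Sum>i. ennreal (shell_bound K i * real (card (\<eta> \<inter> window (2 ^ Suc i * K) x))))"
  proof (intro suminf_le summableI)
    fix i
    have "emeasure (Q \<eta>) (\<Union>y\<in>shell \<eta> K x i. ?E y) \<le> (\<Sum>y\<in>shell \<eta> K x i. emeasure (Q \<eta>) (?E y))"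
      using ev sp(1) by (intro emeasure_subadditive_finite) auto
    also have "\<dots> \<le> (\<Sum>y\<in>shell \<eta> K x i. ennreal (shell_bound K i))"
    proof (intro sum_mono)
      fix y assume y: "y \<in> shell \<eta> K x i"
      have "norm (x - y) powr (- \<beta>) \<le> real (2 ^ i * K) powr (- \<beta>)"
        using sp(2)[OF y] assms(3) beta by (intro powr_mono2') auto
      then have "B * norm (x - y) powr (- \<beta>) \<le> shell_bound K i"
        unfolding shell_bound_def using B by (intro mult_left_mono)
      then show "emeasure (Q \<eta>) (?E y) \<le> ennreal (shell_bound K i)"
        using edge_bound[of x \<eta> y] sp(2)[OF y] assms(2) ennreal_leI order_trans by blast
    qed
    also have "\<dots> = ennreal (shell_bound K i * real (card (shell \<eta> K x i)))"
      using shell_bound_nonneg by (simp add: ennreal_mult ennreal_of_nat_eq_real_of_nat mult.commute)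
    also have "\<dots> \<le> ennreal (shell_bound K i * real (card (\<eta> \<inter> window (2 ^ Suc i * K) x)))"
      using shell_bound_nonneg locally_finite_window[OF assms(1)]
      by (intro ennreal_leI mult_left_mono) (auto simp: shell_def intro!: card_mono)
    finally show "emeasure (Q \<eta>) (\<Union>y\<in>shell \<eta> K x i. ?E y) \<le>
      ennreal (shell_bound K i * real (card (\<eta> \<inter> window (2 ^ Suc i * K) x)))" .
  qed
  finally show ?thesis .
qed

lemma neighbors_if_no_far_edge:
  assumes "G \<in> space (Q \<eta>)" "G \<notin> far_edge \<eta> K x" "x \<in> \<eta>"
  shows "neighbors (edge_set \<eta> G) x \<subseteq> \<eta> \<inter> window K x"
proof
  fix y assume y: "y \<in> neighbors (edge_set \<eta> G) x"
  then have "snd G {x, y}" by (simp add: neighbors_def edge_set_def)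
  moreover have "y \<in> \<eta>" using y neighbors_subset[OF edge_set_subset, of \<eta> G x] by auto
  ultimately show "y \<in> \<eta> \<inter> window K x"
    using assms(1,2) by (auto simp: far_edge_def)
qed

lemma CC_if_no_far_edge:
  assumes "G \<in> space (Q \<eta>)" "G \<notin> far_edge \<eta> K x" "x \<in> \<eta>" "K > 0"
  shows "CC (edge_set \<eta> G \<inter> pairs (\<eta> \<inter> window K x)) x = CC (edge_set \<eta> G) x"
  using assms neighbors_if_no_far_edge[OF assms(1-3)] window_self[of K x]
  by (intro CC_Int_pairs(2)[OF _ _ edge_set_subset]) auto

section \<open>Truncated coefficients and their quenched fluctuations\<close>

definition CC_sum :: "'a set \<Rightarrow> ('a \<Rightarrow> real) \<times> ('a set \<Rightarrow> bool) \<Rightarrow> nat \<Rightarrow> real" where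
  "CC_sum \<eta> G k = (\<Sum>x\<in>\<eta> \<inter> window k 0. CC (edge_set \<eta> G) x)"

definition CC_local :: "'a set \<Rightarrow> ('a \<Rightarrow> real) \<times> ('a set \<Rightarrow> bool) \<Rightarrow> nat \<Rightarrow> 'a \<Rightarrow> real" where
  "CC_local \<eta> G K x = CC (edge_set \<eta> G \<inter> pairs (\<eta> \<inter> window K x)) x"

definition CC_local_sum :: "'a set \<Rightarrow> ('a \<Rightarrow> real) \<times> ('a set \<Rightarrow> bool) \<Rightarrow> nat \<Rightarrow> nat \<Rightarrow> real" where
  "CC_local_sum \<eta> G k K = (\<Sum>x\<in>\<eta> \<inter> window k 0. CC_local \<eta> G K x)"

lemma CC_local_measurable:
  "locally_finite \<eta> \<Longrightarrow> (\<lambda>G. CC_local \<eta> G K x) \<in> borel_measurable (Q \<eta>)"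
  unfolding CC_local_def by (rule local_measurable) (auto simp: locally_finite_window)

lemma CC_local_sum_measurable:
  assumes "locally_finite \<eta>"
  shows "(\<lambda>G. CC_local_sum \<eta> G k K) \<in> borel_measurable (Q \<eta>)"
  unfolding CC_local_sum_def by (intro borel_measurable_sum CC_local_measurable assms)

text \<open>If \<open>y\<close> lies outside \<open>window (2 * K) x\<close>, the two truncations
  use disjoint vertex sets and \<open>integral_Q_local_prod\<close> makes the covariance vanish;
  otherwise the centered coefficients are at most 1 in absolute value.\<close>

lemma CC_local_covariance:
  fixes K :: nat
  assumes lf: "locally_finite \<eta>"
  defines "m \<equiv> \<lambda>x. mean_val CC (\<eta> \<inter> window K x) x"
  shows "(\<integral>G. (CC_local \<eta> G K x - m x) * (CC_local \<eta> G K y - m y) \<partial>Q \<eta>) \<le>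
      (if y \<in> window (2 * K) x then 1 else 0)"
    and "integrable (Q \<eta>) (\<lambda>G. (CC_local \<eta> G K x - m x) * (CC_local \<eta> G K y - m y))"
proof -
  interpret P: prob_space "Q \<eta>" by (rule prob_Q)
  note [measurable] = CC_local_measurable[OF lf]
  let ?f = "\<lambda>x G. CC_local \<eta> G K x"
  have fin: "finite (\<eta> \<inter> window K z)" for z using lf by (rule locally_finite_window)
  have mr: "0 \<le> m z \<and> m z \<le> 1" for z
    unfolding m_def by (rule mean_val_range[OF fin CC_range])
  have fr: "0 \<le> ?f z G \<and> ?f z G \<le> 1" for z G
    unfolding CC_local_def by (rule CC_range)
  have pr: "\<bar>(?f x G - m x) * (?f y G - m y)\<bar> \<le> 1" for G
    using fr[of G x] fr[of G y] mr[of x] mr[of y] unfolding abs_mult by (intro mult_le_one) auto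
  show int: "integrable (Q \<eta>) (\<lambda>G. (?f x G - m x) * (?f y G - m y))"
    by (rule integrable_Q) (use pr in auto)
  have intf: "integrable (Q \<eta>) (?f z)" for z
    by (rule integrable_Q) (use fr in auto)
  have intff: "integrable (Q \<eta>) (\<lambda>G. ?f x G * ?f y G)"
    by (rule integrable_Q) (use fr in \<open>auto simp: abs_mult intro!: mult_le_one\<close>)
  have Ef: "(\<integral>G. ?f z G \<partial>Q \<eta>) = m z" for z
    unfolding CC_local_def m_def by (rule integral_Q_local[OF fin]) auto
  show "(\<integral>G. (?f x G - m x) * (?f y G - m y) \<partial>Q \<eta>) \<le> (if y \<in> window (2 * K) x then 1 else 0)"
  proof (cases "y \<in> window (2 * K) x")
    case True
    have "(\<integral>G. (?f x G - m x) * (?f y G - m y) \<partial>Q \<eta>) \<le> (\<integral>G. 1 \<partial>Q \<eta>)"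
      by (rule integral_mono[OF int]) (use pr abs_le_D1 in auto)
    then show ?thesis using True by (simp add: P.prob_space)
  next
    case False
    then have dj: "(\<eta> \<inter> window K x) \<inter> (\<eta> \<inter> window K y) = {}"
      using window_disjoint[of y K x] by auto
    have "(\<integral>G. (?f x G - m x) * (?f y G - m y) \<partial>Q \<eta>) =
       (\<integral>G. ?f x G * ?f y G - m y * ?f x G - m x * ?f y G + m x * m y \<partial>Q \<eta>)"
      by (intro Bochner_Integration.integral_cong refl) (simp add: algebra_simps)
    also have "\<dots> = (\<integral>G. ?f x G * ?f y G \<partial>Q \<eta>) - m x * m y"
      using intf intff by (simp add: Ef P.prob_space)
    also have "(\<integral>G. ?f x G * ?f y G \<partial>Q \<eta>) = m x * m y"
      unfolding CC_local_def m_def by (rule integral_Q_local_prod[OF fin _ fin _ dj]) auto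
    finally show ?thesis using False by simp
  qed
qed

text \<open>Of the expanded square only pairs within range \<open>2 * K\<close> survive, each
  contributing at most 1.\<close>

lemma second_moment_CC_local_sum:
  assumes lf: "locally_finite \<eta>"
  shows "(\<integral>\<^sup>+G. ennreal ((CC_local_sum \<eta> G k K - local_sum (mean_val CC) k K \<eta>) ^ 2) \<partial>Q \<eta>)
    \<le> ennreal (local_sum nbr_count k (2 * K) \<eta>)"
proof -
  let ?V = "\<eta> \<inter> window k 0"
  let ?c = "\<lambda>x G. CC_local \<eta> G K x - mean_val CC (\<eta> \<inter> window K x) x"
  have finV: "finite ?V" using lf by (rule locally_finite_window)
  have eq: "(CC_local_sum \<eta> G k K - local_sum (mean_val CC) k K \<eta>) ^ 2 = (\<Sum>x\<in>?V. \<Sum>y\<in>?V. ?c x G * ?c y G)" for G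
    unfolding CC_local_sum_def local_sum_def sum_subtractf[symmetric] power2_eq_square sum_product ..
  note cov = CC_local_covariance[OF lf]
  have "(\<integral>\<^sup>+G. ennreal ((CC_local_sum \<eta> G k K - local_sum (mean_val CC) k K \<eta>) ^ 2) \<partial>Q \<eta>) =
    ennreal (\<integral>G. (CC_local_sum \<eta> G k K - local_sum (mean_val CC) k K \<eta>) ^ 2 \<partial>Q \<eta>)"
    unfolding eq
    by (intro nn_integral_eq_integral Bochner_Integration.integrable_sum cov(2))
      (auto simp flip: eq)
  also have "(\<integral>G. (CC_local_sum \<eta> G k K - local_sum (mean_val CC) k K \<eta>) ^ 2 \<partial>Q \<eta>) =
    (\<Sum>x\<in>?V. \<Sum>y\<in>?V. \<integral>G. ?c x G * ?c y G \<partial>Q \<eta>)"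
    unfolding eq using cov(2) by (simp add: Bochner_Integration.integral_sum)
  also have "\<dots> \<le> (\<Sum>x\<in>?V. \<Sum>y\<in>?V. if y \<in> window (2 * K) x then 1 else 0)"
    by (intro sum_mono cov(1))
  also have "\<dots> \<le> (\<Sum>x\<in>?V. nbr_count (\<eta> \<inter> window (2 * K) x) x)"
  proof (intro sum_mono)
    fix x
    have "(\<Sum>y\<in>?V. if y \<in> window (2 * K) x then 1 else 0) = real (card {y\<in>?V. y \<in> window (2 * K) x})"
      using finV by (simp add: sum.If_cases Int_def)
    also have "\<dots> \<le> nbr_count (\<eta> \<inter> window (2 * K) x) x"
      unfolding nbr_count_def using locally_finite_window[OF lf] by (auto intro!: card_mono)
    finally show "(\<Sum>y\<in>?V. if y \<in> window (2 * K) x then 1 else 0) \<le> nbr_count (\<eta> \<inter> window (2 * K) x) x" .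
  qed
  finally show ?thesis by (simp add: local_sum_def ennreal_leI)
qed

definition far_count :: "'a set \<Rightarrow> ('a \<Rightarrow> real) \<times> ('a set \<Rightarrow> bool) \<Rightarrow> nat \<Rightarrow> nat \<Rightarrow> real" where
  "far_count \<eta> G k K = (\<Sum>x\<in>\<eta> \<inter> window k 0. indicator (far_edge \<eta> K x) G)"

text \<open>Bounds the expected number of vertices with an edge leaving their window. The value is
  an extended real because it may be infinite for exceptional configurations.\<close>

definition tail_total :: "nat \<Rightarrow> nat \<Rightarrow> 'a set \<Rightarrow> ennreal" where
  "tail_total k K \<eta> = (\<Sum>i. ennreal (shell_bound K i * local_sum nbr_count k (2 ^ Suc i * K) \<eta>))"

text \<open>Truncation changes a coefficient only at a vertex with an edge leaving its window, and
  then by at most 1.\<close>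

lemma CC_sum_local_diff:
  assumes "G \<in> space (Q \<eta>)" "K > 0"
  shows "\<bar>CC_sum \<eta> G k - CC_local_sum \<eta> G k K\<bar> \<le> far_count \<eta> G k K"
proof -
  have "\<bar>CC (edge_set \<eta> G) x - CC_local \<eta> G K x\<bar> \<le> indicator (far_edge \<eta> K x) G" if "x \<in> \<eta>" for x
  proof (cases "G \<in> far_edge \<eta> K x")
    case True
    then show ?thesis
      using CC_range[of "edge_set \<eta> G" x] CC_range[of "edge_set \<eta> G \<inter> pairs (\<eta> \<inter> window K x)" x]
      by (simp add: CC_local_def abs_le_iff)
  next
    case False
    then show ?thesis using CC_if_no_far_edge[OF assms(1) False that assms(2)] by (simp add: CC_local_def)
  qed
  then show ?thesis
    unfolding CC_sum_def CC_local_sum_def far_count_def sum_subtractf[symmetric]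
    by (intro order_trans[OF sum_abs] sum_mono) auto
qed

lemma far_count_measurable:
  assumes "locally_finite \<eta>" "K > 0"
  shows "(\<lambda>G. far_count \<eta> G k K) \<in> borel_measurable (Q \<eta>)"
  unfolding far_count_def using far_edge_sets[OF assms(1) _ assms(2)]
  by (intro borel_measurable_sum borel_measurable_indicator) auto

lemma nn_integral_far_count_le:
  assumes "locally_finite \<eta>" "K > 0"
  shows "(\<integral>\<^sup>+G. ennreal (far_count \<eta> G k K) \<partial>Q \<eta>) \<le> tail_total k K \<eta>"
proof -
  let ?V = "\<eta> \<inter> window k 0"
  have finV: "finite ?V" using assms(1) by (rule locally_finite_window)
  have "(\<integral>\<^sup>+G. ennreal (far_count \<eta> G k K) \<partial>Q \<eta>) = (\<integral>\<^sup>+G. (\<Sum>x\<in>?V. indicator (far_edge \<eta> K x) G) \<partial>Q \<eta>)"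
    unfolding far_count_def by (simp flip: sum_ennreal ennreal_indicator)
  also have "\<dots> = (\<Sum>x\<in>?V. emeasure (Q \<eta>) (far_edge \<eta> K x))"
    using far_edge_sets[OF assms(1) _ assms(2)] by (subst nn_integral_sum) auto
  also have "\<dots> \<le> (\<Sum>x\<in>?V. \<Sum>i. ennreal (shell_bound K i * real (card (\<eta> \<inter> window (2 ^ Suc i * K) x))))"
    by (intro sum_mono emeasure_far_edge_le assms) auto
  also have "\<dots> = (\<Sum>i. \<Sum>x\<in>?V. ennreal (shell_bound K i * real (card (\<eta> \<inter> window (2 ^ Suc i * K) x))))"
    by (rule suminf_sum[symmetric]) (rule summableI)
  also have "\<dots> = tail_total k K \<eta>"
    unfolding tail_total_def local_sum_def nbr_count_def sum_distrib_left
    using shell_bound_nonneg by (intro suminf_cong sum_ennreal) auto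
  finally show ?thesis .
qed

text \<open>Conditionally on the configuration, the clustering sums concentrate around their quenched
  means along any sequence of windows satisfying two summability conditions.\<close>

lemma quenched_concentration:
  assumes lf: "locally_finite \<eta>" and K: "\<And>j. K j > 0" and H: "\<And>j. H j > 0"
    and near: "(\<Sum>j. ennreal (local_sum nbr_count (k j) (2 * K j) \<eta> / H j ^ 2)) < \<infinity>"
    and far: "(\<Sum>j. tail_total (k j) (K j) \<eta> * ennreal (1 / H j)) < \<infinity>"
  shows "AE G in Q \<eta>. (\<lambda>j. CC_sum \<eta> G (k j) / H j - local_sum (mean_val CC) (k j) (K j) \<eta> / H j) \<longlonglongrightarrow> 0"
proof -
  let ?T = "\<lambda>j. local_sum (mean_val CC) (k j) (K j) \<eta>"
  have "AE G in Q \<eta>. (\<lambda>j. far_count \<eta> G (k j) (K j) / H j) \<longlonglongrightarrow> 0"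
  proof (rule AE_tendsto_0[OF _ _ _ far])
    fix j
    show "(\<lambda>G. far_count \<eta> G (k j) (K j) / H j) \<in> borel_measurable (Q \<eta>)"
      by (intro borel_measurable_divide borel_measurable_const far_count_measurable lf K)
    show "0 \<le> far_count \<eta> G (k j) (K j) / H j" for G
      using H[of j] by (auto simp: far_count_def intro!: divide_nonneg_pos sum_nonneg)
    show "(\<integral>\<^sup>+G. ennreal (far_count \<eta> G (k j) (K j) / H j) \<partial>Q \<eta>) \<le> tail_total (k j) (K j) \<eta> * ennreal (1 / H j)"
      unfolding nn_integral_divide[OF far_count_measurable[OF lf K] H]
      by (intro mult_right_mono nn_integral_far_count_le lf K) simp
  qed
  moreover have "AE G in Q \<eta>. (\<lambda>j. (CC_local_sum \<eta> G (k j) (K j) - ?T j) ^ 2 / H j ^ 2) \<longlonglongrightarrow> 0"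
  proof (rule AE_tendsto_0[OF _ _ _ near])
    fix j
    have meas: "(\<lambda>G. (CC_local_sum \<eta> G (k j) (K j) - ?T j) ^ 2) \<in> borel_measurable (Q \<eta>)"
      by (intro borel_measurable_power borel_measurable_diff borel_measurable_const CC_local_sum_measurable lf)
    then show "(\<lambda>G. (CC_local_sum \<eta> G (k j) (K j) - ?T j) ^ 2 / H j ^ 2) \<in> borel_measurable (Q \<eta>)"
      by (intro borel_measurable_divide borel_measurable_const)
    show "(\<integral>\<^sup>+G. ennreal ((CC_local_sum \<eta> G (k j) (K j) - ?T j) ^ 2 / H j ^ 2) \<partial>Q \<eta>)
      \<le> ennreal (local_sum nbr_count (k j) (2 * K j) \<eta> / H j ^ 2)"
      using H[of j] by (intro nn_integral_divide_le[OF meas _ second_moment_CC_local_sum[OF lf] order_refl]) simp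
  qed simp
  ultimately show ?thesis
    using AE_space
  proof eventually_elim
    case (elim G)
    have "(\<lambda>j. sqrt ((CC_local_sum \<eta> G (k j) (K j) - ?T j) ^ 2 / H j ^ 2)) \<longlonglongrightarrow> sqrt 0"
      by (intro tendsto_real_sqrt elim)
    then have "(\<lambda>j. \<bar>(CC_local_sum \<eta> G (k j) (K j) - ?T j) / H j\<bar>) \<longlonglongrightarrow> 0"
      by (simp flip: power_divide)
    from tendsto_add[OF elim(1) this]
    have lim: "(\<lambda>j. far_count \<eta> G (k j) (K j) / H j + \<bar>(CC_local_sum \<eta> G (k j) (K j) - ?T j) / H j\<bar>) \<longlonglongrightarrow> 0" by simp
    show ?case
    proof (rule Lim_null_comparison[OF always_eventually lim], rule allI)
      fix j
      have "\<bar>(CC_sum \<eta> G (k j) - CC_local_sum \<eta> G (k j) (K j)) / H j\<bar> \<le> far_count \<eta> G (k j) (K j) / H j"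
        using CC_sum_local_diff[OF elim(3) K, of "k j" j] H[of j] by (simp add: abs_divide divide_right_mono)
      then show "norm (CC_sum \<eta> G (k j) / H j - ?T j / H j) \<le>
        far_count \<eta> G (k j) (K j) / H j + \<bar>(CC_local_sum \<eta> G (k j) (K j) - ?T j) / H j\<bar>"
        unfolding diff_divide_distrib real_norm_def by linarith
    qed
  qed
qed

end

section \<open>The Palm expectation\<close>

lemma eventually_in_window: "\<forall>\<^sub>F j in sequentially. y \<in> window j x"
proof -
  obtain k where "y \<in> window k x" by (rule in_some_window)
  then show ?thesis
    using window_mono[of k j x for j]
    by (intro eventually_mono[OF eventually_ge_at_top[of k]]) (auto dest: subsetD)
qed

lemma eventually_subset_window:
  assumes "finite F"
  shows "\<forall>\<^sub>F j in sequentially. F \<subseteq> window j x"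
proof -
  have "\<forall>\<^sub>F j in sequentially. \<forall>y\<in>F. y \<in> window j x"
    using assms by (intro eventually_ball_finite ballI eventually_in_window)
  then show ?thesis by eventually_elim auto
qed

lemma locally_finite_insert: "locally_finite \<eta> \<Longrightarrow> locally_finite (insert x \<eta>)"
  by (simp add: locally_finite_def Int_insert_left)

lemma CC_infinite: "infinite (neighbors Es x) \<Longrightarrow> CC Es x = 0"
  by (simp add: CC_def degr_def)

text \<open>A finite neighbourhood is contained in all large windows, and the coefficient
  stabilizes. At infinite degree \<open>Suc k\<close> neighbours finally lie in the window, the
  truncated degree exceeds \<open>k\<close> and the cut-off gives 0, where the plain coefficients
  might oscillate.\<close>

lemma CC_upto_window_tendsto:
  assumes "locally_finite \<eta>" "x \<in> \<eta>" "Es \<subseteq> pairs \<eta>"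
  shows "(\<lambda>j. CC_upto k (Es \<inter> pairs (\<eta> \<inter> window j x)) x)
    \<longlonglongrightarrow> (if finite (neighbors Es x) then CC_upto k Es x else 0)"
proof (cases "finite (neighbors Es x)")
  case True
  have "\<forall>\<^sub>F j in sequentially. CC_upto k Es x = CC_upto k (Es \<inter> pairs (\<eta> \<inter> window j x)) x"
    using eventually_subset_window[OF True, of x] eventually_gt_at_top[of 0]
  proof eventually_elim
    case (elim j)
    have "x \<in> \<eta> \<inter> window j x" using assms(2) elim window_self[of j x] by simp
    moreover have "neighbors Es x \<subseteq> \<eta> \<inter> window j x"
      using elim neighbors_subset[OF assms(3), of x] by auto
    ultimately show ?case
      using CC_Int_pairs[OF _ _ assms(3)] by (simp add: CC_upto_def degr_def)
  qed
  then show ?thesis using True by (simp add: tendsto_eventually eq_commute)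
next
  case False
  obtain F where F: "F \<subseteq> neighbors Es x" "finite F" "card F = Suc k"
    using infinite_arbitrarily_large[OF False] by blast
  have "\<forall>\<^sub>F j in sequentially. CC_upto k (Es \<inter> pairs (\<eta> \<inter> window j x)) x = 0"
    using eventually_subset_window[OF F(2), of x] eventually_gt_at_top[of 0]
  proof eventually_elim
    case (elim j)
    let ?X = "\<eta> \<inter> window j x"
    have x: "x \<in> ?X" using assms(2) elim window_self[of j x] by simp
    have "F \<subseteq> neighbors (Es \<inter> pairs ?X) x"
    proof
      fix y assume y: "y \<in> F"
      then have "y \<in> \<eta> - {x}" using F(1) neighbors_subset[OF assms(3), of x] by auto
      then have "{x, y} \<in> pairs ?X" using x y elim by (auto simp: pairs_def)
      then show "y \<in> neighbors (Es \<inter> pairs ?X) x" using y F(1) by (auto simp: neighbors_def)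
    qed
    moreover have "finite (neighbors (Es \<inter> pairs ?X) x)"
      using neighbors_subset[of "Es \<inter> pairs ?X" ?X x] locally_finite_window[OF assms(1)]
      by (auto intro: finite_subset)
    ultimately have "Suc k \<le> degr (Es \<inter> pairs ?X) x"
      unfolding degr_def F(3)[symmetric] by (intro card_mono)
    then show ?case by (simp add: CC_upto_def)
  qed
  then show ?thesis using False by (simp add: tendsto_eventually)
qed

text \<open>The second of two limits: first the window grows for a fixed degree bound, then the
  bound grows. At infinite degree all terms are 0, as is \<open>CC\<close> itself.\<close>

lemma CC_upto_tendsto:
  "(\<lambda>k. if finite (neighbors Es x) then CC_upto k Es x else 0) \<longlonglongrightarrow> CC Es x"
proof (cases "finite (neighbors Es x)")
  case True
  have "\<forall>\<^sub>F k in sequentially. CC_upto k Es x = CC Es x"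
    using eventually_ge_at_top[of "degr Es x"] by eventually_elim (simp add: CC_upto_def)
  then show ?thesis using True by (simp add: tendsto_eventually)
qed (simp add: CC_infinite)

lemma CC_pos:
  assumes "finite (neighbors Es x)" "y \<in> neighbors Es x" "z \<in> neighbors Es x" "y \<noteq> z" "{y, z} \<in> Es"
  shows "CC Es x > 0"
proof -
  let ?T = "{{y, z} | y z. y \<in> neighbors Es x \<and> z \<in> neighbors Es x \<and> y \<noteq> z \<and> {y, z} \<in> Es}"
  have "card {y, z} \<le> degr Es x"
    unfolding degr_def using assms by (intro card_mono) auto
  then have "degr Es x \<ge> 2" using assms(4) by simp
  moreover have "triangles Es x > 0"
  proof -
    have "finite ?T" by (rule finite_subset[of _ "Pow (neighbors Es x)"]) (use assms(1) in auto)
    moreover have "{y, z} \<in> ?T" using assms by blast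
    ultimately show ?thesis unfolding triangles_def by (auto simp: card_gt_0_iff)
  qed
  ultimately show ?thesis by (simp add: CC_def)
qed

lemma bern_full: "finite J \<Longrightarrow> bern p J (\<lambda>S. if S = J then 1 else 0) = (\<Prod>e\<in>J. p e)"
  by (simp add: bern_def if_distrib[where f = "\<lambda>t. _ * t"] sum.delta cong: if_cong)

context scale_free
begin

lemma CC_upto_measurable:
  assumes "locally_finite \<eta>"
  shows "(\<lambda>G. CC_upto k (edge_set \<eta> G \<inter> pairs (\<eta> \<inter> window j x)) x) \<in> borel_measurable (Q \<eta>)"
  by (rule local_measurable) (auto simp: locally_finite_window assms)

lemma CC_upto_finite_measurable:
  assumes "locally_finite \<eta>" "x \<in> \<eta>"
  shows "(\<lambda>G. if finite (neighbors (edge_set \<eta> G) x) then CC_upto k (edge_set \<eta> G) x else 0) \<in> borel_measurable (Q \<eta>)"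
proof (rule borel_measurable_LIMSEQ_real)
  show "(\<lambda>G. CC_upto k (edge_set \<eta> G \<inter> pairs (\<eta> \<inter> window j x)) x) \<in> borel_measurable (Q \<eta>)" for j
    by (rule CC_upto_measurable[OF assms(1)])
qed (rule CC_upto_window_tendsto[OF assms edge_set_subset])

lemma CC_measurable:
  assumes "locally_finite \<eta>" "x \<in> \<eta>"
  shows "(\<lambda>G. CC (edge_set \<eta> G) x) \<in> borel_measurable (Q \<eta>)"
proof (rule borel_measurable_LIMSEQ_real)
  show "(\<lambda>G. if finite (neighbors (edge_set \<eta> G) x) then CC_upto k (edge_set \<eta> G) x else 0) \<in> borel_measurable (Q \<eta>)" for k
    by (rule CC_upto_finite_measurable[OF assms])
qed (rule CC_upto_tendsto)

definition palm_val :: "'a set \<Rightarrow> real" where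
  "palm_val \<eta> = (\<integral>G. CC (edge_set (insert 0 \<eta>) G) 0 \<partial>Q (insert 0 \<eta>))"

lemma integrable_CC:
  "locally_finite \<eta> \<Longrightarrow> x \<in> \<eta> \<Longrightarrow> integrable (Q \<eta>) (\<lambda>G. CC (edge_set \<eta> G) x)"
  by (rule integrable_Q[OF CC_measurable]) (auto simp: CC_nonneg CC_le_1)

lemma palm_val_range:
  assumes "locally_finite \<eta>"
  shows "0 \<le> palm_val \<eta> \<and> palm_val \<eta> \<le> 1"
proof
  show "0 \<le> palm_val \<eta>"
    unfolding palm_val_def by (intro Bochner_Integration.integral_nonneg) (rule CC_nonneg)
  have "palm_val \<eta> \<le> (\<integral>G. 1 \<partial>Q (insert 0 \<eta>))"
    unfolding palm_val_def
    by (intro integral_mono integrable_CC integrable_Q locally_finite_insert assms CC_le_1) auto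
  then show "palm_val \<eta> \<le> 1" by (simp add: prob_space.prob_space[OF prob_Q])
qed

lemma insert_Int_window:
  "K > 0 \<Longrightarrow> insert 0 \<eta> \<inter> window K 0 = insert 0 (\<eta> \<inter> window K 0)"
  using window_self[of K 0] by auto

text \<open>An iterated dominated limit: quenched means on finite windows are measurable by
  discretization, then the window grows, then the degree bound. Both limits hold at every
  configuration, so no completion of the measure is required.\<close>

lemma palm_val_measurable: "palm_val \<in> borel_measurable PP"
proof -
  let ?g = "\<lambda>k \<eta>. \<integral>G. (if finite (neighbors (edge_set (insert 0 \<eta>) G) 0) then CC_upto k (edge_set (insert 0 \<eta>) G) 0 else 0) \<partial>Q (insert 0 \<eta>)"
  have one: "integrable (Q \<eta>) (\<lambda>_. 1 :: real)" for \<eta> :: "'a set"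
    by (rule integrable_Q) auto
  have g_lim: "(\<lambda>j. mean_val (CC_upto k) (insert 0 (\<eta> \<inter> window (Suc j) 0)) 0) \<longlonglongrightarrow> ?g k \<eta>"
    if "\<eta> \<in> space PP" for k \<eta>
  proof -
    have lf: "locally_finite (insert 0 \<eta>)" using that by (simp add: space_PP locally_finite_insert)
    have eq: "mean_val (CC_upto k) (insert 0 (\<eta> \<inter> window (Suc j) 0)) 0 =
      (\<integral>G. CC_upto k (edge_set (insert 0 \<eta>) G \<inter> pairs (insert 0 \<eta> \<inter> window (Suc j) 0)) 0 \<partial>Q (insert 0 \<eta>))" for j
      unfolding insert_Int_window[OF zero_less_Suc, symmetric]
      using locally_finite_window[OF lf] by (intro integral_Q_local[symmetric]) auto
    show ?thesis
      unfolding eq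
    proof (rule integral_dominated_convergence[OF _ _ one AE_I2 AE_I2])
      fix j G
      show "(\<lambda>j. CC_upto k (edge_set (insert 0 \<eta>) G \<inter> pairs (insert 0 \<eta> \<inter> window (Suc j) 0)) 0)
        \<longlonglongrightarrow> (if finite (neighbors (edge_set (insert 0 \<eta>) G) 0) then CC_upto k (edge_set (insert 0 \<eta>) G) 0 else 0)"
        by (intro LIMSEQ_Suc[OF CC_upto_window_tendsto] lf edge_set_subset insertI1)
      show "norm (CC_upto k (edge_set (insert 0 \<eta>) G \<inter> pairs (insert 0 \<eta> \<inter> window (Suc j) 0)) 0) \<le> 1"
        by (simp add: CC_upto_range)
    qed (rule CC_upto_finite_measurable[OF lf insertI1] CC_upto_measurable[OF lf])+
  qed
  have "?g k \<in> borel_measurable PP" for k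
  proof (rule borel_measurable_LIMSEQ_real[OF g_lim])
    fix j
    show "(\<lambda>\<eta>. mean_val (CC_upto k) (insert 0 (\<eta> \<inter> window (Suc j) 0)) 0) \<in> borel_measurable PP"
      by (intro palm_measurable disc_continuous_mean_val translation_invariant_mean_val graph_invariant_CC_upto) simp
  qed
  moreover have "(\<lambda>k. ?g k \<eta>) \<longlonglongrightarrow> palm_val \<eta>" if "\<eta> \<in> space PP" for \<eta>
  proof -
    have lf: "locally_finite (insert 0 \<eta>)" using that by (simp add: space_PP locally_finite_insert)
    show ?thesis
      unfolding palm_val_def
    proof (rule integral_dominated_convergence[OF _ _ one AE_I2[OF CC_upto_tendsto] AE_I2])
      fix k G
      show "norm (if finite (neighbors (edge_set (insert 0 \<eta>) G) 0) then CC_upto k (edge_set (insert 0 \<eta>) G) 0 else 0) \<le> 1"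
        by (simp add: CC_upto_range)
    qed (rule CC_upto_finite_measurable[OF lf insertI1] CC_measurable[OF lf insertI1])+
  qed
  ultimately show ?thesis by (rule borel_measurable_LIMSEQ_real[rotated])
qed

lemma palm_expectation_eq: "palm_expectation PP \<alpha> Wt (\<lambda>\<eta> G. CC (edge_set \<eta> G) 0) = expectation palm_val"
  by (simp add: palm_expectation_def palm_val_def[abs_def])

section \<open>Finiteness of the degree at the origin\<close>

lemma disc_continuous_const: "disc_continuous (\<lambda>_ _. c)"
  by (simp add: disc_continuous_def)

lemma translation_invariant_const: "translation_invariant (\<lambda>_ _. c)"
  by (simp add: translation_invariant_def)

lemma local_sum_one: "local_sum (\<lambda>_ _. 1) k K \<eta> = real (card (\<eta> \<inter> window k 0))"
  by (simp add: local_sum_def)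

lemma card_measurable: "(\<lambda>\<eta>. real (card (\<eta> \<inter> window k 0))) \<in> borel_measurable PP"
  using local_sum_measurable[OF disc_continuous_const translation_invariant_const, of 1 1 k]
  by (simp add: local_sum_one[abs_def])

text \<open>Each point counts itself in its unit window, so the first moment of
  \<open>nbr_count\<close> at range 1 is an upper bound; only its order in \<open>k\<close>
  matters.\<close>

lemma expected_card_le:
  "(\<integral>\<^sup>+\<eta>. ennreal (real (card (\<eta> \<inter> window k 0))) \<partial>PP)
    \<le> ennreal ((2 * real k) ^ DIM('a) * (\<nu> + 2 ^ DIM('a) * \<nu> ^ 2))"
proof -
  have "(\<integral>\<^sup>+\<eta>. ennreal (real (card (\<eta> \<inter> window k 0))) \<partial>PP) \<le> (\<integral>\<^sup>+\<eta>. ennreal (local_sum nbr_count k 1 \<eta>) \<partial>PP)"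
  proof (intro nn_integral_mono ennreal_leI)
    fix \<eta> assume "\<eta> \<in> space PP"
    then have lf: "locally_finite \<eta>" by (simp add: space_PP)
    have "(\<Sum>x\<in>\<eta> \<inter> window k 0. 1) \<le> local_sum nbr_count k 1 \<eta>"
      unfolding local_sum_def
    proof (intro sum_mono)
      fix x assume "x \<in> \<eta> \<inter> window k 0"
      then have "x \<in> \<eta> \<inter> window 1 x" using window_self[of 1 x] by simp
      then have "card (\<eta> \<inter> window 1 x) > 0"
        using locally_finite_window[OF lf] card_gt_0_iff by blast
      then show "1 \<le> nbr_count (\<eta> \<inter> window 1 x) x" by (simp add: nbr_count_def)
    qed
    then show "real (card (\<eta> \<inter> window k 0)) \<le> local_sum nbr_count k 1 \<eta>" by simp
  qed
  also have "\<dots> \<le> ennreal ((2 * real k) ^ DIM('a) * (\<nu> + (2 * real 1) ^ DIM('a) * \<nu> ^ 2))"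
    by (rule first_moment_nbr_count) simp
  finally show ?thesis by simp
qed

text \<open>Here \<open>\<beta> > DIM\<close> pays off: shell volumes grow like
  \<open>2 ^ (i * DIM)\<close> and edge probabilities fall like
  \<open>2 powr (- \<beta> * i)\<close>.\<close>

lemma summable_shells: "summable (\<lambda>i. shell_bound 1 i * real (2 ^ i) ^ DIM('a))"
proof -
  have "shell_bound 1 i * real (2 ^ i) ^ DIM('a) = B * (2 powr (real DIM('a) - \<beta>)) ^ i" for i
  proof -
    have "real (2 ^ i) powr (- \<beta>) * real (2 ^ i) ^ DIM('a) = (2 ^ i) powr (real DIM('a) - \<beta>)"
      by (simp add: powr_diff powr_minus_divide powr_realpow)
    also have "\<dots> = (2 powr (real DIM('a) - \<beta>)) ^ i"
      by (simp add: powr_realpow[symmetric] powr_powr mult.commute)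
    finally show ?thesis by (simp add: shell_bound_def)
  qed
  moreover have "2 powr (real DIM('a) - \<beta>) < 1"
    using beta powr_less_mono[of "real DIM('a) - \<beta>" 0 2] by simp
  ultimately show ?thesis by (simp add: summable_geometric)
qed

text \<open>The summand 1 accounts for the vertex added at the origin.\<close>

definition origin_bound :: "'a set \<Rightarrow> nat \<Rightarrow> real" where
  "origin_bound \<eta> i = shell_bound 1 i * (1 + real (card (\<eta> \<inter> window (2 ^ Suc i) 0)))"

lemma AE_origin_bound: "AE \<eta> in PP. (\<Sum>i. ennreal (origin_bound \<eta> i)) \<noteq> \<infinity>"
proof (rule AE_suminf_finite)
  define C where "C = 1 + 4 ^ DIM('a) * (\<nu> + 2 ^ DIM('a) * \<nu> ^ 2)"
  have "C \<ge> 0" using nu_pos by (simp add: C_def)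
  then show "(\<Sum>i. ennreal (C * (shell_bound 1 i * real (2 ^ i) ^ DIM('a)))) < \<infinity>"
    using shell_bound_nonneg by (intro suminf_ennreal_finite[OF order_refl] summable_mult summable_shells) simp
  fix i
  show "(\<lambda>\<eta>. ennreal (origin_bound \<eta> i)) \<in> borel_measurable PP"
    unfolding origin_bound_def using card_measurable by measurable
  show "(\<integral>\<^sup>+\<eta>. ennreal (origin_bound \<eta> i) \<partial>PP) \<le> ennreal (C * (shell_bound 1 i * real (2 ^ i) ^ DIM('a)))"
  proof -
    have "(\<integral>\<^sup>+\<eta>. ennreal (origin_bound \<eta> i) \<partial>PP) =
       (\<integral>\<^sup>+\<eta>. ennreal (shell_bound 1 i) * (1 + ennreal (real (card (\<eta> \<inter> window (2 ^ Suc i) 0)))) \<partial>PP)"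
      unfolding origin_bound_def using shell_bound_nonneg
      by (intro nn_integral_cong) (simp add: ennreal_mult flip: ennreal_1 ennreal_plus)
    also have "\<dots> = ennreal (shell_bound 1 i) * (1 + (\<integral>\<^sup>+\<eta>. ennreal (real (card (\<eta> \<inter> window (2 ^ Suc i) 0))) \<partial>PP))"
      using measurable_compose[OF card_measurable[of "2 ^ Suc i"] measurable_ennreal]
      by (simp only: nn_integral_cmult nn_integral_add borel_measurable_add borel_measurable_const
          nn_integral_const emeasure_space_1 mult_1)
    also have "\<dots> \<le> ennreal (shell_bound 1 i) * (1 + ennreal ((2 * real (2 ^ Suc i)) ^ DIM('a) * (\<nu> + 2 ^ DIM('a) * \<nu> ^ 2)))"
      by (intro mult_left_mono add_left_mono expected_card_le) auto
    also have "\<dots> = ennreal (shell_bound 1 i * (1 + (2 * real (2 ^ Suc i)) ^ DIM('a) * (\<nu> + 2 ^ DIM('a) * \<nu> ^ 2)))"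
    proof -
      have "ennreal s * (1 + ennreal D) = ennreal (s * (1 + D))" if "s \<ge> 0" "D \<ge> 0" for s D :: real
        using that by (simp add: ennreal_mult)
      then show ?thesis using shell_bound_nonneg nu_pos by simp
    qed
    also have "\<dots> \<le> ennreal (C * (shell_bound 1 i * real (2 ^ i) ^ DIM('a)))"
    proof (rule ennreal_leI)
      have "(2 * real (2 ^ Suc i)) ^ DIM('a) = 4 ^ DIM('a) * real (2 ^ i) ^ DIM('a)"
      proof -
        have "2 * real (2 ^ Suc i) = 4 * real (2 ^ i)" by simp
        then show ?thesis by (simp only: power_mult_distrib)
      qed
      moreover have "1 \<le> real (2 ^ i) ^ DIM('a)" by simp
      ultimately have "1 + (2 * real (2 ^ Suc i)) ^ DIM('a) * (\<nu> + 2 ^ DIM('a) * \<nu> ^ 2) \<le> C * real (2 ^ i) ^ DIM('a)"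
        by (simp add: C_def algebra_simps)
      from mult_left_mono[OF this shell_bound_nonneg[of 1 i]]
      show "shell_bound 1 i * (1 + (2 * real (2 ^ Suc i)) ^ DIM('a) * (\<nu> + 2 ^ DIM('a) * \<nu> ^ 2)) \<le> C * (shell_bound 1 i * real (2 ^ i) ^ DIM('a))"
        by (simp only: ac_simps)
    qed
    finally show ?thesis .
  qed
qed

text \<open>The events decrease in \<open>n\<close>, and their probabilities are bounded by the
  tails of one convergent series; so their intersection is a null set.\<close>

lemma AE_no_far_edge:
  assumes lf: "locally_finite \<eta>" and fin: "(\<Sum>i. ennreal (origin_bound \<eta> i)) \<noteq> \<infinity>"
  shows "AE G in Q (insert 0 \<eta>). \<exists>n. G \<notin> far_edge (insert 0 \<eta>) (2 ^ n) 0"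
proof -
  let ?\<eta> = "insert 0 \<eta>"
  have lf0: "locally_finite ?\<eta>" using lf by (rule locally_finite_insert)
  have nn: "0 \<le> origin_bound \<eta> i" for i using shell_bound_nonneg by (simp add: origin_bound_def)
  have sm: "summable (origin_bound \<eta>)" using fin nn by (intro summable_suminf_not_top) auto
  have fs: "far_edge ?\<eta> (2 ^ n) 0 \<in> sets (Q ?\<eta>)" for n using far_edge_sets[OF lf0] by simp
  have bound: "emeasure (Q ?\<eta>) (far_edge ?\<eta> (2 ^ n) 0) \<le> ennreal (\<Sum>i. origin_bound \<eta> (i + n))" for n
  proof -
    have "emeasure (Q ?\<eta>) (far_edge ?\<eta> (2 ^ n) 0) \<le>
      (\<Sum>i. ennreal (shell_bound (2 ^ n) i * real (card (?\<eta> \<inter> window (2 ^ Suc i * 2 ^ n) 0))))"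
      by (rule emeasure_far_edge_le[OF lf0]) auto
    also have "\<dots> \<le> (\<Sum>i. ennreal (origin_bound \<eta> (i + n)))"
    proof (intro suminf_le summableI ennreal_leI)
      fix i
      have "card (?\<eta> \<inter> window (2 ^ Suc (i + n)) 0) \<le> Suc (card (\<eta> \<inter> window (2 ^ Suc (i + n)) 0))"
        using locally_finite_window[OF lf, of "2 ^ Suc (i + n)" 0]
        by (simp add: Int_insert_left card_insert_if)
      \<comment> \<open>Starting at range \<open>2 ^ n\<close> amounts to discarding the first
        \<open>n\<close> shells around range 1.\<close>
      moreover have "shell_bound (2 ^ n) i = shell_bound 1 (i + n)"
        by (simp add: shell_bound_def power_add)
      moreover have eq: "(2::nat) ^ Suc i * 2 ^ n = 2 ^ Suc (i + n)" by (simp add: power_add)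
      ultimately show "shell_bound (2 ^ n) i * real (card (?\<eta> \<inter> window (2 ^ Suc i * 2 ^ n) 0)) \<le> origin_bound \<eta> (i + n)"
        unfolding origin_bound_def eq using shell_bound_nonneg
        by (simp only:) (intro mult_left_mono, simp_all)
    qed
    also have "\<dots> = ennreal (\<Sum>i. origin_bound \<eta> (i + n))"
      using nn sm by (intro suminf_ennreal2) (auto simp: summable_iff_shift)
    finally show ?thesis .
  qed
  have "(\<Inter>n. far_edge ?\<eta> (2 ^ n) 0) \<in> null_sets (Q ?\<eta>)"
  proof (intro null_setsI)
    have "(\<lambda>n. \<Sum>i. origin_bound \<eta> (i + n)) \<longlonglongrightarrow> 0"
    proof -
      have "(\<lambda>n. suminf (origin_bound \<eta>) - (\<Sum>i<n. origin_bound \<eta> i)) \<longlonglongrightarrow> suminf (origin_bound \<eta>) - suminf (origin_bound \<eta>)"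
        by (intro tendsto_diff tendsto_const summable_LIMSEQ sm)
      then show ?thesis by (simp add: suminf_minus_initial_segment[OF sm])
    qed
    then have lim: "(\<lambda>n. ennreal (\<Sum>i. origin_bound \<eta> (i + n))) \<longlonglongrightarrow> 0"
      using tendsto_ennrealI[of _ 0] by simp
    have "emeasure (Q ?\<eta>) (\<Inter>n. far_edge ?\<eta> (2 ^ n) 0) \<le> ennreal (\<Sum>i. origin_bound \<eta> (i + n))" for n
    proof -
      have "emeasure (Q ?\<eta>) (\<Inter>n. far_edge ?\<eta> (2 ^ n) 0) \<le> emeasure (Q ?\<eta>) (far_edge ?\<eta> (2 ^ n) 0)"
        by (rule emeasure_mono[OF _ fs]) auto
      then show ?thesis using bound[of n] by (rule order_trans)
    qed
    then have "emeasure (Q ?\<eta>) (\<Inter>n. far_edge ?\<eta> (2 ^ n) 0) \<le> 0"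
      by (intro tendsto_lowerbound[OF lim]) auto
    then show "emeasure (Q ?\<eta>) (\<Inter>n. far_edge ?\<eta> (2 ^ n) 0) = 0" by simp
  qed (use fs in auto)
  then show ?thesis by (rule AE_I') auto
qed

lemma far_edge_mono: "K \<le> K' \<Longrightarrow> far_edge \<eta> K' x \<subseteq> far_edge \<eta> K x"
  using window_mono[of K K' x] by (auto simp: far_edge_def)

text \<open>In almost every graph some dyadic window contains all neighbours of the origin; from
  there on the local coefficient is constant in the range.\<close>

lemma mean_val_palm_tendsto:
  assumes lf: "locally_finite \<eta>" and fin: "(\<Sum>i. ennreal (origin_bound \<eta> i)) \<noteq> \<infinity>"
  shows "(\<lambda>K. mean_val CC (insert 0 (\<eta> \<inter> window (Suc K) 0)) 0) \<longlonglongrightarrow> palm_val \<eta>"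
proof -
  let ?\<eta> = "insert 0 \<eta>"
  have lf0: "locally_finite ?\<eta>" using lf by (rule locally_finite_insert)
  have eq: "mean_val CC (insert 0 (\<eta> \<inter> window (Suc j) 0)) 0 = (\<integral>G. CC_local ?\<eta> G (Suc j) 0 \<partial>Q ?\<eta>)" for j
    unfolding insert_Int_window[OF zero_less_Suc, symmetric] CC_local_def
    using locally_finite_window[OF lf0] by (intro integral_Q_local[symmetric]) auto
  show ?thesis
    unfolding eq palm_val_def
  proof (rule integral_dominated_convergence[where w = "\<lambda>_. 1"])
    show "AE G in Q ?\<eta>. (\<lambda>j. CC_local ?\<eta> G (Suc j) 0) \<longlonglongrightarrow> CC (edge_set ?\<eta> G) 0"
      using AE_no_far_edge[OF assms] AE_space
    proof eventually_elim
      case (elim G)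
      then obtain n where n: "G \<notin> far_edge ?\<eta> (2 ^ n) 0" by blast
      have "\<forall>\<^sub>F j in sequentially. CC_local ?\<eta> G (Suc j) 0 = CC (edge_set ?\<eta> G) 0"
        using eventually_ge_at_top[of "2 ^ n"]
      proof eventually_elim
        case (elim j)
        then have "G \<notin> far_edge ?\<eta> (Suc j) 0" using n far_edge_mono[of "2 ^ n" "Suc j" ?\<eta> 0] by auto
        then show ?case
          unfolding CC_local_def using \<open>G \<in> space (Q ?\<eta>)\<close> by (intro CC_if_no_far_edge) auto
      qed
      then show ?case by (rule tendsto_eventually)
    qed
    show "AE G in Q ?\<eta>. norm (CC_local ?\<eta> G (Suc j) 0) \<le> 1" for j
      by (simp add: CC_local_def CC_nonneg CC_le_1)
    show "integrable (Q ?\<eta>) (\<lambda>_. 1 :: real)"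
      by (rule integrable_Q) auto
  qed (auto intro: CC_measurable CC_local_measurable lf0)
qed

lemma palm_local_tendsto: "(\<lambda>K. palm_local (mean_val CC) K) \<longlonglongrightarrow> expectation palm_val"
proof -
  have "(\<lambda>K. palm_local (mean_val CC) (Suc K)) \<longlonglongrightarrow> expectation palm_val"
    unfolding palm_local_def
  proof (rule integral_dominated_convergence[where w = "\<lambda>_. 1"])
    show "AE \<eta> in PP. (\<lambda>K. mean_val CC (insert 0 (\<eta> \<inter> window (Suc K) 0)) 0) \<longlonglongrightarrow> palm_val \<eta>"
      using AE_origin_bound AE_space
    proof eventually_elim
      case (elim \<eta>)
      then show ?case using mean_val_palm_tendsto[of \<eta>] by (simp add: space_PP)
    qed
    show "AE \<eta> in PP. norm (mean_val CC (insert 0 (\<eta> \<inter> window (Suc K) 0)) 0) \<le> 1" for K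
    proof (rule AE_I2)
      fix \<eta> assume "\<eta> \<in> space PP"
      then have "finite (insert 0 (\<eta> \<inter> window (Suc K) 0))"
        using locally_finite_window[of \<eta>] by (simp add: space_PP)
      from mean_val_range[OF this, of CC 0, OF CC_range]
      show "norm (mean_val CC (insert 0 (\<eta> \<inter> window (Suc K) 0)) 0) \<le> 1" by simp
    qed
    show "(\<lambda>\<eta>. mean_val CC (insert 0 (\<eta> \<inter> window (Suc K) 0)) 0) \<in> borel_measurable PP" for K
      by (intro palm_measurable disc_continuous_mean_val translation_invariant_mean_val graph_invariant_CC) simp
  qed (auto intro: palm_val_measurable)
  then show ?thesis by (rule LIMSEQ_imp_Suc)
qed

text \<open>Two further points form a triangle with the origin with positive probability: positive
  weights make all three edge probabilities positive. A vanishing mean would force the product of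
  these probabilities to vanish for almost all weights.\<close>

lemma palm_val_pos:
  assumes lf: "locally_finite \<eta>" and fin: "(\<Sum>i. ennreal (origin_bound \<eta> i)) \<noteq> \<infinity>"
    and yz: "y \<in> \<eta>" "z \<in> \<eta>" "y \<noteq> z" "y \<noteq> 0" "z \<noteq> 0"
  shows "palm_val \<eta> > 0"
proof (rule ccontr)
  assume "\<not> palm_val \<eta> > 0"
  let ?\<eta> = "insert 0 \<eta>" and ?J = "{{0, y}, {0, z}, {y, z}}"
  have lf0: "locally_finite ?\<eta>" using lf by (rule locally_finite_insert)
  have J: "?J \<subseteq> pairs ?\<eta>" using yz by (auto simp: pairs_def)
  define indicator_of :: "'a set set \<Rightarrow> real" where "indicator_of = (\<lambda>S. if S = ?J then 1 else 0)"
  have "palm_val \<eta> = 0" using \<open>\<not> palm_val \<eta> > 0\<close> palm_val_range[OF lf] by linarith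
  then have "AE G in Q ?\<eta>. CC (edge_set ?\<eta> G) 0 = 0"
    unfolding palm_val_def using integrable_CC[OF lf0]
    by (subst (asm) integral_nonneg_eq_0_iff_AE) (auto simp: CC_nonneg)
  then have "AE G in Q ?\<eta>. (if {e\<in>?J. snd G e} = ?J then 1 else 0) = (0::real)"
    using AE_no_far_edge[OF lf fin] AE_space
  proof eventually_elim
    case (elim G)
    obtain n where n: "G \<notin> far_edge ?\<eta> (2 ^ n) 0" using elim(2) by blast
    \<comment> \<open>Finite degree matters here: at infinite degree \<open>CC\<close> is 0 by
      convention even if there are triangles.\<close>
    have "neighbors (edge_set ?\<eta> G) 0 \<subseteq> ?\<eta> \<inter> window (2 ^ n) 0"
      by (rule neighbors_if_no_far_edge[OF elim(3) n]) simp
    then have finN: "finite (neighbors (edge_set ?\<eta> G) 0)"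
      using locally_finite_window[OF lf0] finite_subset by blast
    have "{e\<in>?J. snd G e} \<noteq> ?J"
    proof
      assume "{e\<in>?J. snd G e} = ?J"
      then have "\<forall>e\<in>?J. snd G e" by blast
      then have "?J \<subseteq> edge_set ?\<eta> G" using J by (auto simp: edge_set_def)
      then have "CC (edge_set ?\<eta> G) 0 > 0"
        using yz(3) by (intro CC_pos[OF finN, of y z]) (auto simp: neighbors_def)
      then show False using elim(1) by simp
    qed
    then show ?case by simp
  qed
  then have "AE G in Q ?\<eta>. indicator_of {e\<in>?J. snd G e} = 0"
    by (simp add: indicator_of_def)
  moreover have "(\<lambda>G. indicator_of {e\<in>?J. snd G e}) \<in> borel_measurable (Q ?\<eta>)"
  proof -
    have "(\<lambda>G. indicator_of {e\<in>?J. snd G e}) \<in> borel_measurable (graph_space ?\<eta>)"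
      by (rule measurable_compose[OF edges_measurable[OF _ J]]) auto
    then show ?thesis using measurable_cong_sets[OF sets_Q refl] by blast
  qed
  ultimately have "(\<integral>G. indicator_of {e\<in>?J. snd G e} \<partial>Q ?\<eta>) = (\<integral>G. 0 \<partial>Q ?\<eta>)"
    by (intro integral_cong_AE) auto
  then have "(\<integral>w. bern (edge_p w) ?J indicator_of \<partial>weights ?\<eta>) = 0"
    using integral_Q_finite[OF _ J, of indicator_of] by simp
  moreover have full: "bern (edge_p w) ?J indicator_of = (\<Prod>e\<in>?J. edge_p w e)" for w
    unfolding indicator_of_def by (rule bern_full) simp
  ultimately have "(\<integral>w. (\<Prod>e\<in>?J. edge_p w e) \<partial>weights ?\<eta>) = 0" by (simp only: full)
  moreover have "integrable (weights ?\<eta>) (\<lambda>w. \<Prod>e\<in>?J. edge_p w e)"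
    using bern_edge_p_integrable[OF J, of indicator_of] by (simp only: full)
  ultimately have zero: "AE w in weights ?\<eta>. (\<Prod>e\<in>?J. edge_p w e) = 0"
    using edge_p_range by (subst (asm) integral_nonneg_eq_0_iff_AE) (auto intro!: AE_I2 prod_nonneg)
  have pw: "AE w in weights ?\<eta>. 0 < w v" if "v \<in> ?\<eta>" for v
    using that weight_pos W.prob_space_axioms by (intro AE_PiM_component) auto
  have "AE w in weights ?\<eta>. False"
    using zero pw[OF insertI1] pw[OF insertI2[OF yz(1)]] pw[OF insertI2[OF yz(2)]]
  proof eventually_elim
    case (elim w)
    have pos: "edge_p w {u, v} > 0" if "w u > 0" "w v > 0" "u \<noteq> v" for u v
    proof -
      have "w u * w v / norm (u - v) powr \<alpha> > 0" using that by simp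
      then show ?thesis by (simp add: edge_p_def clamp01_def edge_prob_pair[OF that(3)])
    qed
    have "(\<Prod>e\<in>?J. edge_p w e) > 0"
      using pos elim yz by (intro prod_pos) auto
    then show ?case using elim(1) by simp
  qed
  then show False
    using prob_space.AE_False[OF prob_weights] by simp
qed

lemma palm_pos: "expectation palm_val > 0"
proof (rule ccontr)
  assume "\<not> expectation palm_val > 0"
  have range: "0 \<le> palm_val \<eta> \<and> palm_val \<eta> \<le> 1" if "\<eta> \<in> space PP" for \<eta>
    using that palm_val_range by (simp add: space_PP)
  have int: "integrable PP palm_val"
    by (rule integrable_const_bound[where B = 1]) (auto intro!: AE_I2 palm_val_measurable dest: range)
  have "expectation palm_val \<ge> 0"
    by (intro Bochner_Integration.integral_nonneg) (use range in auto)
  then have "expectation palm_val = 0" using \<open>\<not> expectation palm_val > 0\<close> by linarith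
  then have ae: "AE \<eta> in PP. palm_val \<eta> = 0"
    using int range by (subst (asm) integral_nonneg_eq_0_iff_AE) auto
  \<comment> \<open>The unit cell with corner \<open>One\<close> misses the origin and contains
    exactly two points with probability \<open>\<nu> ^ 2 / 2 * exp (- \<nu>)\<close>; these serve as
    the two further points.\<close>
  define c :: 'a where "c = One"
  have "c \<in> grid 1" by (auto simp: grid_iff c_def)
  note c = cell_borel[OF zero_less_one this] bounded_cell[OF zero_less_one this] measure_cell[OF zero_less_one this]
  have c0: "0 \<notin> cell 1 c"
    by (auto simp: cell_def c_def)
  have "AE \<eta> in PP. \<not> card (\<eta> \<inter> cell 1 c) = 2"
    using ae AE_origin_bound AE_space
  proof eventually_elim
    case (elim \<eta>)
    show ?case
    proof
      assume "card (\<eta> \<inter> cell 1 c) = 2"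
      then obtain y z where "\<eta> \<inter> cell 1 c = {y, z}" "y \<noteq> z" by (auto simp: card_2_iff)
      then have "y \<in> \<eta>" "z \<in> \<eta>" "y \<noteq> z" "y \<noteq> 0" "z \<noteq> 0" using c0 by auto
      then have "palm_val \<eta> > 0" using elim by (intro palm_val_pos[of \<eta> y z]) (auto simp: space_PP)
      then show False using elim by simp
    qed
  qed
  then have "prob {\<eta> \<in> space PP. card (\<eta> \<inter> cell 1 c) = 2} = 0"
    using count_event[OF c(1,2), of 2] by (simp add: prob_eq_0)
  moreover have "prob {\<eta> \<in> space PP. card (\<eta> \<inter> cell 1 c) = 2} > 0"
    using law c nu_pos by (simp add: poisson_process_law_def)
  ultimately show False by simp
qed

end

section \<open>Almost sure convergence\<close>

lemma window_subset_box_n: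
  assumes "2 * k \<le> n"
  shows "(window k 0 :: 'a::euclidean_space set) \<subseteq> box_n n"
proof
  fix x :: 'a assume x: "x \<in> window k 0"
  have n: "real k \<le> real n / 2" using assms by linarith
  have "- (real n / 2) \<le> x \<bullet> i \<and> x \<bullet> i \<le> real n / 2" if "i \<in> Basis" for i
  proof -
    have "- real k \<le> x \<bullet> i" "x \<bullet> i < real k" using x that by (auto simp: window_def)
    then show ?thesis using n by linarith
  qed
  then show "x \<in> box_n n" by (simp add: box_n_def mem_box)
qed

text \<open>The inequality is strict because the box is closed while the window lacks its upper
  faces.\<close>

lemma box_n_subset_window:
  assumes "n < 2 * k"
  shows "box_n n \<subseteq> (window k 0 :: 'a::euclidean_space set)"
proof
  fix x :: 'a assume x: "x \<in> box_n n"
  have n: "real n / 2 < real k" using assms by linarith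
  have "- (real n / 2) \<le> x \<bullet> i \<and> x \<bullet> i \<le> real n / 2" if "i \<in> Basis" for i
    using x that by (auto simp: box_n_def mem_box)
  then show "x \<in> window k 0" using n by (force simp: window_def)
qed

text \<open>Numerator and denominator are monotone in the window, so the average at \<open>n\<close>
  lies between \<open>S j / N (Suc j)\<close> and \<open>S (Suc j) / N j\<close> at consecutive
  scales; shifting one index costs the factor \<open>H (Suc j) / H j\<close>, which tends to
  1.\<close>

lemma ratio_sandwich:
  fixes k :: "nat \<Rightarrow> nat" and S N :: "nat \<Rightarrow> real" and SB NB :: "nat \<Rightarrow> real"
  assumes mono: "incseq k" and inf: "\<And>j. j \<le> k j"
    and H: "\<And>j. H j > 0" "(\<lambda>j. H (Suc j) / H j) \<longlonglongrightarrow> 1"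
    and S: "(\<lambda>j. S j / H j) \<longlonglongrightarrow> \<nu> * a" and N: "(\<lambda>j. N j / H j) \<longlonglongrightarrow> \<nu>" and \<nu>: "\<nu> > 0"
    and nn: "\<And>j. 0 \<le> S j"
    and between: "\<And>j n. 2 * k j \<le> n \<Longrightarrow> n < 2 * k (Suc j) \<Longrightarrow>
      S j \<le> SB n \<and> SB n \<le> S (Suc j) \<and> N j \<le> NB n \<and> NB n \<le> N (Suc j)"
  shows "(\<lambda>n. SB n / NB n) \<longlonglongrightarrow> a"
proof -
  \<comment> \<open>The scale with \<open>2 * k (J n) \<le> n < 2 * k (Suc (J n))\<close>, the lower
    bound for \<open>n \<ge> 2 * k 0\<close>. The factor 2 appears because \<open>k\<close> is half
    the side of a window and \<open>n\<close> the full side of a box.\<close>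
  define J where "J n = (LEAST j. n < 2 * k (Suc j))" for n
  have ex: "n < 2 * k (Suc n)" for n using inf[of "Suc n"] by simp
  then have J2: "n < 2 * k (Suc (J n))" for n unfolding J_def by (rule LeastI)
  have J1: "2 * k (J n) \<le> n" if "2 * k 0 \<le> n" for n
  proof (cases "J n")
    case 0
    then show ?thesis using that by simp
  next
    case (Suc j)
    then have "j < J n" by simp
    then have "\<not> n < 2 * k (Suc j)" unfolding J_def by (rule not_less_Least)
    then show ?thesis using Suc by simp
  qed
  have J: "filterlim J at_top sequentially"
    unfolding filterlim_at_top
  proof
    fix M
    have "M \<le> J n" if "2 * k M \<le> n" for n
    proof (rule ccontr)
      assume "\<not> M \<le> J n"
      then have "k (Suc (J n)) \<le> k M" by (intro incseqD[OF mono]) simp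
      then show False using J2[of n] that by linarith
    qed
    then show "\<forall>\<^sub>F n in sequentially. M \<le> J n"
      by (intro eventually_mono[OF eventually_ge_at_top[of "2 * k M"]])
  qed
  have Npos: "\<forall>\<^sub>F j in sequentially. N j > 0"
    using order_tendstoD(1)[OF N \<nu>] by eventually_elim (simp add: pos_less_divide_eq[OF H(1)])
  have S': "(\<lambda>j. S (Suc j) / H (Suc j)) \<longlonglongrightarrow> \<nu> * a" and N': "(\<lambda>j. N (Suc j) / H (Suc j)) \<longlonglongrightarrow> \<nu>"
    by (rule LIMSEQ_Suc[OF S], rule LIMSEQ_Suc[OF N])
  have up: "(\<lambda>j. S (Suc j) / N j) \<longlonglongrightarrow> a"
  proof -
    have "(\<lambda>j. (S (Suc j) / H (Suc j)) / (N j / H j) * (H (Suc j) / H j)) \<longlonglongrightarrow> \<nu> * a / \<nu> * 1"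
      using \<nu> by (intro tendsto_intros S' N H(2)) auto
    moreover have "(S (Suc j) / H (Suc j)) / (N j / H j) * (H (Suc j) / H j) = S (Suc j) / N j" for j
      using H(1)[of j] H(1)[of "Suc j"] by (simp add: field_simps)
    ultimately show ?thesis using \<nu> by simp
  qed
  have lo: "(\<lambda>j. S j / N (Suc j)) \<longlonglongrightarrow> a"
  proof -
    have "(\<lambda>j. (S j / H j) / (N (Suc j) / H (Suc j)) / (H (Suc j) / H j)) \<longlonglongrightarrow> \<nu> * a / \<nu> / 1"
      using \<nu> by (intro tendsto_intros S N' H(2)) auto
    moreover have "(S j / H j) / (N (Suc j) / H (Suc j)) / (H (Suc j) / H j) = S j / N (Suc j)" for j
      using H(1)[of j] H(1)[of "Suc j"] by (simp add: field_simps)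
    ultimately show ?thesis using \<nu> by simp
  qed
  have ev: "\<forall>\<^sub>F n in sequentially. S (J n) / N (Suc (J n)) \<le> SB n / NB n \<and> SB n / NB n \<le> S (Suc (J n)) / N (J n)"
    using filterlim_iff[THEN iffD1, OF J, rule_format, OF Npos] eventually_ge_at_top[of "2 * k 0"]
  proof eventually_elim
    case (elim n)
    note b = between[OF J1[OF elim(2)] J2]
    have "0 < NB n" "0 < N (J n)" using b elim(1) by linarith+
    then show ?case using b nn[of "J n"] by (intro conjI frac_le) auto
  qed
  show ?thesis
  proof (rule tendsto_sandwich)
    show "(\<lambda>n. S (J n) / N (Suc (J n))) \<longlonglongrightarrow> a" using lo J by (rule filterlim_compose)
    show "(\<lambda>n. S (Suc (J n)) / N (J n)) \<longlonglongrightarrow> a" using up J by (rule filterlim_compose)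
  qed (use ev in \<open>auto elim: eventually_mono\<close>)
qed

lemma summable_inverse_square: "summable (\<lambda>j. C * (1 / real (Suc j) ^ 2))"
proof -
  have "summable (\<lambda>j. inverse (real (Suc j) ^ 2))"
    using inverse_power_summable[of 2, where 'a = real] by (subst summable_Suc_iff) simp
  then show ?thesis by (intro summable_mult) (simp add: divide_inverse)
qed

section \<open>Choice of the scales and summable errors\<close>

context scale_free
begin

text \<open>The number 2 is the decay exponent that makes the expected share of far edges at range
  \<open>Suc j ^ range_exp\<close> summable; a suitable exponent exists because
  \<open>\<beta> > DIM\<close>.\<close>

definition range_exp :: nat where
  "range_exp = (SOME q. real q * (\<beta> - real DIM('a)) \<ge> 2)"

definition rad :: "nat \<Rightarrow> nat" where "rad j = Suc j ^ range_exp"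

text \<open>The two additional powers make the ratio of side to range equal to
  \<open>Suc j ^ 2\<close>, the source of the summability in \<open>rad_vol\<close>.\<close>

definition side :: "nat \<Rightarrow> nat" where "side j = Suc j ^ (range_exp + 2)"

definition vol :: "nat \<Rightarrow> real" where "vol j = (2 * real (side j)) ^ DIM('a)"

lemma range_exp: "real range_exp * (\<beta> - real DIM('a)) \<ge> 2"
proof -
  obtain q :: nat where "2 / (\<beta> - real DIM('a)) \<le> real q" using real_arch_simple by blast
  then have "real q * (\<beta> - real DIM('a)) \<ge> 2" using beta by (simp add: field_simps)
  then show ?thesis unfolding range_exp_def by (rule someI)
qed

lemma rad_pos: "rad j > 0"
  by (simp add: rad_def)

lemma side_pos: "side j > 0"
  by (simp add: side_def)

lemma vol_pos: "vol j > 0"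
  using side_pos by (simp add: vol_def)

lemma rad_vol: "real (rad j) ^ DIM('a) / vol j \<le> 1 / real (Suc j) ^ 2"
proof -
  have "1 * real (Suc j) ^ 2 \<le> 2 ^ DIM('a) * (real (Suc j) ^ 2) ^ DIM('a)"
    by (intro mult_mono self_le_power) auto
  then have "real (rad j) ^ DIM('a) * real (Suc j) ^ 2 \<le> real (rad j) ^ DIM('a) * (2 ^ DIM('a) * (real (Suc j) ^ 2) ^ DIM('a))"
    by (intro mult_left_mono) auto
  also have "\<dots> = vol j"
    by (simp only: vol_def rad_def side_def power_add power_mult_distrib of_nat_power of_nat_mult ac_simps)
  finally show ?thesis using vol_pos[of j] by (simp add: field_simps del: of_nat_Suc)
qed

lemma rad_decay: "real (rad j) powr (real DIM('a) - \<beta>) \<le> 1 / real (Suc j) ^ 2"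
proof -
  have "real (rad j) powr (real DIM('a) - \<beta>) = real (Suc j) powr (real range_exp * (real DIM('a) - \<beta>))"
    by (simp add: rad_def powr_realpow[symmetric] powr_powr del: of_nat_Suc)
  also have "\<dots> \<le> real (Suc j) powr (- 2)"
    using range_exp by (intro powr_mono) (auto simp: algebra_simps)
  also have "\<dots> = 1 / real (Suc j) ^ 2"
    by (simp add: powr_minus_divide powr_numeral del: of_nat_Suc)
  finally show ?thesis .
qed

text \<open>One constant for both moment bounds: the second moment at range \<open>r\<close> and the
  first moment of \<open>nbr_count\<close> at range \<open>2 * r\<close> both carry the factor
  \<open>(4 * r) ^ DIM\<close>.\<close>

definition var_const :: real where
  "var_const = \<nu> + 4 ^ DIM('a) * \<nu> ^ 2"

lemma var_const_nonneg: "var_const \<ge> 0"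
  using nu_pos by (simp add: var_const_def)

lemma var_const_le:
  assumes "r > 0"
  shows "\<nu> + (4 * real r) ^ DIM('a) * \<nu> ^ 2 \<le> var_const * real r ^ DIM('a)"
proof -
  have "1 \<le> real r ^ DIM('a)" using assms by simp
  then have "\<nu> * 1 \<le> \<nu> * real r ^ DIM('a)" using nu_pos by (intro mult_left_mono) auto
  then show ?thesis by (simp add: var_const_def power_mult_distrib algebra_simps)
qed

lemma var_const_vol_le:
  assumes "r > 0" "r \<le> rad j"
  shows "vol j * (\<nu> + (4 * real r) ^ DIM('a) * \<nu> ^ 2) / vol j ^ 2 \<le> var_const * (1 / real (Suc j) ^ 2)"
proof -
  have "vol j * (\<nu> + (4 * real r) ^ DIM('a) * \<nu> ^ 2) / vol j ^ 2 = (\<nu> + (4 * real r) ^ DIM('a) * \<nu> ^ 2) / vol j"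
    by (simp add: power2_eq_square)
  also have "(\<nu> + (4 * real r) ^ DIM('a) * \<nu> ^ 2) / vol j \<le> var_const * real (rad j) ^ DIM('a) / vol j"
    using assms vol_pos[of j] var_const_nonneg
    by (intro divide_right_mono order_trans[OF var_const_le[OF assms(1)]] mult_left_mono power_mono) auto
  also have "\<dots> = var_const * (real (rad j) ^ DIM('a) / vol j)" by simp
  also have "\<dots> \<le> var_const * (1 / real (Suc j) ^ 2)"
    by (intro mult_left_mono rad_vol var_const_nonneg)
  finally show ?thesis .
qed

lemma local_sum_nbr_count_nonneg: "0 \<le> local_sum nbr_count k r \<eta>"
  by (simp add: local_sum_def nbr_count_def sum_nonneg)

lemma suminf_inverse_square_finite: "C \<ge> 0 \<Longrightarrow> (\<Sum>j. ennreal (C * (1 / real (Suc j) ^ 2))) < \<infinity>"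
  by (intro suminf_ennreal_finite[OF order_refl] summable_inverse_square) simp

lemma local_sum_nbr_count_measurable: "r > 0 \<Longrightarrow> local_sum nbr_count k r \<in> borel_measurable PP"
  by (rule local_sum_measurable[OF disc_continuous_card translation_invariant_card])

text \<open>The bound on the quenched variance is itself random. Its mean over
  \<open>vol j ^ 2\<close> is of order \<open>(rad j / side j) ^ DIM\<close>, so the series
  converges for almost every configuration.\<close>

lemma AE_near: "AE \<eta> in PP. (\<Sum>j. ennreal (local_sum nbr_count (side j) (2 * rad j) \<eta> / vol j ^ 2)) \<noteq> \<infinity>"
proof (rule AE_suminf_finite[OF _ _ suminf_inverse_square_finite[OF var_const_nonneg]])
  fix j
  have r: "2 * rad j > 0" using rad_pos by simp
  note meas = local_sum_nbr_count_measurable[OF r, of "side j"]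
  show "(\<lambda>\<eta>. ennreal (local_sum nbr_count (side j) (2 * rad j) \<eta> / vol j ^ 2)) \<in> borel_measurable PP"
    by (rule measurable_compose[OF borel_measurable_divide[OF meas borel_measurable_const] measurable_ennreal])
  show "(\<integral>\<^sup>+\<eta>. ennreal (local_sum nbr_count (side j) (2 * rad j) \<eta> / vol j ^ 2) \<partial>PP) \<le> ennreal (var_const * (1 / real (Suc j) ^ 2))"
    using vol_pos[of j] var_const_vol_le[OF rad_pos order_refl, of j]
    by (intro nn_integral_divide_le[OF meas _ first_moment_nbr_count[OF r]]) (simp_all add: vol_def side_pos)
qed

text \<open>Separates the range from the shell index: the powers of \<open>K\<close> combine to
  \<open>K powr (DIM - \<beta>)\<close>, which is small at large range.\<close>

lemma shell_bound_scale:
  assumes "K > 0"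
  shows "shell_bound K i * (real (2 ^ i * K)) ^ DIM('a) =
    real K powr (real DIM('a) - \<beta>) * (shell_bound 1 i * real (2 ^ i) ^ DIM('a))"
proof -
  have K: "real K powr (- \<beta>) * real K ^ DIM('a) = real K powr (real DIM('a) - \<beta>)"
    using assms by (simp add: powr_diff powr_minus_divide powr_realpow)
  have "shell_bound K i * (real (2 ^ i * K)) ^ DIM('a) =
     (real K powr (- \<beta>) * real K ^ DIM('a)) * (shell_bound 1 i * real (2 ^ i) ^ DIM('a))"
    by (simp add: shell_bound_def powr_mult power_mult_distrib ac_simps)
  then show ?thesis by (simp only: K)
qed

text \<open>In the mean, a shell contributes its edge bound times the volume of its window. By
  scaling, the sum over shells is the constant \<open>Z\<close> times a power of
  \<open>rad j\<close>, and \<open>rad_decay\<close> makes this summable in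
  \<open>j\<close>.\<close>

lemma AE_far: "AE \<eta> in PP. (\<Sum>j. tail_total (side j) (rad j) \<eta> * ennreal (1 / vol j)) \<noteq> \<infinity>"
proof (rule AE_suminf_finite)
  define Z where "Z = (\<Sum>i. shell_bound 1 i * real (2 ^ i) ^ DIM('a))"
  have Z: "Z \<ge> 0" unfolding Z_def using summable_shells shell_bound_nonneg by (intro suminf_nonneg) auto
  then show "(\<Sum>j. ennreal (var_const * Z * (1 / real (Suc j) ^ 2))) < \<infinity>"
    using var_const_nonneg by (intro suminf_inverse_square_finite) simp
  fix j
  have meas: "local_sum nbr_count (side j) (2 ^ Suc i * rad j) \<in> borel_measurable PP" for i
    by (intro local_sum_nbr_count_measurable) (simp add: rad_pos)
  have meas': "(\<lambda>\<eta>. ennreal (shell_bound (rad j) i * local_sum nbr_count (side j) (2 ^ Suc i * rad j) \<eta>)) \<in> borel_measurable PP" for i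
    by (intro measurable_compose[OF _ measurable_ennreal] borel_measurable_times borel_measurable_const meas)
  then have measT: "tail_total (side j) (rad j) \<in> borel_measurable PP"
    unfolding tail_total_def by measurable
  then show "(\<lambda>\<eta>. tail_total (side j) (rad j) \<eta> * ennreal (1 / vol j)) \<in> borel_measurable PP"
    by measurable
  show "(\<integral>\<^sup>+\<eta>. tail_total (side j) (rad j) \<eta> * ennreal (1 / vol j) \<partial>PP) \<le> ennreal (var_const * Z * (1 / real (Suc j) ^ 2))"
  proof -
    have "(\<integral>\<^sup>+\<eta>. tail_total (side j) (rad j) \<eta> * ennreal (1 / vol j) \<partial>PP) =
      (\<integral>\<^sup>+\<eta>. tail_total (side j) (rad j) \<eta> \<partial>PP) * ennreal (1 / vol j)"
      using measT by (rule nn_integral_multc)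
    also have "(\<integral>\<^sup>+\<eta>. tail_total (side j) (rad j) \<eta> \<partial>PP) =
      (\<Sum>i. \<integral>\<^sup>+\<eta>. ennreal (shell_bound (rad j) i * local_sum nbr_count (side j) (2 ^ Suc i * rad j) \<eta>) \<partial>PP)"
      unfolding tail_total_def by (rule nn_integral_suminf[OF meas'])
    also have "\<dots> \<le> (\<Sum>i. ennreal (vol j * var_const * real (rad j) powr (real DIM('a) - \<beta>) * (shell_bound 1 i * real (2 ^ i) ^ DIM('a))))"
    proof (intro suminf_le summableI)
      fix i
      let ?r = "2 ^ Suc i * rad j"
      have "(\<integral>\<^sup>+\<eta>. ennreal (shell_bound (rad j) i * local_sum nbr_count (side j) ?r \<eta>) \<partial>PP) =
        ennreal (shell_bound (rad j) i) * (\<integral>\<^sup>+\<eta>. ennreal (local_sum nbr_count (side j) ?r \<eta>) \<partial>PP)"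
        by (subst nn_integral_cmult[OF measurable_compose[OF meas measurable_ennreal], symmetric],
            intro nn_integral_cong ennreal_mult shell_bound_nonneg local_sum_nbr_count_nonneg)
      also have "\<dots> \<le> ennreal (shell_bound (rad j) i) * ennreal (vol j * (\<nu> + (2 * real ?r) ^ DIM('a) * \<nu> ^ 2))"
        unfolding vol_def by (intro mult_left_mono first_moment_nbr_count) (auto simp: rad_pos)
      also have "\<dots> = ennreal (shell_bound (rad j) i * (vol j * (\<nu> + (4 * real (2 ^ i * rad j)) ^ DIM('a) * \<nu> ^ 2)))"
        using shell_bound_nonneg vol_pos[of j] nu_pos by (simp add: mult.assoc flip: ennreal_mult)
      also have "\<dots> \<le> ennreal (shell_bound (rad j) i * (vol j * (var_const * real (2 ^ i * rad j) ^ DIM('a))))"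
        using shell_bound_nonneg vol_pos[of j] rad_pos[of j]
        by (intro ennreal_leI mult_left_mono var_const_le) auto
      also have "shell_bound (rad j) i * (vol j * (var_const * real (2 ^ i * rad j) ^ DIM('a))) =
        vol j * var_const * (shell_bound (rad j) i * real (2 ^ i * rad j) ^ DIM('a))"
        by (simp only: ac_simps)
      also have "\<dots> = vol j * var_const * real (rad j) powr (real DIM('a) - \<beta>) * (shell_bound 1 i * real (2 ^ i) ^ DIM('a))"
        by (simp only: shell_bound_scale[OF rad_pos] mult.assoc)
      finally show "(\<integral>\<^sup>+\<eta>. ennreal (shell_bound (rad j) i * local_sum nbr_count (side j) ?r \<eta>) \<partial>PP) \<le>
        ennreal (vol j * var_const * real (rad j) powr (real DIM('a) - \<beta>) * (shell_bound 1 i * real (2 ^ i) ^ DIM('a)))" .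
    qed
    also have "\<dots> = ennreal (vol j * var_const * real (rad j) powr (real DIM('a) - \<beta>) * Z)"
      unfolding Z_def using vol_pos[of j] var_const_nonneg shell_bound_nonneg summable_shells
      by (subst suminf_ennreal2) (auto simp: suminf_mult intro!: summable_mult mult_nonneg_nonneg)
    also have "\<dots> * ennreal (1 / vol j) = ennreal (var_const * Z * real (rad j) powr (real DIM('a) - \<beta>))"
      using vol_pos[of j] var_const_nonneg Z by (simp add: ac_simps flip: ennreal_mult)
    also have "\<dots> \<le> ennreal (var_const * Z * (1 / real (Suc j) ^ 2))"
      using var_const_nonneg Z by (intro ennreal_leI mult_left_mono rad_decay) auto
    finally show ?thesis by (simp add: mult_right_mono)
  qed
qed

text \<open>The range may vary with \<open>j\<close>; its bound by \<open>rad j\<close> keeps the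
  normalized variances summable. Used at range \<open>rad j\<close> for the quenched means and at
  range 1 for the number of points.\<close>

lemma AE_local_sum_tendsto:
  assumes F: "disc_continuous F" "translation_invariant F"
    and bnd: "\<And>X x. finite X \<Longrightarrow> x \<in> X \<Longrightarrow> 0 \<le> F X x \<and> F X x \<le> 1"
    and r: "\<And>j. 0 < r j \<and> r j \<le> rad j"
    and lim: "(\<lambda>j. palm_local F (r j)) \<longlonglongrightarrow> a"
  shows "AE \<eta> in PP. (\<lambda>j. local_sum F (side j) (r j) \<eta> / vol j) \<longlonglongrightarrow> \<nu> * a"
proof -
  let ?m = "\<lambda>j. vol j * \<nu> * palm_local F (r j)"
  have "AE \<eta> in PP. (\<lambda>j. (local_sum F (side j) (r j) \<eta> - ?m j) ^ 2 / vol j ^ 2) \<longlonglongrightarrow> 0"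
  proof (rule AE_tendsto_0[OF _ _ _ suminf_inverse_square_finite[OF var_const_nonneg]])
    fix j
    have meas: "(\<lambda>\<eta>. (local_sum F (side j) (r j) \<eta> - ?m j) ^ 2) \<in> borel_measurable PP"
      using r by (intro borel_measurable_power borel_measurable_diff local_sum_measurable F borel_measurable_const) auto
    then show "(\<lambda>\<eta>. (local_sum F (side j) (r j) \<eta> - ?m j) ^ 2 / vol j ^ 2) \<in> borel_measurable PP"
      by (intro borel_measurable_divide borel_measurable_const)
    have "r j > 0" "r j \<le> rad j" using r by auto
    then show "(\<integral>\<^sup>+\<eta>. ennreal ((local_sum F (side j) (r j) \<eta> - ?m j) ^ 2 / vol j ^ 2) \<partial>PP) \<le> ennreal (var_const * (1 / real (Suc j) ^ 2))"
      using vol_pos[of j] var_const_vol_le[of "r j" j] second_moment_local_sum[OF F _ bnd, of "r j" "side j"]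
      by (intro nn_integral_divide_le[OF meas]) (simp_all add: vol_def side_pos)
  qed simp
  then show ?thesis
  proof eventually_elim
    case (elim \<eta>)
    have "(\<lambda>j. sqrt ((local_sum F (side j) (r j) \<eta> - ?m j) ^ 2 / vol j ^ 2)) \<longlonglongrightarrow> sqrt 0"
      by (intro tendsto_real_sqrt elim)
    moreover have "sqrt ((local_sum F (side j) (r j) \<eta> - ?m j) ^ 2 / vol j ^ 2) =
        \<bar>local_sum F (side j) (r j) \<eta> / vol j - \<nu> * palm_local F (r j)\<bar>" for j
      using vol_pos[of j] by (simp add: diff_divide_distrib flip: power_divide)
    ultimately have "(\<lambda>j. local_sum F (side j) (r j) \<eta> / vol j - \<nu> * palm_local F (r j)) \<longlonglongrightarrow> 0"
      by (simp add: tendsto_rabs_zero_iff)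
    from tendsto_add[OF this tendsto_mult[OF tendsto_const[of \<nu>] lim]] show ?case by simp
  qed
qed

lemma AE_card_tendsto: "AE \<eta> in PP. (\<lambda>j. real (card (\<eta> \<inter> window (side j) 0)) / vol j) \<longlonglongrightarrow> \<nu>"
proof -
  have "palm_local (\<lambda>_ _. 1) K = 1" for K by (simp add: palm_local_def prob_space)
  then have lim: "(\<lambda>j. palm_local (\<lambda>_ _. 1) 1) \<longlonglongrightarrow> 1" by simp
  have "AE \<eta> in PP. (\<lambda>j. local_sum (\<lambda>_ _. 1) (side j) 1 \<eta> / vol j) \<longlonglongrightarrow> \<nu> * 1"
    using rad_pos
    by (intro AE_local_sum_tendsto[where r = "\<lambda>_. 1"] lim disc_continuous_const translation_invariant_const)
      (auto simp: Suc_le_eq)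
  then show ?thesis by (simp only: local_sum_one mult_1_right)
qed

lemma filterlim_rad: "filterlim rad at_top sequentially"
proof -
  \<comment> \<open>For exponent 0 the defining inequality would read
    \<open>0 \<ge> 2\<close>.\<close>
  have "range_exp > 0"
    using range_exp by (cases range_exp) auto
  then have "j \<le> rad j" for j
    unfolding rad_def using self_le_power[of "Suc j" range_exp] by linarith
  then show ?thesis
    by (rule filterlim_at_top_mono[OF filterlim_ident always_eventually, OF allI])
qed

lemma AE_mean_val_sum_tendsto:
  "AE \<eta> in PP. (\<lambda>j. local_sum (mean_val CC) (side j) (rad j) \<eta> / vol j) \<longlonglongrightarrow> \<nu> * expectation palm_val"
proof (rule AE_local_sum_tendsto)
  show "(\<lambda>j. palm_local (mean_val CC) (rad j)) \<longlonglongrightarrow> expectation palm_val"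
    by (rule filterlim_compose[OF palm_local_tendsto filterlim_rad])
qed (auto simp: rad_pos disc_continuous_mean_val translation_invariant_mean_val graph_invariant_CC
    mean_val_range[OF _ CC_range, THEN conjunct1] mean_val_range[OF _ CC_range, THEN conjunct2])

text \<open>Joins the two layers: the configuration controls the quenched means, and given such a
  configuration the graph concentrates around them.\<close>

lemma AE_CC_sum_tendsto:
  "AE \<eta> in PP. AE G in Q \<eta>. (\<lambda>j. CC_sum \<eta> G (side j) / vol j) \<longlonglongrightarrow> \<nu> * expectation palm_val"
  using AE_mean_val_sum_tendsto AE_near AE_far AE_space
proof eventually_elim
  case (elim \<eta>)
  have "AE G in Q \<eta>. (\<lambda>j. CC_sum \<eta> G (side j) / vol j - local_sum (mean_val CC) (side j) (rad j) \<eta> / vol j) \<longlonglongrightarrow> 0"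
    using elim by (intro quenched_concentration rad_pos vol_pos) (auto simp: space_PP less_top)
  then show ?case
  proof eventually_elim
    case (elim G)
    from tendsto_add[OF this \<open>(\<lambda>j. local_sum (mean_val CC) (side j) (rad j) \<eta> / vol j) \<longlonglongrightarrow> _\<close>]
    show ?case by simp
  qed
qed

text \<open>Polynomial growth of the windows is what counts; geometric growth would leave a ratio
  above 1 and the sandwich between scales would not close.\<close>

lemma vol_ratio: "(\<lambda>j. vol (Suc j) / vol j) \<longlonglongrightarrow> 1"
proof -
  have "(\<lambda>j. (real (Suc (Suc j)) / real (Suc j)) ^ ((range_exp + 2) * DIM('a))) \<longlonglongrightarrow> 1 ^ ((range_exp + 2) * DIM('a))"
    by (intro tendsto_power LIMSEQ_Suc[OF LIMSEQ_Suc_n_over_n])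
  moreover have "(real (Suc (Suc j)) / real (Suc j)) ^ ((range_exp + 2) * DIM('a)) = vol (Suc j) / vol j" for j
    unfolding vol_def side_def
    by (simp only: of_nat_power power_mult_distrib power_mult power_divide) (simp del: of_nat_Suc)
  ultimately show ?thesis by simp
qed

lemma CC_avg_tendsto:
  "AE \<eta> in PP. AE G in Q \<eta>. CC_avg \<eta> (edge_set \<eta> G) \<longlonglongrightarrow> expectation palm_val"
  using AE_CC_sum_tendsto AE_card_tendsto AE_space
proof eventually_elim
  case (elim \<eta>)
  have lf: "locally_finite \<eta>" using elim by (simp add: space_PP)
  have fin_box: "finite (\<eta> \<inter> box_n n)" for n
    using lf by (simp add: locally_finite_def box_n_def)
  note fin_win = locally_finite_window[OF lf]
  show ?case
    using elim(1)
  proof eventually_elim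
    case (elim G)
    show ?case
      unfolding CC_avg_def
    proof (rule ratio_sandwich[where k = side and H = vol and S = "\<lambda>j. CC_sum \<eta> G (side j)" and \<nu> = \<nu>])
      show "incseq side"
        unfolding side_def by (intro monoI power_mono) auto
      show "j \<le> side j" for j
        unfolding side_def using self_le_power[of "Suc j" "range_exp + 2"] by linarith
      show "0 \<le> CC_sum \<eta> G (side j)" for j
        unfolding CC_sum_def by (intro sum_nonneg CC_nonneg)
      fix j n assume n: "2 * side j \<le> n" "n < 2 * side (Suc j)"
      have sub: "\<eta> \<inter> window (side j) 0 \<subseteq> \<eta> \<inter> box_n n" "\<eta> \<inter> box_n n \<subseteq> \<eta> \<inter> window (side (Suc j)) 0"
        using window_subset_box_n[OF n(1)] box_n_subset_window[OF n(2)] by auto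
      show "CC_sum \<eta> G (side j) \<le> (\<Sum>x\<in>\<eta> \<inter> box_n n. CC (edge_set \<eta> G) x) \<and>
        (\<Sum>x\<in>\<eta> \<inter> box_n n. CC (edge_set \<eta> G) x) \<le> CC_sum \<eta> G (side (Suc j)) \<and>
        real (card (\<eta> \<inter> window (side j) 0)) \<le> real (card (\<eta> \<inter> box_n n)) \<and>
        real (card (\<eta> \<inter> box_n n)) \<le> real (card (\<eta> \<inter> window (side (Suc j)) 0))"
        unfolding CC_sum_def of_nat_le_iff
        by (intro conjI sum_mono2 card_mono fin_box fin_win sub CC_nonneg)
    qed (fact vol_pos vol_ratio elim nu_pos \<open>(\<lambda>j. real (card (\<eta> \<inter> window (side j) 0)) / vol j) \<longlonglongrightarrow> \<nu>\<close>)+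
  qed
qed

end

theorem theorem2p5:
  fixes \<nu> \<alpha> \<tau> :: real
    and L :: "real \<Rightarrow> real"
    and Wt :: "real measure"
    and PP :: "'a::euclidean_space set measure"
  assumes "\<nu> > 0" and "\<tau> > 1"
    and "poisson_process_law \<nu> PP"
    and "slowly_varying L"
    and "weight_distribution \<tau> L Wt"
    and "\<alpha> > real DIM('a)"
    and "\<alpha> * (\<tau> - 1) / real DIM('a) > 1"
  shows "(AE \<eta> in PP. AE G in quenched_law \<alpha> Wt \<eta>.
            CC_avg \<eta> (edge_set \<eta> G) \<longlonglongrightarrow>
              palm_expectation PP \<alpha> Wt (\<lambda>\<eta>0 G0. CC (edge_set \<eta>0 G0) 0)) \<and>
         palm_expectation PP \<alpha> Wt (\<lambda>\<eta>0 G0. CC (edge_set \<eta>0 G0) 0) > 0"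
proof -
  obtain \<beta> B :: real where decay: "\<beta> > real DIM('a)" "B \<ge> 0"
    "\<And>\<eta> x y. x \<in> \<eta> \<Longrightarrow> y \<in> \<eta> \<Longrightarrow> x \<noteq> (y::'a) \<Longrightarrow>
      emeasure (quenched_law \<alpha> Wt \<eta>) {G \<in> space (quenched_law \<alpha> Wt \<eta>). snd G {x, y}}
        \<le> ennreal (B * norm (x - y) powr (- \<beta>))"
    by (rule edge_decay[OF assms(5,4,2,6,7)]) blast
  have "real_distribution Wt" "AE w in Wt. 0 < w"
    using assms(5) by (auto simp: weight_distribution_def)
  then interpret scale_free \<nu> PP \<alpha> Wt \<beta> B
    using assms(1,3) decay
    by (intro scale_free.intro poisson_process.intro weighted_graph.intro scale_free_axioms.intro)
  show ?thesis
    unfolding palm_expectation_eq using CC_avg_tendsto palm_pos by blast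
qed

end
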